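(* Let $K$ be an algebraically closed field, $r\ge2$ and $L\ge1$ integers, $Q$ the quiver with one vertex and $r$ loops, and $\Lambda=KQ/\langle\text{all paths of length }L+1\rangle$. Let $d$ be a positive integer and let $\mathbb S=(\mathbb S_0,\dots,\mathbb S_L)$ be a $d$-dimensional semisimple sequence with $\dim\mathbb S_l\le r\cdot\dim\mathbb S_{l-1}$ and $\dim\mathbb S_{l-1}\le r\cdot\dim\mathbb S_l$ for $1\le l\le L$, and let $\sigma$ be any skeleton with radical layering $\mathbb S$. Let $P$ be the fixed projective cover of $\mathbb S_0$ containing $\sigma$. Then, generically, the modules in the irreducible component $\mathcal C=\overline{\mathbf{Rep}\,\mathbb S}$ of $\mathbf{Rep}_d(\Lambda)$ have a minimal projective presentation of the form $P/U(c)$. In fact, there is a dense open subset $\mathfrak U$ of $\mathcal C$ such that the modules in $\mathfrak U$ are precisely those isomorphic to $P/U(c)$, where $c=(c_{uz_i,qz_j})$ traces the affine $K$-space of dimension $$N=\bigl|\{(uz_i,qz_j)\mid uz_i \text{ a } \sigma\text{-critical path},\ qz_j\in\sigma(uz_i)\}\bigr|.$$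
   Context: Modules are finite dimensional left $\Lambda$-modules; $J$ is the Jacobson radical of $\Lambda$, so $J^{L+1}=0$. Isomorphic semisimple modules are identified. A semisimple sequence is a sequence $\mathbb S=(\mathbb S_0,\dots,\mathbb S_L)$ of finite dimensional semisimple modules; its dimension is $\sum_l\dim\mathbb S_l$. The radical layering of $M$ is $\mathbb S(M)=(J^lM/J^{l+1}M)_{0\le l\le L}$. $\mathbf{Rep}_d(\Lambda)$ is the affine variety of $r$-tuples $(A_1,\dots,A_r)$ of $d\times d$ matrices over $K$ such that all $(L+1)$-fold products of the $A_i$ vanish; a point $x=(A_i)$ corresponds to the module $M_x$ on $K^d$ on which the $i$-th loop acts as $A_i$. $\mathbf{Rep}\,\mathbb S$ is the locally closed subset of points $x$ with $\mathbb S(M_x)=\mathbb S$; bars denote closures in $\mathbf{Rep}_d(\Lambda)$. The modules in a subset $\mathfrak U$ of $\mathbf{Rep}_d(\Lambda)$ are the $M_x$, $x\in\mathfrak U$ (up to isomorphism); the modules in an irreducible subset generically have a property if all modules in some dense open subset of it have the property. Skeleta. Let $t=\dim\mathbb S_0$ and let $P=\bigoplus_{1\le i\le t}\Lambda z_i$ be free of rank $t$ with basis $z_1,\dots,z_t$ (a projective cover of $\mathbb S_0$). A path in $P$ is a nonzero element $pz_i$, with $p$ a path in $Q$ (of length $\ge0$); its length is that of $p$ (so it is at most $L$). Paths are composed from right to left: if $p=p_2p_1$ with paths $p_1,p_2$, then $p_1z_i$ is an initial subpath of $pz_i$, proper if $p_2$ has positive length. A skeleton with radical layering $\mathbb S$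 is a set $\sigma$ of paths in $P$ which is closed under initial subpaths and such that, for every $l\in\{0,\dots,L\}$, the number of paths of length $l$ in $\sigma$ equals $\dim\mathbb S_l$. A path $uz_i$ in $P$ is $\sigma$-critical if $uz_i\notin\sigma$ while all its proper initial subpaths belong to $\sigma$. For a $\sigma$-critical path $uz_i$, put $\sigma(uz_i)=\{qz_j\in\sigma\mid \mathrm{length}(q)\ge\mathrm{length}(u)\}$. For a family of scalars $c=(c_{uz_i,qz_j})$ in $K$, indexed by the pairs with $uz_i$ $\sigma$-critical and $qz_j\in\sigma(uz_i)$, let $U(c)$ be the submodule of $P$ generated by the elements $$uz_i-\sum_{qz_j\in\sigma(uz_i)}c_{uz_i,qz_j}\,qz_j,\qquad uz_i\ \ \sigma\text{-critical}.$$ *)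

theory Defs
  imports "HOL-Analysis.Analysis" "HOL-Library.Sublist" "HOL-Algebra.Module" "HOL-Algebra.QuotRing"
begin

section \<open>Left modules over a ring\<close>

text \<open>The locale \<open>module\<close> of HOL-Algebra requires a commutative ring of scalars.
  Only its record type and the locale \<open>submodule\<close>, which does not, are used here.
  The multiplicative fields of the record play no role for modules.\<close>

locale left_module = R?: ring R + M?: abelian_group M
  for R :: "('a, 'm) ring_scheme" (structure) and M :: "('a, 'b, 'n) module_scheme" (structure) +
  assumes smult_closed:
      "a \<in> carrier R \<Longrightarrow> x \<in> carrier M \<Longrightarrow> a \<odot>\<^bsub>M\<^esub> x \<in> carrier M"
    and smult_l_distr: "a \<in> carrier R \<Longrightarrow> b \<in> carrier R \<Longrightarrow> x \<in> carrier M \<Longrightarrow>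
      (a \<oplus>\<^bsub>R\<^esub> b) \<odot>\<^bsub>M\<^esub> x = a \<odot>\<^bsub>M\<^esub> x \<oplus>\<^bsub>M\<^esub> b \<odot>\<^bsub>M\<^esub> x"
    and smult_r_distr: "a \<in> carrier R \<Longrightarrow> x \<in> carrier M \<Longrightarrow> y \<in> carrier M \<Longrightarrow>
      a \<odot>\<^bsub>M\<^esub> (x \<oplus>\<^bsub>M\<^esub> y) = a \<odot>\<^bsub>M\<^esub> x \<oplus>\<^bsub>M\<^esub> a \<odot>\<^bsub>M\<^esub> y"
    and smult_assoc: "a \<in> carrier R \<Longrightarrow> b \<in> carrier R \<Longrightarrow> x \<in> carrier M \<Longrightarrow>
      (a \<otimes>\<^bsub>R\<^esub> b) \<odot>\<^bsub>M\<^esub> x = a \<odot>\<^bsub>M\<^esub> (b \<odot>\<^bsub>M\<^esub> x)"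
    and smult_one: "x \<in> carrier M \<Longrightarrow> \<one>\<^bsub>R\<^esub> \<odot>\<^bsub>M\<^esub> x = x"

definition generated_submodule ::
    "('a, 'm) ring_scheme \<Rightarrow> ('a, 'b, 'n) module_scheme \<Rightarrow> 'b set \<Rightarrow> 'b set" where
  "generated_submodule R M X = \<Inter>{H. submodule H R M \<and> X \<subseteq> H}"

definition quotient_module :: "('a, 'b, 'n) module_scheme \<Rightarrow> 'b set \<Rightarrow> ('a, 'b set) module" where
  "quotient_module M U =
    \<lparr>carrier = a_rcosets\<^bsub>M\<^esub> U, mult = (\<lambda>_ _. undefined), one = undefined, zero = U,
     add = set_add M, smult = (\<lambda>a X. \<Union>x\<in>X. U +>\<^bsub>M\<^esub> (a \<odot>\<^bsub>M\<^esub> x))\<rparr>"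

definition module_iso ::
    "('a, 'm) ring_scheme \<Rightarrow> ('a, 'b, 'n) module_scheme \<Rightarrow> ('a, 'c, 'o) module_scheme \<Rightarrow> bool" where
  "module_iso R M N \<longleftrightarrow> (\<exists>f. f \<in> iso (add_monoid M) (add_monoid N) \<and>
     (\<forall>a\<in>carrier R. \<forall>x\<in>carrier M. f (a \<odot>\<^bsub>M\<^esub> x) = a \<odot>\<^bsub>N\<^esub> f x))"

definition free_module :: "('a, 'm) ring_scheme \<Rightarrow> nat \<Rightarrow> ('a, nat \<Rightarrow> 'a) module" where
  "free_module R t =
    \<lparr>carrier = {..<t} \<rightarrow>\<^sub>E carrier R, mult = (\<lambda>_ _. undefined), one = undefined,
     zero = (\<lambda>j\<in>{..<t}. \<zero>\<^bsub>R\<^esub>), add = (\<lambda>v w. \<lambda>j\<in>{..<t}. v j \<oplus>\<^bsub>R\<^esub> w j),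
     smult = (\<lambda>a v. \<lambda>j\<in>{..<t}. a \<otimes>\<^bsub>R\<^esub> v j)\<rparr>"

definition free_basis :: "('a, 'm) ring_scheme \<Rightarrow> nat \<Rightarrow> nat \<Rightarrow> nat \<Rightarrow> 'a" where
  "free_basis R t i = (\<lambda>j\<in>{..<t}. if j = i then \<one>\<^bsub>R\<^esub> else \<zero>\<^bsub>R\<^esub>)"

definition superfluous ::
    "('a, 'm) ring_scheme \<Rightarrow> ('a, 'b, 'n) module_scheme \<Rightarrow> 'b set \<Rightarrow> bool" where
  "superfluous R M U \<longleftrightarrow> submodule U R M \<and>
     (\<forall>X. submodule X R M \<and> U <+>\<^bsub>M\<^esub> X = carrier M \<longrightarrow> X = carrier M)"

text \<open>The modules \<open>P\<close> to which this is applied are free, so it says that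
  \<open>P \<longrightarrow> P/U \<cong> M\<close> is a projective cover.\<close>

definition minimal_presentation ::
    "('a, 'm) ring_scheme \<Rightarrow> ('a, 'b, 'n) module_scheme \<Rightarrow> 'b set \<Rightarrow> ('a, 'c, 'o) module_scheme \<Rightarrow> bool" where
  "minimal_presentation R P U M \<longleftrightarrow> superfluous R P U \<and> module_iso R M (quotient_module P U)"

definition left_ideal :: "'a set \<Rightarrow> ('a, 'm) ring_scheme \<Rightarrow> bool" where
  "left_ideal I R \<longleftrightarrow> additive_subgroup I R \<and> (\<forall>a\<in>carrier R. \<forall>x\<in>I. a \<otimes>\<^bsub>R\<^esub> x \<in> I)"

definition maximal_left_ideal :: "'a set \<Rightarrow> ('a, 'm) ring_scheme \<Rightarrow> bool" where
  "maximal_left_ideal I R \<longleftrightarrow> left_ideal I R \<and> I \<noteq> carrier R \<and>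
     (\<forall>I'. left_ideal I' R \<and> I \<subseteq> I' \<longrightarrow> I' = I \<or> I' = carrier R)"

definition jacobson_radical :: "('a, 'm) ring_scheme \<Rightarrow> 'a set" where
  "jacobson_radical R = carrier R \<inter> \<Inter>{I. maximal_left_ideal I R}"

text \<open>The submodule \<open>J\<^sup>l M\<close>, via \<open>J\<^sup>0 M = M\<close> and \<open>J\<^sup>l\<^sup>+\<^sup>1 M = J (J\<^sup>l M)\<close>.\<close>

definition radical_power ::
    "('a, 'm) ring_scheme \<Rightarrow> ('a, 'b, 'n) module_scheme \<Rightarrow> nat \<Rightarrow> 'b set" where
  "radical_power R M l =
     ((\<lambda>N. generated_submodule R M {a \<odot>\<^bsub>M\<^esub> x | a x. a \<in> jacobson_radical R \<and> x \<in> N}) ^^ l)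
       (carrier M)"


section \<open>The truncated path algebra of a quiver with one vertex\<close>

text \<open>The loops are the elements of the finite type \<open>'r\<close>. A path is the word of its loops, written
  as in the convention of composing from right to left: the path \<open>p\<^sub>2p\<^sub>1\<close> is \<open>p\<^sub>2 @ p\<^sub>1\<close>, and the
  initial subpaths of a path are the suffixes of the word.
  An element of the path algebra is the family of its coefficients.\<close>

definition path_conv :: "('r list \<Rightarrow> 'k::field) \<Rightarrow> ('r list \<Rightarrow> 'k) \<Rightarrow> 'r list \<Rightarrow> 'k" where
  "path_conv f g p = (\<Sum>k\<le>length p. f (take k p) * g (drop k p))"

definition path_vec :: "'r list \<Rightarrow> 'k::field \<Rightarrow> 'r list \<Rightarrow> 'k" where
  "path_vec p a = (\<lambda>q. if q = p then a else 0)"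

definition path_algebra :: "('r list \<Rightarrow> 'k::field) ring" where
  "path_algebra =
    \<lparr>carrier = {f. finite {p. f p \<noteq> 0}}, mult = path_conv, one = path_vec [] 1,
     zero = (\<lambda>_. 0), add = (\<lambda>f g p. f p + g p)\<rparr>"

text \<open>The quotient of the path algebra by the ideal generated by all paths of length \<open>L + 1\<close>, on its
  basis of the paths of length at most \<open>L\<close>; see \<open>path_algebra_quotient_iso\<close> below.\<close>

definition trunc_path_algebra :: "nat \<Rightarrow> ('r list \<Rightarrow> 'k::field) ring" where
  "trunc_path_algebra L =
    \<lparr>carrier = {f. \<forall>p. L < length p \<longrightarrow> f p = 0},
     mult = (\<lambda>f g p. if length p \<le> L then path_conv f g p else 0), one = path_vec [] 1,
     zero = (\<lambda>_. 0), add = (\<lambda>f g p. f p + g p)\<rparr>"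


section \<open>The variety of representations\<close>

text \<open>Points of the affine space of tuples of matrices have type \<open>'r \<Rightarrow> 'k^'d^'d\<close>.
  Over an infinite field polynomials may be identified with polynomial functions.\<close>

inductive_set polynomial_funs :: "(('r \<Rightarrow> 'k::field ^ 'd ^ 'd) \<Rightarrow> 'k) set" where
  const: "(\<lambda>_. a) \<in> polynomial_funs"
| coord: "(\<lambda>x. x s $ i $ j) \<in> polynomial_funs"
| add: "f \<in> polynomial_funs \<Longrightarrow> g \<in> polynomial_funs \<Longrightarrow> (\<lambda>x. f x + g x) \<in> polynomial_funs"
| mult: "f \<in> polynomial_funs \<Longrightarrow> g \<in> polynomial_funs \<Longrightarrow> (\<lambda>x. f x * g x) \<in> polynomial_funs"

definition zariski_closed :: "('r \<Rightarrow> 'k::field ^ 'd ^ 'd) set \<Rightarrow> bool" where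
  "zariski_closed Z \<longleftrightarrow> (\<exists>F \<subseteq> polynomial_funs. Z = {x. \<forall>f\<in>F. f x = 0})"

definition zariski :: "('r \<Rightarrow> 'k::field ^ 'd ^ 'd) topology" where
  "zariski = topology (\<lambda>U. zariski_closed (- U))"

definition path_matrix :: "('r \<Rightarrow> 'k::field ^ 'd ^ 'd) \<Rightarrow> 'r list \<Rightarrow> 'k ^ 'd ^ 'd" where
  "path_matrix x p = foldr (\<lambda>s B. x s ** B) p (mat 1)"

definition rep_variety :: "nat \<Rightarrow> ('r \<Rightarrow> 'k::field ^ 'd ^ 'd) set" where
  "rep_variety L = {x. \<forall>p. length p = L + 1 \<longrightarrow> path_matrix x p = 0}"

definition rep_module ::
    "nat \<Rightarrow> ('r::finite \<Rightarrow> 'k::field ^ 'd ^ 'd) \<Rightarrow> ('r list \<Rightarrow> 'k, 'k ^ 'd) module" where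
  "rep_module L x =
    \<lparr>carrier = UNIV, mult = (\<lambda>_ _. undefined), one = undefined, zero = 0, add = (+),
     smult = (\<lambda>f v. \<Sum>p | length p \<le> L. f p *s (path_matrix x p *v v))\<rparr>"

definition rep_topology :: "nat \<Rightarrow> ('r \<Rightarrow> 'k::field ^ 'd ^ 'd) topology" where
  "rep_topology L = subtopology zariski (rep_variety L)"

text \<open>The algebra has just one simple module, which is one-dimensional. So a finite-dimensional
  semisimple module is, up to isomorphism, its dimension, and a semisimple sequence is the sequence
  \<open>S 0, \<dots>, S L\<close> of the dimensions of its terms.\<close>

definition rep_layer :: "nat \<Rightarrow> (nat \<Rightarrow> nat) \<Rightarrow> ('r::finite \<Rightarrow> 'k::field ^ 'd ^ 'd) set" where
  "rep_layer L S = {x \<in> rep_variety L. \<forall>l\<le>L.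
     vec.dim (radical_power (trunc_path_algebra L) (rep_module L x) l) =
     S l + vec.dim (radical_power (trunc_path_algebra L) (rep_module L x) (l + 1))}"

definition irreducible_subset :: "'a topology \<Rightarrow> 'a set \<Rightarrow> bool" where
  "irreducible_subset T A \<longleftrightarrow> A \<subseteq> topspace T \<and> A \<noteq> {} \<and>
     (\<forall>F G. closedin T F \<and> closedin T G \<and> A \<subseteq> F \<union> G \<longrightarrow> A \<subseteq> F \<or> A \<subseteq> G)"

definition irreducible_component :: "'a topology \<Rightarrow> 'a set \<Rightarrow> bool" where
  "irreducible_component T C \<longleftrightarrow> irreducible_subset T C \<and>
     (\<forall>B. irreducible_subset T B \<and> C \<subseteq> B \<longrightarrow> B = C)"

definition dense_open_in :: "'a topology \<Rightarrow> 'a set \<Rightarrow> 'a set \<Rightarrow> bool" where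
  "dense_open_in T C V \<longleftrightarrow>
     openin (subtopology T C) V \<and> subtopology T C closure_of V = topspace (subtopology T C)"

definition generically :: "'a topology \<Rightarrow> 'a set \<Rightarrow> ('a \<Rightarrow> bool) \<Rightarrow> bool" where
  "generically T C Q \<longleftrightarrow> (\<exists>V. dense_open_in T C V \<and> (\<forall>x\<in>V. Q x))"


section \<open>Skeleta\<close>

text \<open>The pair \<open>(p, i)\<close> stands for the path \<open>p z\<^sub>i\<close> in the free module with basis
  \<open>z\<^sub>0, \<dots>, z\<^sub>t\<^sub>-\<^sub>1\<close>, which is nonzero if and only if \<open>p\<close> has length at most \<open>L\<close>.\<close>

definition paths_in :: "nat \<Rightarrow> nat \<Rightarrow> ('r list \<times> nat) set" where
  "paths_in L t = {(p, i). length p \<le> L \<and> i < t}"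

definition path_elem :: "nat \<Rightarrow> nat \<Rightarrow> 'r list \<times> nat \<Rightarrow> nat \<Rightarrow> 'r list \<Rightarrow> 'k::field" where
  "path_elem L t = (\<lambda>(p, i).
     path_vec p 1 \<odot>\<^bsub>free_module (trunc_path_algebra L) t\<^esub> free_basis (trunc_path_algebra L) t i)"

definition skeleton :: "nat \<Rightarrow> (nat \<Rightarrow> nat) \<Rightarrow> ('r list \<times> nat) set \<Rightarrow> bool" where
  "skeleton L S \<sigma> \<longleftrightarrow> \<sigma> \<subseteq> paths_in L (S 0) \<and>
     (\<forall>p i q. (p, i) \<in> \<sigma> \<and> suffix q p \<longrightarrow> (q, i) \<in> \<sigma>) \<and>
     (\<forall>l\<le>L. card {(p, i) \<in> \<sigma>. length p = l} = S l)"

definition critical :: "nat \<Rightarrow> nat \<Rightarrow> ('r list \<times> nat) set \<Rightarrow> ('r list \<times> nat) set" where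
  "critical L t \<sigma> =
     {(u, i) \<in> paths_in L t. (u, i) \<notin> \<sigma> \<and> (\<forall>q. strict_suffix q u \<longrightarrow> (q, i) \<in> \<sigma>)}"

definition sigma_above :: "('r list \<times> nat) set \<Rightarrow> 'r list \<times> nat \<Rightarrow> ('r list \<times> nat) set" where
  "sigma_above \<sigma> y = {z \<in> \<sigma>. length (fst z) \<ge> length (fst y)}"

definition coord_pairs ::
    "nat \<Rightarrow> nat \<Rightarrow> ('r list \<times> nat) set \<Rightarrow> (('r list \<times> nat) \<times> ('r list \<times> nat)) set" where
  "coord_pairs L t \<sigma> = (SIGMA y : critical L t \<sigma>. sigma_above \<sigma> y)"

definition critical_relation :: "nat \<Rightarrow> nat \<Rightarrow> ('r list \<times> nat) set \<Rightarrow>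
    (('r list \<times> nat) \<times> ('r list \<times> nat) \<Rightarrow> 'k::field) \<Rightarrow> 'r list \<times> nat \<Rightarrow> nat \<Rightarrow> 'r list \<Rightarrow> 'k" where
  "critical_relation L t \<sigma> c y =
     (let P = free_module (trunc_path_algebra L) t in
      path_elem L t y \<ominus>\<^bsub>P\<^esub>
        (\<Oplus>\<^bsub>P\<^esub>z\<in>sigma_above \<sigma> y. path_vec [] (c (y, z)) \<odot>\<^bsub>P\<^esub> path_elem L t z))"

definition relation_submodule :: "nat \<Rightarrow> nat \<Rightarrow> ('r list \<times> nat) set \<Rightarrow>
    (('r list \<times> nat) \<times> ('r list \<times> nat) \<Rightarrow> 'k::field) \<Rightarrow> (nat \<Rightarrow> 'r list \<Rightarrow> 'k) set" where
  "relation_submodule L t \<sigma> c =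
     generated_submodule (trunc_path_algebra L) (free_module (trunc_path_algebra L) t)
       (critical_relation L t \<sigma> c ` critical L t \<sigma>)"



section \<open>Basic facts\<close>

subsection \<open>The truncated path algebra as a quotient\<close>

lemma path_conv_assoc:
  "path_conv (path_conv f g) h p = path_conv f (path_conv g h) p"
proof -
  let ?F = "\<lambda>i m (r::nat). f (take i p) * (g (take m (drop i p)) * h (drop (i + m) p))"
  have "path_conv (path_conv f g) h p =
      (\<Sum>k = 0..length p. \<Sum>j = 0..k. ?F j (k - j) (length p - k))"
    unfolding path_conv_def atMost_atLeast0
    by (intro sum.cong refl)
       (auto simp: sum_distrib_right mult.assoc drop_take min_def intro!: sum.cong)
  also have "\<dots> = (\<Sum>j = 0..length p. \<Sum>i = 0..length p - j. ?F j i (length p - j - i))"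
    by (rule fps_mult_assoc_lemma)
  also have "\<dots> = path_conv f (path_conv g h) p"
    unfolding path_conv_def atMost_atLeast0
    by (intro sum.cong refl) (auto simp: sum_distrib_left add.commute)
  finally show ?thesis .
qed

lemma path_conv_one_left: "path_conv (path_vec [] 1) f p = f p"
proof -
  have "path_conv (path_vec [] 1) f p = (\<Sum>k\<le>length p. if k = 0 then f p else 0)"
    unfolding path_conv_def path_vec_def by (intro sum.cong) auto
  thus ?thesis by simp
qed

lemma path_conv_one_right: "path_conv f (path_vec [] 1) p = f p"
proof -
  have "path_conv f (path_vec [] 1) p = (\<Sum>k\<le>length p. if k = length p then f p else 0)"
    unfolding path_conv_def path_vec_def by (intro sum.cong) auto
  thus ?thesis by simp
qed

lemma path_conv_add_left: "path_conv (\<lambda>p. f p + g p) h p = path_conv f h p + path_conv g h p"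
  by (simp add: path_conv_def distrib_right sum.distrib)

lemma path_conv_add_right: "path_conv h (\<lambda>p. f p + g p) p = path_conv h f p + path_conv h g p"
  by (simp add: path_conv_def distrib_left sum.distrib)

lemma path_conv_path_vec: "path_conv (path_vec p a) (path_vec q b) = path_vec (p @ q) (a * b)"
proof
  fix s
  have "path_conv (path_vec p a) (path_vec q b) s =
      (\<Sum>k\<le>length s. if k = length p \<and> s = p @ q then a * b else 0)"
    unfolding path_conv_def path_vec_def
    by (intro sum.cong) (auto simp: min_def append_eq_conv_conj split: if_splits)
  also have "\<dots> = path_vec (p @ q) (a * b) s"
    by (auto simp: path_vec_def)
  finally show "path_conv (path_vec p a) (path_vec q b) s = path_vec (p @ q) (a * b) s" .
qed

lemma path_conv_cong:
  assumes "\<And>q. length q \<le> length p \<Longrightarrow> f q = f' q" "\<And>q. length q \<le> length p \<Longrightarrow> g q = g' q"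
  shows "path_conv f g p = path_conv f' g' p"
  unfolding path_conv_def using assms by (intro sum.cong) auto

lemma finite_support_path_conv:
  assumes "finite {p. f p \<noteq> 0}" "finite {p. g p \<noteq> 0}"
  shows "finite {p. path_conv f g p \<noteq> 0}"
proof (rule finite_subset)
  show "{p. path_conv f g p \<noteq> 0} \<subseteq> (\<lambda>(a, b). a @ b) ` ({p. f p \<noteq> 0} \<times> {p. g p \<noteq> 0})"
  proof
    fix p assume "p \<in> {p. path_conv f g p \<noteq> 0}"
    then obtain k where "f (take k p) * g (drop k p) \<noteq> 0"
      unfolding path_conv_def by (auto elim: sum.not_neutral_contains_not_neutral)
    then show "p \<in> (\<lambda>(a, b). a @ b) ` ({p. f p \<noteq> 0} \<times> {p. g p \<noteq> 0})"
      by (intro image_eqI[of _ _ "(take k p, drop k p)"]) auto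
  qed
  show "finite ((\<lambda>(a, b). a @ b) ` ({p. f p \<noteq> 0} \<times> {p. g p \<noteq> 0}))"
    using assms by blast
qed

lemma finite_path_vec: "finite {q. path_vec p a q \<noteq> 0}"
  by (rule finite_subset[of _ "{p}"]) (auto simp: path_vec_def)

lemma ring_path_algebra: "ring (path_algebra :: ('r list \<Rightarrow> 'k::field) ring)"
proof (rule ringI)
  show "abelian_group (path_algebra :: ('r list \<Rightarrow> 'k) ring)"
  proof (rule abelian_groupI)
    fix f g :: "'r list \<Rightarrow> 'k" assume "f \<in> carrier path_algebra" "g \<in> carrier path_algebra"
    moreover have "{p. f p + g p \<noteq> 0} \<subseteq> {p. f p \<noteq> 0} \<union> {p. g p \<noteq> 0}" by auto
    ultimately show "f \<oplus>\<^bsub>path_algebra\<^esub> g \<in> carrier path_algebra"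
      by (auto simp: path_algebra_def intro: finite_subset)
  next
    fix f :: "'r list \<Rightarrow> 'k" assume "f \<in> carrier path_algebra"
    then show "\<exists>g\<in>carrier path_algebra. g \<oplus>\<^bsub>path_algebra\<^esub> f = \<zero>\<^bsub>path_algebra\<^esub>"
      by (intro bexI[of _ "\<lambda>p. - f p"]) (auto simp: path_algebra_def)
  qed (auto simp: path_algebra_def algebra_simps)
  show "Group.monoid (path_algebra :: ('r list \<Rightarrow> 'k) ring)"
    by (rule monoidI)
       (auto simp: path_algebra_def path_conv_assoc path_conv_one_left path_conv_one_right
         finite_support_path_conv finite_path_vec fun_eq_iff)
qed (auto simp: path_algebra_def path_conv_add_left path_conv_add_right)

lemma path_vec_long: "L < length q \<Longrightarrow> path_vec [] a q = 0"
  by (auto simp: path_vec_def)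

lemma ring_trunc_path_algebra: "ring (trunc_path_algebra L :: ('r list \<Rightarrow> 'k::field) ring)"
proof (rule ringI)
  show "abelian_group (trunc_path_algebra L :: ('r list \<Rightarrow> 'k) ring)"
  proof (rule abelian_groupI)
    fix f :: "'r list \<Rightarrow> 'k" assume "f \<in> carrier (trunc_path_algebra L)"
    then show "\<exists>g\<in>carrier (trunc_path_algebra L).
        g \<oplus>\<^bsub>trunc_path_algebra L\<^esub> f = \<zero>\<^bsub>trunc_path_algebra L\<^esub>"
      by (intro bexI[of _ "\<lambda>p. - f p"]) (auto simp: trunc_path_algebra_def)
  qed (auto simp: trunc_path_algebra_def algebra_simps)
  show "Group.monoid (trunc_path_algebra L :: ('r list \<Rightarrow> 'k) ring)"
  proof (rule monoidI)
    fix f g h :: "'r list \<Rightarrow> 'k"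
    show "f \<otimes>\<^bsub>trunc_path_algebra L\<^esub> g \<otimes>\<^bsub>trunc_path_algebra L\<^esub> h =
        f \<otimes>\<^bsub>trunc_path_algebra L\<^esub> (g \<otimes>\<^bsub>trunc_path_algebra L\<^esub> h)"
    proof
      fix p
      have "path_conv (\<lambda>p. if length p \<le> L then path_conv f g p else 0) h p = path_conv (path_conv f g) h p"
        "path_conv f (\<lambda>p. if length p \<le> L then path_conv g h p else 0) p = path_conv f (path_conv g h) p"
        if "length p \<le> L" using that by (auto intro!: path_conv_cong)
      then show "(f \<otimes>\<^bsub>trunc_path_algebra L\<^esub> g \<otimes>\<^bsub>trunc_path_algebra L\<^esub> h) p =
          (f \<otimes>\<^bsub>trunc_path_algebra L\<^esub> (g \<otimes>\<^bsub>trunc_path_algebra L\<^esub> h)) p"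
        by (simp add: trunc_path_algebra_def path_conv_assoc)
    qed
  qed (auto simp: trunc_path_algebra_def path_conv_one_left path_conv_one_right path_vec_long fun_eq_iff)
qed (auto simp: trunc_path_algebra_def path_conv_add_left path_conv_add_right)

theorem path_algebra_quotient_iso:
  "(path_algebra :: ('r::finite list \<Rightarrow> 'k::field) ring) Quot
     (Idl\<^bsub>path_algebra\<^esub> {path_vec p 1 | p. length p = L + 1}) \<simeq>
   (trunc_path_algebra L :: ('r list \<Rightarrow> 'k) ring)"
proof -
  let ?A = "path_algebra :: ('r list \<Rightarrow> 'k) ring" and ?T = "trunc_path_algebra L :: ('r list \<Rightarrow> 'k) ring"
  let ?X = "{path_vec p 1 | p. length p = L + 1} :: ('r list \<Rightarrow> 'k) set"
  define h where "h = (\<lambda>(f :: 'r list \<Rightarrow> 'k) p. if length p \<le> L then f p else 0)"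
  interpret A: ring ?A by (rule ring_path_algebra)
  interpret H: ring_hom_ring ?A ?T h
  proof (rule ring_hom_ringI[OF ring_path_algebra ring_trunc_path_algebra])
    fix f g
    have "path_conv (h f) (h g) p = path_conv f g p" if "length p \<le> L" for p
      using that by (auto simp: h_def intro!: path_conv_cong)
    then show "h (f \<otimes>\<^bsub>?A\<^esub> g) = h f \<otimes>\<^bsub>?T\<^esub> h g"
      by (simp add: path_algebra_def trunc_path_algebra_def fun_eq_iff) (simp add: h_def)
  qed (auto simp: h_def path_algebra_def trunc_path_algebra_def path_vec_def)
  have vec_closed: "path_vec p a \<in> carrier ?A" for p a
    by (simp add: path_algebra_def finite_path_vec)
  have XA: "?X \<subseteq> carrier ?A" using vec_closed by blast
  interpret I: ideal "Idl\<^bsub>?A\<^esub> ?X" ?A by (rule A.genideal_ideal[OF XA])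
  have surj: "h ` carrier ?A = carrier ?T"
  proof
    show "carrier ?T \<subseteq> h ` carrier ?A"
    proof
      fix f assume f: "f \<in> carrier ?T"
      have "{p. f p \<noteq> 0} \<subseteq> {p. set p \<subseteq> UNIV \<and> length p \<le> L}"
        using f by (auto simp: trunc_path_algebra_def not_less[symmetric])
      then have "finite {p. f p \<noteq> 0}"
        by (rule finite_subset) (rule finite_lists_length_le, simp)
      moreover have "h f = f" using f by (auto simp: h_def trunc_path_algebra_def)
      ultimately show "f \<in> h ` carrier ?A" by (auto simp: path_algebra_def image_iff intro!: exI[of _ f])
    qed
  qed auto
  have ker: "f \<in> a_kernel ?A ?T h \<longleftrightarrow> f \<in> carrier ?A \<and> (\<forall>p. length p \<le> L \<longrightarrow> f p = 0)" for f
    by (auto simp: a_kernel_def' h_def trunc_path_algebra_def fun_eq_iff)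
  have "f \<in> Idl\<^bsub>?A\<^esub> ?X" if "finite D" "{p. f p \<noteq> 0} \<subseteq> D" "\<forall>p\<in>D. L < length p" for f :: "'r list \<Rightarrow> 'k" and D
    using that
  proof (induction D arbitrary: f rule: finite_induct)
    case empty
    then have "f = \<zero>\<^bsub>?A\<^esub>" by (auto simp: path_algebra_def)
    then show ?case using I.zero_closed by simp
  next
    case (insert p D)
    let ?g = "f(p := 0)"
    have 1: "?g \<in> Idl\<^bsub>?A\<^esub> ?X" using insert.prems by (intro insert.IH) (auto split: if_splits)
    have "path_vec (take (L + 1) p) 1 \<in> ?X" using insert.prems by auto
    then have "path_vec (take (L + 1) p) 1 \<otimes>\<^bsub>?A\<^esub> path_vec (drop (L + 1) p) (f p) \<in> Idl\<^bsub>?A\<^esub> ?X"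
      by (intro I.I_r_closed vec_closed subsetD[OF A.genideal_self[OF XA]])
    then have 2: "path_vec p (f p) \<in> Idl\<^bsub>?A\<^esub> ?X"
      by (simp add: path_algebra_def path_conv_path_vec)
    have "f = ?g \<oplus>\<^bsub>?A\<^esub> path_vec p (f p)" by (auto simp: path_algebra_def path_vec_def)
    then show ?case using I.a_closed[OF 1 2] by simp
  qed
  then have "f \<in> Idl\<^bsub>?A\<^esub> ?X" if "f \<in> a_kernel ?A ?T h" for f
    using that unfolding ker
    by (metis (mono_tags, lifting) linorder_not_le mem_Collect_eq path_algebra_def
        partial_object.select_convs(1) subsetI)
  moreover have "Idl\<^bsub>?A\<^esub> ?X \<subseteq> a_kernel ?A ?T h"
    by (intro A.genideal_minimal H.kernel_is_ideal) (auto simp: ker vec_closed, auto simp: path_vec_def)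
  ultimately have "a_kernel ?A ?T h = Idl\<^bsub>?A\<^esub> ?X" by blast
  then show ?thesis using H.FactRing_iso[OF surj] by simp
qed


subsection \<open>The modules\<close>

lemma path_matrix_append: "path_matrix x (p @ q) = path_matrix x p ** path_matrix x q"
  by (induction p) (simp_all add: path_matrix_def matrix_mul_assoc)

lemma path_matrix_eq_0:
  assumes "x \<in> rep_variety L" "L < length p"
  shows "path_matrix x p = 0"
proof -
  have "path_matrix x (take (L + 1) p) = 0" using assms by (auto simp: rep_variety_def)
  then show ?thesis using path_matrix_append[of x "take (L + 1) p" "drop (L + 1) p"]
    by (simp add: matrix_matrix_mult_def vec_eq_iff)
qed

lemma finite_short_paths: "finite {p :: 'r::finite list. length p \<le> L}"
  using finite_lists_length_le[of "UNIV :: 'r set" L] by simp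

lemma left_module_rep_module:
  fixes x :: "'r::finite \<Rightarrow> 'k::field ^ 'd::finite ^ 'd"
  assumes x: "x \<in> rep_variety L"
  shows "left_module (trunc_path_algebra L) (rep_module L x)"
proof -
  let ?T = "trunc_path_algebra L :: ('r list \<Rightarrow> 'k) ring" and ?M = "rep_module L x"
  have "abelian_group ?M"
    by (rule abelian_groupI) (auto simp: rep_module_def algebra_simps intro: exI[of _ "- _"])
  moreover have "(f \<otimes>\<^bsub>?T\<^esub> g) \<odot>\<^bsub>?M\<^esub> v = f \<odot>\<^bsub>?M\<^esub> (g \<odot>\<^bsub>?M\<^esub> v)" for f g v
  proof -
    let ?D = "{p :: 'r list. length p \<le> L}"
    let ?t = "\<lambda>(p, q). (f p * g q) *s (path_matrix x (p @ q) *v v)"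
    have "(f \<otimes>\<^bsub>?T\<^esub> g) \<odot>\<^bsub>?M\<^esub> v =
        (\<Sum>p\<in>?D. \<Sum>k\<le>length p. ?t (take k p, drop k p))"
      by (auto simp: rep_module_def trunc_path_algebra_def path_conv_def vec.scale_sum_left intro!: sum.cong)
    also have "\<dots> = (\<Sum>(p, k)\<in>Sigma ?D (\<lambda>p. {..length p}). ?t (take k p, drop k p))"
      by (subst sum.Sigma) (auto simp: finite_short_paths)
    also have "\<dots> = (\<Sum>y\<in>{(p, q). length p + length q \<le> L}. ?t y)"
      by (rule sum.reindex_bij_witness[where i = "\<lambda>(p, q). (p @ q, length p)"
            and j = "\<lambda>(p, k). (take k p, drop k p)"]) auto
    also have "\<dots> = (\<Sum>y\<in>?D \<times> ?D. ?t y)"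
    proof (rule sum.mono_neutral_left)
      show "\<forall>y\<in>?D \<times> ?D - {(p, q). length p + length q \<le> L}. ?t y = 0"
      proof
        fix y assume y: "y \<in> ?D \<times> ?D - {(p, q). length p + length q \<le> L}"
        obtain p q where pq: "y = (p, q)" by fastforce
        then have "path_matrix x (p @ q) = 0" using y by (intro path_matrix_eq_0[OF x]) simp
        then show "?t y = 0" using pq by simp
      qed
    qed (auto simp: finite_short_paths)
    also have "\<dots> = f \<odot>\<^bsub>?M\<^esub> (g \<odot>\<^bsub>?M\<^esub> v)"
      unfolding sum.cartesian_product[symmetric]
      by (auto simp: rep_module_def vec.sum vec.scale_sum_right path_matrix_append
          matrix_vector_mul_assoc[symmetric] vector_scalar_commute[symmetric] intro!: sum.cong)
    finally show ?thesis .
  qed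
  moreover have "\<one>\<^bsub>?T\<^esub> \<odot>\<^bsub>?M\<^esub> v = v" for v
  proof -
    have "\<one>\<^bsub>?T\<^esub> \<odot>\<^bsub>?M\<^esub> v = (\<Sum>p :: 'r list | length p \<le> L. if p = [] then v else 0)"
      unfolding rep_module_def module.simps by (rule sum.cong) (auto simp: trunc_path_algebra_def path_vec_def path_matrix_def)
    then show ?thesis by (simp add: finite_short_paths)
  qed
  ultimately show ?thesis
    by (intro left_module.intro left_module_axioms.intro ring_trunc_path_algebra)
       (auto simp: rep_module_def trunc_path_algebra_def vec.add vec.scale_left_distrib
         vec.scale_right_distrib sum.distrib matrix_vector_right_distrib)
qed

lemma left_module_free_module:
  assumes "ring R"
  shows "left_module R (free_module R t)"
proof -
  interpret ring R by fact
  have "abelian_group (free_module R t)"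
  proof (rule abelian_groupI)
    fix v assume "v \<in> carrier (free_module R t)"
    then show "\<exists>w\<in>carrier (free_module R t). w \<oplus>\<^bsub>free_module R t\<^esub> v = \<zero>\<^bsub>free_module R t\<^esub>"
      by (intro bexI[of _ "\<lambda>j\<in>{..<t}. \<ominus>\<^bsub>R\<^esub> v j"])
         (auto simp: free_module_def l_neg PiE_iff intro!: restrict_ext)
  qed (auto simp: free_module_def PiE_iff a_ac restrict_def extensional_def fun_eq_iff)
  then show ?thesis
    by (intro left_module.intro left_module_axioms.intro assms)
       (auto simp: free_module_def PiE_iff l_distr r_distr m_assoc restrict_def extensional_def fun_eq_iff)
qed


subsection \<open>The Zariski topology\<close>

lemma istopology_zariski:
  "istopology (\<lambda>U. zariski_closed (- U :: ('r \<Rightarrow> 'k::field ^ 'd ^ 'd) set))"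
  unfolding istopology_def
proof (intro conjI allI impI)
  fix U V :: "('r \<Rightarrow> 'k ^ 'd ^ 'd) set"
  assume U: "zariski_closed (- U)" and V: "zariski_closed (- V)"
  obtain F where F: "F \<subseteq> polynomial_funs" "- U = {x. \<forall>f\<in>F. f x = 0}"
    using U unfolding zariski_closed_def by (elim exE conjE)
  obtain G where G: "G \<subseteq> polynomial_funs" "- V = {x. \<forall>f\<in>G. f x = 0}"
    using V unfolding zariski_closed_def by (elim exE conjE)
  have "- (U \<inter> V) = {x. \<forall>h\<in>{\<lambda>x. f x * g x | f g. f \<in> F \<and> g \<in> G}. h x = 0}"
    (is "_ = ?Z")
  proof
    show "- (U \<inter> V) \<subseteq> ?Z" unfolding Compl_Int F(2) G(2) by auto
    show "?Z \<subseteq> - (U \<inter> V)"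
    proof
      fix x assume x: "x \<in> ?Z"
      have "f x * g x = 0" if "f \<in> F" "g \<in> G" for f g
      proof -
        have "(\<lambda>x. f x * g x) \<in> {\<lambda>x. f x * g x | f g. f \<in> F \<and> g \<in> G}"
          unfolding mem_Collect_eq using that by (intro exI[of _ f] exI[of _ g]) simp
        from bspec[OF x[unfolded mem_Collect_eq] this] show ?thesis .
      qed
      then have "(\<forall>f\<in>F. f x = 0) \<or> (\<forall>g\<in>G. g x = 0)" unfolding mult_eq_0_iff by metis
      then show "x \<in> - (U \<inter> V)" unfolding Compl_Int F(2) G(2) by blast
    qed
  qed
  moreover have "{\<lambda>x. f x * g x | f g. f \<in> F \<and> g \<in> G} \<subseteq> polynomial_funs"
    using F G by (auto intro!: polynomial_funs.mult)
  ultimately show "zariski_closed (- (U \<inter> V))" unfolding zariski_closed_def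
    by (intro exI conjI)
next
  fix \<K> :: "('r \<Rightarrow> 'k ^ 'd ^ 'd) set set"
  assume "\<forall>U\<in>\<K>. zariski_closed (- U)"
  then have "\<forall>U\<in>\<K>. \<exists>F. F \<subseteq> polynomial_funs \<and> - U = {x. \<forall>f\<in>F. f x = 0}"
    unfolding zariski_closed_def .
  then obtain F where F: "\<forall>U\<in>\<K>. F U \<subseteq> polynomial_funs \<and> - U = {x. \<forall>f\<in>F U. f x = 0}"
    by (rule bchoice[THEN exE])
  have "- \<Union>\<K> = (\<Inter>U\<in>\<K>. - U)" by blast
  also have "\<dots> = (\<Inter>U\<in>\<K>. {x. \<forall>f\<in>F U. f x = 0})" using F by (intro INF_cong) auto
  also have "\<dots> = {x. \<forall>f\<in>\<Union>(F ` \<K>). f x = 0}" by auto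
  finally show "zariski_closed (- \<Union>\<K>)"
    unfolding zariski_closed_def using F by (intro exI[of _ "\<Union>(F ` \<K>)"] conjI UN_least) simp_all
qed

lemma closedin_zariski:
  "closedin zariski (Z :: ('r \<Rightarrow> 'k::field ^ 'd ^ 'd) set) \<longleftrightarrow> zariski_closed Z"
proof -
  have o: "openin zariski = (\<lambda>U :: ('r \<Rightarrow> 'k ^ 'd ^ 'd) set. zariski_closed (- U))"
    unfolding zariski_def by (rule topology_inverse'[OF istopology_zariski])
  have "zariski_closed ({} :: ('r \<Rightarrow> 'k ^ 'd ^ 'd) set)" unfolding zariski_closed_def
    by (rule exI[of _ "{\<lambda>_. 1}"]) (auto intro: polynomial_funs.const)
  then have "openin zariski (UNIV :: ('r \<Rightarrow> 'k ^ 'd ^ 'd) set)" by (simp add: o)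
  then have "topspace zariski = (UNIV :: ('r \<Rightarrow> 'k ^ 'd ^ 'd) set)"
    using openin_subset by blast
  then show ?thesis by (simp add: closedin_def o Compl_eq_Diff_UNIV[symmetric])
qed

end

theory Submission
  imports Defs
begin

text \<open>The radical powers of \<open>M\<^sub>x\<close> are spanned by the vectors \<open>A\<^sub>p v\<close> with \<open>p\<close> of a given length, so lower
  bounds on their dimensions are open conditions. A point of a layer is, up to conjugation, a tuple of
  strictly triangular matrices for a fixed grading of the basis; joining two conjugated triangular
  tuples by a rational curve shows that the layer is irreducible. Bounding the dimensions of the
  radical powers of the module and of its dual from below defines an open set inside the layer, and it
  contains a graded module given by partial permutations as soon as consecutive dimensions differ at
  most by the factor \<open>r\<close>; so the closure of the layer is a component. Finally, the open set \<open>\<UU>\<close> consists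
  of the points of the layer for which some vectors \<open>z\<^sub>i\<close> make the family \<open>A\<^sub>p z\<^sub>i\<close>, \<open>p z\<^sub>i\<close> in the skeleton,
  a basis. Expressing the critical paths in this basis gives the coefficients \<open>c\<close>, and the kernel of
  the evaluation map \<open>P \<longrightarrow> M\<^sub>x\<close> is \<open>U(c)\<close>, because modulo \<open>U(c)\<close> the skeleton spans \<open>P\<close>.\<close>

section \<open>The radical filtration\<close>

text \<open>Membership in a layer is a system of equalities of ranks, while only lower bounds on
  ranks are open; each step has to get its upper bounds from elsewhere. On the rational curve they
  come from triangularity for one fixed grading, in the closure of the layer from semicontinuity,
  and near the graded module from duality: \<open>J^l M\<close> and the power
  \<open>L + 1 - l\<close> of the radical on the dual annihilate each other under the standard
  pairing, so their dimensions add up to at most d. The bound \<open>S l \<le> r * S (l - 1)\<close>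
  lets every basis vector of level l be hit by an arrow, and \<open>S (l - 1) \<le> r * S l\<close>
  lets every one of level l - 1 have a nonzero image, with r partial permutations at hand. For the
  resulting graded module the two dimensions add up to exactly d. One enumeration of \<sigma> by the
  coordinate indices turns path length into the grading and the skeleton family into a square
  matrix. The generators \<open>z i\<close> are not coordinates of the variety; for fixed ones the
  basis condition is the nonvanishing of one determinant, and \<UU> takes the union over all
  choices.\<close>

lemma trunc_path_algebra_minus:
  assumes "f \<in> carrier (trunc_path_algebra L :: ('r list \<Rightarrow> 'k::field) ring)"
  shows "\<ominus>\<^bsub>trunc_path_algebra L\<^esub> f = (\<lambda>p. - f p)"
proof -
  interpret T: ring "trunc_path_algebra L :: ('r list \<Rightarrow> 'k) ring" by (rule ring_trunc_path_algebra)
  show ?thesis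
    using assms by (intro T.minus_equality) (auto simp: trunc_path_algebra_def)
qed

text \<open>A left ideal containing some f with \<open>f [] \<noteq> 0\<close> contains 1: normalise
  the constant coefficient, then remove the terms of higher degree. So every proper left ideal lies
  in the set on the right, which is itself a left ideal and hence the only maximal one.\<close>

lemma jacobson_radical_trunc_path_algebra:
  "jacobson_radical (trunc_path_algebra L :: ('r list \<Rightarrow> 'k::field) ring) =
    {f \<in> carrier (trunc_path_algebra L). f [] = 0}" (is "_ = ?J")
proof -
  let ?T = "trunc_path_algebra L :: ('r list \<Rightarrow> 'k) ring"
  interpret T: ring ?T by (rule ring_trunc_path_algebra)
  have unit: "I = carrier ?T" if I: "left_ideal I ?T" and f: "f \<in> I" "f [] \<noteq> 0" for I f
  proof -
    interpret I: additive_subgroup I ?T using I by (simp add: left_ideal_def)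
    have lm: "a \<in> carrier ?T \<Longrightarrow> y \<in> I \<Longrightarrow> a \<otimes>\<^bsub>?T\<^esub> y \<in> I" for a y
      using I by (simp add: left_ideal_def)
    have ex: "\<exists>h\<in>I. \<forall>p. length p \<le> n \<longrightarrow> h p = path_vec [] 1 p" for n
    proof (induction n)
      case 0
      have "path_vec [] (inverse (f [])) \<otimes>\<^bsub>?T\<^esub> f \<in> I"
        by (rule lm[OF _ f(1)]) (auto simp: trunc_path_algebra_def path_vec_def)
      moreover have "(path_vec [] (inverse (f [])) \<otimes>\<^bsub>?T\<^esub> f) [] = 1"
        using f(2) by (simp add: trunc_path_algebra_def path_conv_def path_vec_def)
      ultimately show ?case by (auto simp: path_vec_def)
    next
      case (Suc n)
      then obtain h where h: "h \<in> I" "\<And>p. length p \<le> n \<Longrightarrow> h p = path_vec [] 1 p" by auto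
      \<comment> \<open>This is 2 - h. If h = 1 + m with m starting in degree n + 1, then gh = 1 -
        m^2 agrees with 1 at least up to degree n + 1.\<close>
      define g where "g = (\<lambda>p. if p = [] then 1 else - h p)"
      have hc: "h \<in> carrier ?T" using h(1) I.a_subset by blast
      have "g \<otimes>\<^bsub>?T\<^esub> h \<in> I"
        using hc by (intro lm h) (auto simp: g_def trunc_path_algebra_def)
      moreover have "(g \<otimes>\<^bsub>?T\<^esub> h) p = path_vec [] 1 p" if p: "length p \<le> Suc n" for p
      proof (cases "p = []")
        case True
        then show ?thesis using h(2)[of "[]"]
          by (simp add: trunc_path_algebra_def path_conv_def g_def path_vec_def)
      next
        case False
        then have l: "length p > 0" by simp
        have "path_conv g h p = (\<Sum>k\<in>{0, length p}. g (take k p) * h (drop k p))"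
          unfolding path_conv_def
        proof (rule sum.mono_neutral_right)
          show "\<forall>k\<in>{..length p} - {0, length p}. g (take k p) * h (drop k p) = 0"
            using p by (auto simp: h(2) path_vec_def)
        qed auto
        also have "\<dots> = 0" using False l h(2)[of "[]"] by (simp add: g_def path_vec_def)
        finally show ?thesis using False by (simp add: trunc_path_algebra_def path_vec_def)
      qed
      ultimately show ?case by blast
    qed
    obtain h where h: "h \<in> I" "\<And>p. length p \<le> L \<Longrightarrow> h p = path_vec [] 1 p" using ex[of L] by auto
    have hc: "h \<in> carrier ?T" using h(1) I.a_subset by blast
    have "h p = path_vec [] 1 p" for p
      using h(2)[of p] hc by (cases "length p \<le> L") (auto simp: trunc_path_algebra_def path_vec_def)
    then have "h = \<one>\<^bsub>?T\<^esub>" by (auto simp: trunc_path_algebra_def)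
    then have "a \<in> I" if "a \<in> carrier ?T" for a using lm[OF that h(1)] that by simp
    then show ?thesis using I.a_subset by blast
  qed
  have lJ: "left_ideal ?J ?T"
    unfolding left_ideal_def
  proof (intro conjI ballI)
    show "additive_subgroup ?J ?T"
    proof (intro additive_subgroup.intro group.subgroupI T.a_group)
      show "inv\<^bsub>add_monoid ?T\<^esub> f \<in> ?J" if "f \<in> ?J" for f
        using that trunc_path_algebra_minus[of f L] unfolding a_inv_def
        by (simp (no_asm_use)) (simp add: trunc_path_algebra_def)
      have "\<zero>\<^bsub>?T\<^esub> \<in> ?J" by (simp add: trunc_path_algebra_def)
      then show "?J \<noteq> {}" by blast
    qed (auto simp: trunc_path_algebra_def)
    fix a y assume "a \<in> carrier ?T" "y \<in> ?J"
    then show "a \<otimes>\<^bsub>?T\<^esub> y \<in> ?J" by (auto simp: trunc_path_algebra_def path_conv_def)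
  qed
  have ne: "?J \<noteq> carrier ?T"
  proof
    assume "?J = carrier ?T"
    then have "\<one>\<^bsub>?T\<^esub> \<in> ?J" using T.one_closed by blast
    then show False by (simp add: trunc_path_algebra_def path_vec_def)
  qed
  have "maximal_left_ideal ?J ?T"
    unfolding maximal_left_ideal_def
  proof (intro conjI allI impI)
    fix I' assume I': "left_ideal I' ?T \<and> ?J \<subseteq> I'"
    show "I' = ?J \<or> I' = carrier ?T"
    proof (cases "\<exists>f\<in>I'. f [] \<noteq> 0")
      case True
      then show ?thesis using unit I' by blast
    next
      case False
      moreover have "I' \<subseteq> carrier ?T"
        using I' by (intro additive_subgroup.a_subset) (simp add: left_ideal_def)
      ultimately show ?thesis using I' by blast
    qed
  qed (fact lJ ne)+
  moreover have "I = ?J" if I: "maximal_left_ideal I ?T" for I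
  proof -
    have l: "left_ideal I ?T" "I \<noteq> carrier ?T" using I unfolding maximal_left_ideal_def by blast+
    then have "I \<subseteq> carrier ?T" by (intro additive_subgroup.a_subset) (simp add: left_ideal_def)
    then have "I \<subseteq> ?J" using unit[OF l(1)] l(2) by blast
    moreover have "left_ideal ?J ?T \<and> I \<subseteq> ?J \<longrightarrow> ?J = I \<or> ?J = carrier ?T"
      using I unfolding maximal_left_ideal_def by (elim conjE) (erule spec)
    ultimately show ?thesis using lJ ne by argo
  qed
  ultimately have "{I. maximal_left_ideal I ?T} = {?J}" by blast
  then show ?thesis by (auto simp: jacobson_radical_def)
qed

section \<open>Submodules of left modules\<close>

context left_module
begin

lemma smult_zero_left: "v \<in> carrier M \<Longrightarrow> \<zero>\<^bsub>R\<^esub> \<odot>\<^bsub>M\<^esub> v = \<zero>\<^bsub>M\<^esub>"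
  using smult_l_distr[of "\<zero>\<^bsub>R\<^esub>" "\<zero>\<^bsub>R\<^esub>" v] smult_closed[of "\<zero>\<^bsub>R\<^esub>" v]
  by (metis M.add.l_cancel_one R.add.r_one R.zero_closed)

lemma smult_minus_one:
  assumes "v \<in> carrier M"
  shows "(\<ominus>\<^bsub>R\<^esub> \<one>\<^bsub>R\<^esub>) \<odot>\<^bsub>M\<^esub> v = \<ominus>\<^bsub>M\<^esub> v"
proof (rule M.minus_equality[symmetric])
  show "(\<ominus>\<^bsub>R\<^esub> \<one>\<^bsub>R\<^esub>) \<odot>\<^bsub>M\<^esub> v \<oplus>\<^bsub>M\<^esub> v = \<zero>\<^bsub>M\<^esub>"
    using assms smult_l_distr[of "\<ominus>\<^bsub>R\<^esub> \<one>\<^bsub>R\<^esub>" "\<one>\<^bsub>R\<^esub>" v]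
    by (simp add: smult_one R.l_neg smult_zero_left)
qed (use assms smult_closed in auto)

text \<open>Closure under negation comes for free, since negation is the action of -1.\<close>

lemma submoduleI:
  assumes "H \<subseteq> carrier M" "\<zero>\<^bsub>M\<^esub> \<in> H"
    and "\<And>v w. v \<in> H \<Longrightarrow> w \<in> H \<Longrightarrow> v \<oplus>\<^bsub>M\<^esub> w \<in> H"
    and "\<And>a v. a \<in> carrier R \<Longrightarrow> v \<in> H \<Longrightarrow> a \<odot>\<^bsub>M\<^esub> v \<in> H"
  shows "submodule H R M"
proof (intro submodule.intro submodule_axioms.intro group.subgroupI M.a_group)
  show "inv\<^bsub>add_monoid M\<^esub> v \<in> H" if "v \<in> H" for v
    using assms(4)[of "\<ominus>\<^bsub>R\<^esub> \<one>\<^bsub>R\<^esub>" v] that assms(1) smult_minus_one[of v]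
    by (auto simp: a_inv_def)
qed (use assms in auto)

lemma submodule_carrier: "submodule (carrier M) R M"
  by (rule submoduleI) (auto intro: smult_closed)

end

lemma submoduleD:
  assumes "submodule H R M"
  shows "H \<subseteq> carrier M" "\<zero>\<^bsub>M\<^esub> \<in> H" "\<And>v w. v \<in> H \<Longrightarrow> w \<in> H \<Longrightarrow> v \<oplus>\<^bsub>M\<^esub> w \<in> H"
    "\<And>a v. a \<in> carrier R \<Longrightarrow> v \<in> H \<Longrightarrow> a \<odot>\<^bsub>M\<^esub> v \<in> H"
  using assms by (auto simp: submodule_def submodule_axioms_def subgroup_def)

lemma (in left_module) submodule_generated_submodule:
  assumes "X \<subseteq> carrier M"
  shows "submodule (generated_submodule R M X) R M"
proof (rule submoduleI)
  show "generated_submodule R M X \<subseteq> carrier M"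
    using submodule_carrier assms by (auto simp: generated_submodule_def)
qed (auto simp: generated_submodule_def dest: submoduleD)

lemma generated_submodule_least: "submodule H R M \<Longrightarrow> X \<subseteq> H \<Longrightarrow> generated_submodule R M X \<subseteq> H"
  by (auto simp: generated_submodule_def)

lemma generated_submodule_superset: "X \<subseteq> generated_submodule R M X"
  by (auto simp: generated_submodule_def)

section \<open>The subspaces spanned by the images of paths of a given length\<close>

lemma path_matrix_Nil [simp]: "path_matrix x [] = mat 1"
  and path_matrix_Cons: "path_matrix x (s # p) = x s ** path_matrix x p"
  by (simp_all add: path_matrix_def)

lemma smult_path_vec_rep_module:
  fixes x :: "'r::finite \<Rightarrow> 'k::field ^ 'd ^ 'd"
  assumes "length p \<le> L"
  shows "path_vec p a \<odot>\<^bsub>rep_module L x\<^esub> v = a *s (path_matrix x p *v v)"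
proof -
  have "path_vec p a \<odot>\<^bsub>rep_module L x\<^esub> v =
      (\<Sum>q | length q \<le> L. if q = p then a *s (path_matrix x p *v v) else 0)"
    by (auto simp: rep_module_def path_vec_def intro!: sum.cong)
  then show ?thesis using assms by (simp add: finite_short_paths)
qed

lemma path_vec_closed: "length p \<le> L \<Longrightarrow> path_vec p a \<in> carrier (trunc_path_algebra L)"
  by (auto simp: trunc_path_algebra_def path_vec_def)

text \<open>The field acts through the multiples \<open>path_vec [] a\<close> of the trivial
  path.\<close>

lemma subspace_of_submodule:
  fixes x :: "'r::finite \<Rightarrow> 'k::field ^ 'd ^ 'd"
  assumes "submodule H (trunc_path_algebra L) (rep_module L x)"
  shows "vec.subspace H"
proof (rule vec.subspaceI)
  show "0 \<in> H" "\<And>v w. v \<in> H \<Longrightarrow> w \<in> H \<Longrightarrow> v + w \<in> H"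
    using submoduleD(2,3)[OF assms] by (simp_all add: rep_module_def)
  show "a *s v \<in> H" if "v \<in> H" for a v
    using submoduleD(4)[OF assms path_vec_closed that, of "[]" a] smult_path_vec_rep_module[of "[]" L x a v]
    by simp
qed

text \<open>This is \<open>J^l M\<close>, but defined for every tuple of matrices, also outside
  \<open>rep_variety L\<close>: the openness statements live on the whole affine space, and
  transposed tuples are used as well.\<close>

definition path_space :: "('r \<Rightarrow> 'k::field ^ 'd ^ 'd) \<Rightarrow> nat \<Rightarrow> ('k ^ 'd) set" where
  "path_space x l = vec.span {path_matrix x p *v v | p v. length p = l}"

lemma path_matrix_mult_mem_path_space: "length p = l \<Longrightarrow> path_matrix x p *v v \<in> path_space x l"
  unfolding path_space_def by (rule vec.span_base) blast

lemma path_space_0: "path_space x 0 = UNIV"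
  using path_matrix_mult_mem_path_space[of "[]" 0 x] by auto

lemma subspace_path_space: "vec.subspace (path_space x l)"
  unfolding path_space_def by simp

lemma path_space_eq_0:
  assumes "x \<in> rep_variety L" "L < l"
  shows "path_space x l = {0}"
proof -
  have "{path_matrix x p *v v | p v. length p = l} \<subseteq> {0}"
    using assms by (auto simp: path_matrix_eq_0)
  then have "path_space x l \<subseteq> vec.span {0}" unfolding path_space_def by (rule vec.span_mono)
  then show ?thesis using vec.subspace_0[OF subspace_path_space] by auto
qed

lemma path_matrix_mult_path_space:
  fixes x :: "'r \<Rightarrow> 'k::field ^ 'd::finite ^ 'd"
  assumes "v \<in> path_space x l"
  shows "path_matrix x p *v v \<in> path_space x (length p + l)"
  using assms unfolding path_space_def[of x l]
proof (induction rule: vec.span_induct_alt)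
  case base
  then show ?case using vec.subspace_0[OF subspace_path_space] by simp
next
  case (step c u w)
  then obtain q v' where u: "u = path_matrix x q *v v'" "length q = l" by blast
  have "path_matrix x p *v u \<in> path_space x (length p + l)"
    using path_matrix_mult_mem_path_space[of "p @ q" "length p + l" x v'] u
    by (simp add: path_matrix_append matrix_vector_mul_assoc)
  then show ?case using step
    by (simp add: vec.add vec.scale vec.subspace_add[OF subspace_path_space] vec.subspace_scale[OF subspace_path_space])
qed

lemma path_space_antimono:
  fixes x :: "'r \<Rightarrow> 'k::field ^ 'd::finite ^ 'd"
  assumes "l \<le> m"
  shows "path_space x m \<subseteq> path_space x l"
  unfolding path_space_def[of x m]
proof (rule vec.span_minimal[OF _ subspace_path_space], safe)
  fix p :: "'r list" and v assume m: "m = length p"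
  have "path_matrix x p *v v = path_matrix x (take l p) *v (path_matrix x (drop l p) *v v)"
    by (metis append_take_drop_id matrix_vector_mul_assoc path_matrix_append)
  then show "path_matrix x p *v v \<in> path_space x l"
    using assms m path_matrix_mult_mem_path_space[of "take l p" l x] by simp
qed

text \<open>An element of J has no constant term, so it raises the length by at least one, and
  longer paths are absorbed by \<open>path_space_antimono\<close>. Conversely single arrows, applied
  to paths of length l, produce all paths of length l + 1.\<close>

lemma radical_power_rep_module:
  fixes x :: "'r::finite \<Rightarrow> 'k::field ^ 'd::finite ^ 'd"
  assumes x: "x \<in> rep_variety L" and L: "1 \<le> L"
  shows "radical_power (trunc_path_algebra L) (rep_module L x) l = path_space x l"
proof (induction l)
  case 0
  show ?case by (simp add: radical_power_def path_space_0 rep_module_def)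
next
  case (Suc l)
  let ?T = "trunc_path_algebra L :: ('r list \<Rightarrow> 'k) ring" and ?M = "rep_module L x"
  interpret left_module ?T ?M by (rule left_module_rep_module[OF x])
  let ?X = "{a \<odot>\<^bsub>?M\<^esub> v | a v. a \<in> jacobson_radical ?T \<and> v \<in> path_space x l}"
  have smult: "a \<odot>\<^bsub>?M\<^esub> v = (\<Sum>p | length p \<le> L. a p *s (path_matrix x p *v v))" for a v
    by (simp add: rep_module_def)
  have sub: "submodule (path_space x (Suc l)) ?T ?M"
  proof (rule submoduleI)
    fix a v assume "v \<in> path_space x (Suc l)"
    then have "path_matrix x p *v v \<in> path_space x (Suc l)" for p
      using path_matrix_mult_path_space[of v x "Suc l" p] path_space_antimono[of "Suc l" "length p + Suc l" x]
      by auto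
    then show "a \<odot>\<^bsub>?M\<^esub> v \<in> path_space x (Suc l)"
      unfolding smult by (intro vec.subspace_sum vec.subspace_scale subspace_path_space)
  qed (auto simp: rep_module_def intro: vec.subspace_add vec.subspace_0 subspace_path_space)
  have "?X \<subseteq> path_space x (Suc l)"
  proof safe
    fix a v assume a: "a \<in> jacobson_radical ?T" and v: "v \<in> path_space x l"
    have "a p *s (path_matrix x p *v v) \<in> path_space x (Suc l)" for p
    proof (cases "p = []")
      case True
      then show ?thesis using a vec.subspace_0[OF subspace_path_space]
        by (simp add: jacobson_radical_trunc_path_algebra)
    next
      case False
      then have "path_space x (length p + l) \<subseteq> path_space x (Suc l)"
        by (intro path_space_antimono) (cases p, auto)
      then show ?thesis using path_matrix_mult_path_space[OF v, of p]
        by (intro vec.subspace_scale[OF subspace_path_space]) blast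
    qed
    then show "a \<odot>\<^bsub>?M\<^esub> v \<in> path_space x (Suc l)"
      unfolding smult by (intro vec.subspace_sum subspace_path_space)
  qed
  moreover have "path_space x (Suc l) \<subseteq> H" if H: "submodule H ?T ?M" "?X \<subseteq> H" for H
    unfolding path_space_def
  proof (rule vec.span_minimal[OF _ subspace_of_submodule[OF H(1)]], safe)
    fix p :: "'r list" and v assume "length p = Suc l"
    then obtain s q where p: "p = s # q" "length q = l" by (auto simp: length_Suc_conv)
    \<comment> \<open>An arrow survives in the truncated algebra because
      \<open>1 \<le> L\<close>.\<close>
    have "path_vec [s] 1 \<odot>\<^bsub>?M\<^esub> (path_matrix x q *v v) \<in> ?X"
      using p L by (intro CollectI exI conjI refl path_matrix_mult_mem_path_space)
         (auto simp: jacobson_radical_trunc_path_algebra path_vec_closed path_matrix_mult_mem_path_space,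
          simp add: path_vec_def)
    moreover have "path_vec [s] 1 \<odot>\<^bsub>?M\<^esub> (path_matrix x q *v v) = path_matrix x p *v v"
      using smult_path_vec_rep_module[of "[s]" L x 1] L p
      by (simp add: path_matrix_Cons matrix_vector_mul_assoc)
    ultimately show "path_matrix x p *v v \<in> H" using H(2) by auto
  qed
  ultimately have "generated_submodule ?T ?M ?X = path_space x (Suc l)"
    using generated_submodule_least[OF sub] unfolding generated_submodule_def
    by (intro equalityI Inter_greatest) (assumption, blast)
  then show ?case using Suc by (simp add: radical_power_def)
qed

section \<open>Open conditions on ranks\<close>

lemma polynomial_funs_sum:
  assumes "\<And>i. i \<in> I \<Longrightarrow> f i \<in> polynomial_funs"
  shows "(\<lambda>x. \<Sum>i\<in>I. f i x) \<in> polynomial_funs"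
  using assms
  by (induction I rule: infinite_finite_induct) (auto intro: polynomial_funs.const polynomial_funs.add)

lemma polynomial_funs_prod:
  assumes "\<And>i. i \<in> I \<Longrightarrow> f i \<in> polynomial_funs"
  shows "(\<lambda>x. \<Prod>i\<in>I. f i x) \<in> polynomial_funs"
  using assms
  by (induction I rule: infinite_finite_induct) (auto intro: polynomial_funs.const polynomial_funs.mult)

lemma polynomial_funs_det:
  assumes "\<And>i j. (\<lambda>x. B x $ i $ j) \<in> polynomial_funs"
  shows "(\<lambda>x. det (B x)) \<in> polynomial_funs"
  unfolding det_def
  by (intro polynomial_funs_sum polynomial_funs.mult[OF polynomial_funs.const] polynomial_funs_prod assms)

lemma polynomial_funs_path_matrix: "(\<lambda>x. path_matrix x p $ i $ j) \<in> polynomial_funs"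
proof (induction p arbitrary: i)
  case Nil
  show ?case by (simp add: polynomial_funs.const)
next
  case (Cons s p)
  then show ?case unfolding path_matrix_Cons matrix_matrix_mult_def vec_lambda_beta
    by (intro polynomial_funs_sum polynomial_funs.mult polynomial_funs.coord)
qed

lemma polynomial_funs_path_matrix_mult: "(\<lambda>x. (path_matrix x p *v v) $ i) \<in> polynomial_funs"
  unfolding matrix_vector_mult_def vec_lambda_beta
  by (intro polynomial_funs_sum polynomial_funs.mult polynomial_funs_path_matrix polynomial_funs.const)

lemma openin_zariski: "openin zariski U \<longleftrightarrow> zariski_closed (- U)"
  unfolding zariski_def by (rule fun_cong[OF topology_inverse'[OF istopology_zariski]])

lemma openin_zariski_nonvanishing:
  assumes "f \<in> polynomial_funs"
  shows "openin zariski {x. f x \<noteq> 0}"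
  unfolding openin_zariski zariski_closed_def using assms by (intro exI[of _ "{f}"]) auto

lemma topspace_zariski [simp]: "topspace zariski = UNIV"
  using openin_subset[OF openin_zariski_nonvanishing[OF polynomial_funs.const[of 1]]] by auto

lemma topspace_rep_topology [simp]: "topspace (rep_topology L) = rep_variety L"
  by (simp add: rep_topology_def)

text \<open>The sets where one polynomial does not vanish form a basis of the topology. Arguments
  about open sets can therefore be run with single polynomials, which restrict well to
  curves.\<close>

lemma zariski_openE:
  assumes "openin zariski U" "x \<in> U"
  obtains f where "f \<in> polynomial_funs" "f x \<noteq> 0" "{y. f y \<noteq> 0} \<subseteq> U"
proof -
  obtain F where F: "F \<subseteq> polynomial_funs" "- U = {x. \<forall>f\<in>F. f x = 0}"
    using assms(1) unfolding openin_zariski zariski_closed_def by (elim exE conjE)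
  have "x \<notin> {x. \<forall>f\<in>F. f x = 0}" using assms(2) unfolding F(2)[symmetric] by simp
  then obtain f where f: "f \<in> F" "f x \<noteq> 0" by auto
  have "y \<in> U" if "f y \<noteq> 0" for y
  proof -
    have "y \<notin> - U" unfolding F(2) using that f(1) by blast
    then show ?thesis by simp
  qed
  then have "{y. f y \<noteq> 0} \<subseteq> U" by (intro subsetI) simp
  with f(2) subsetD[OF F(1) f(1)] show ?thesis by (intro that)
qed

lemma zariski_openI:
  assumes "\<And>x. x \<in> U \<Longrightarrow> \<exists>f\<in>polynomial_funs. f x \<noteq> 0 \<and> {y. f y \<noteq> 0} \<subseteq> U"
  shows "openin zariski U"
proof (subst openin_subopen, intro ballI)
  fix x assume "x \<in> U"
  then obtain f where "f \<in> polynomial_funs" "f x \<noteq> 0" "{y. f y \<noteq> 0} \<subseteq> U" using assms by blast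
  then show "\<exists>T. openin zariski T \<and> x \<in> T \<and> T \<subseteq> U"
    by (intro exI[of _ "{y. f y \<noteq> 0}"] conjI openin_zariski_nonvanishing) auto
qed

section \<open>Bases as invertible matrices, and lower semicontinuity of ranks\<close>

definition of_columns :: "('d \<Rightarrow> 'k ^ 'd) \<Rightarrow> 'k ^ 'd ^ 'd" where
  "of_columns b = (\<chi> i j. b j $ i)"

lemma of_columns_nth: "of_columns b $ i $ j = b j $ i"
  by (simp add: of_columns_def)

lemma of_columns_mult:
  fixes v :: "'k::field ^ 'd::finite"
  shows "of_columns b *v v = (\<Sum>j\<in>UNIV. v $ j *s b j)"
  by (simp add: of_columns_def matrix_vector_mult_def vec_eq_iff mult.commute)

lemma column_of_columns: "column j (of_columns b) = b j"
  by (simp add: of_columns_def column_def vec_eq_iff)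

lemma det_of_columns_nonzero_iff:
  fixes b :: "'d::finite \<Rightarrow> 'k::field ^ 'd"
  shows "det (of_columns b) \<noteq> 0 \<longleftrightarrow> (\<forall>c. (\<Sum>j\<in>UNIV. c j *s b j) = 0 \<longrightarrow> (\<forall>j. c j = 0))"
  unfolding invertible_det_nz[symmetric] invertible_left_inverse
    matrix_left_invertible_independent_columns column_of_columns ..

lemma det_of_columns_nonzero_iff_independent:
  fixes b :: "'d::finite \<Rightarrow> 'k::field ^ 'd"
  shows "det (of_columns b) \<noteq> 0 \<longleftrightarrow> inj b \<and> vec.independent (range b)"
proof
  assume d: "det (of_columns b) \<noteq> 0"
  have coeff: "c j = 0" if "(\<Sum>j\<in>UNIV. c j *s b j) = 0" for c j
    using d[unfolded det_of_columns_nonzero_iff, THEN spec, THEN mp, OF that] by simp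
  have inj: "inj b"
  proof (rule injI)
    fix i j assume ij: "b i = b j"
    show "i = j"
    proof (rule ccontr)
      assume ne: "i \<noteq> j"
      \<comment> \<open>The nontrivial relation \<open>b i - b j = 0\<close>, written with
        coefficients on the whole index type.\<close>
      have "(\<Sum>k\<in>UNIV. (if k = i then 1 else if k = j then - 1 else 0) *s b k) =
          (\<Sum>k\<in>{i, j}. (if k = i then 1 else if k = j then - 1 else 0) *s b k)"
        by (rule sum.mono_neutral_right) auto
      also have "\<dots> = 0" using ne ij by simp
      finally have "(if i = i then 1 else if i = j then - 1 else 0) = (0 :: 'k)"
        by (rule coeff)
      then show False by simp
    qed
  qed
  moreover have "vec.independent (range b)"
    unfolding vec.independent_explicit
  proof (intro conjI allI impI ballI)
    fix u v assume u: "(\<Sum>v\<in>range b. u v *s v) = 0" and "v \<in> range b"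
    then obtain j where j: "v = b j" by blast
    have "(\<Sum>j\<in>UNIV. u (b j) *s b j) = 0"
      using u sum.reindex[OF inj, of "\<lambda>v. u v *s v"] by simp
    then have "u (b j) = 0" by (rule coeff)
    then show "u v = 0" using j by simp
  qed simp
  ultimately show "inj b \<and> vec.independent (range b)" ..
next
  assume b: "inj b \<and> vec.independent (range b)"
  show "det (of_columns b) \<noteq> 0" unfolding det_of_columns_nonzero_iff
  proof (intro allI impI)
    fix c j assume c: "(\<Sum>j\<in>UNIV. c j *s b j) = 0"
    have "(\<Sum>v\<in>range b. c (inv_into UNIV b v) *s v) = (\<Sum>j\<in>UNIV. c j *s b j)"
      using b by (subst sum.reindex) auto
    then have "(\<Sum>v\<in>range b. c (inv_into UNIV b v) *s v) = 0" using c by simp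
    then have "c (inv_into UNIV b (b j)) = 0"
      using b unfolding vec.independent_explicit by (elim conjE allE[of _ "\<lambda>v. c (inv_into UNIV b v)"]) auto
    then show "c j = 0" using b by simp
  qed
qed

lemma ex_bij_betw_basis:
  fixes B :: "('k::field ^ 'd::finite) set"
  assumes "vec.independent B" "vec.span B = UNIV"
  obtains b :: "'d \<Rightarrow> 'k ^ 'd" where "bij_betw b UNIV B"
proof -
  have "card B = CARD('d)" using vec.dim_eq_card[of B UNIV] assms
    by (metis vec.dim_span_eq_card_independent vec_dim_card)
  moreover have "finite B" using assms(1) by (rule vec.finiteI_independent)
  ultimately show ?thesis using that by (metis bij_betw_iff_card finite)
qed

text \<open>A maximal independent subfamily at the given point is completed by constant vectors to a
  basis. Its determinant is a polynomial in x, and wherever this is nonzero the subfamily stays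
  independent. The index set may be infinite, as it is when all vectors v of the space take
  part.\<close>

lemma openin_zariski_dim_ge:
  fixes f :: "'i \<Rightarrow> ('r \<Rightarrow> 'k::field ^ 'd::finite ^ 'd) \<Rightarrow> 'k ^ 'd"
  assumes f: "\<And>i k. i \<in> I \<Longrightarrow> (\<lambda>x. f i x $ k) \<in> polynomial_funs"
  shows "openin zariski {x. n \<le> vec.dim ((\<lambda>i. f i x) ` I)}"
proof (rule zariski_openI)
  fix x0 assume "x0 \<in> {x. n \<le> vec.dim ((\<lambda>i. f i x) ` I)}"
  then have n: "n \<le> vec.dim ((\<lambda>i. f i x0) ` I)" by simp
  obtain B where B: "B \<subseteq> (\<lambda>i. f i x0) ` I" "vec.independent B"
    "card B = vec.dim ((\<lambda>i. f i x0) ` I)"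
    using vec.basis_exists by metis
  obtain C where C: "B \<subseteq> C" "vec.independent C" "UNIV \<subseteq> vec.span C"
    using vec.maximal_independent_subset_extend[of B UNIV] B(2) by auto
  then obtain b :: "'d \<Rightarrow> 'k ^ 'd" where b: "bij_betw b UNIV C" using ex_bij_betw_basis by blast
  have inj: "inj b" and ran: "range b = C" using b by (auto simp: bij_betw_def)
  define J where "J = b -` B"
  have J: "card J = card B" unfolding J_def using C(1) ran by (intro card_vimage_inj inj) auto
  have "\<forall>j\<in>J. \<exists>i\<in>I. b j = f i x0" using B(1) by (auto simp: J_def)
  then obtain h where h: "\<And>j. j \<in> J \<Longrightarrow> h j \<in> I \<and> b j = f (h j) x0" by metis
  \<comment> \<open>Only the columns that belong to the subfamily move with x; the completing
    columns stay fixed.\<close>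
  define b' where "b' x j = (if j \<in> J then f (h j) x else b j)" for x j
  define D where "D x = det (of_columns (b' x))" for x
  have "D \<in> polynomial_funs" unfolding D_def
  proof (rule polynomial_funs_det)
    fix i j show "(\<lambda>x. of_columns (b' x) $ i $ j) \<in> polynomial_funs"
      unfolding of_columns_nth b'_def using f h by (cases "j \<in> J") (auto intro: polynomial_funs.const)
  qed
  moreover have "D x0 \<noteq> 0"
  proof -
    have "b' x0 = b" using h by (auto simp: b'_def)
    then show ?thesis using inj C(2) ran by (simp add: D_def det_of_columns_nonzero_iff_independent)
  qed
  moreover have "n \<le> vec.dim ((\<lambda>i. f i x) ` I)" if "D x \<noteq> 0" for x
  proof -
    have i: "inj (b' x)" "vec.independent (range (b' x))"
      using that by (simp_all add: D_def det_of_columns_nonzero_iff_independent)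
    have "b' x ` J \<subseteq> (\<lambda>i. f i x) ` I" using h by (auto simp: b'_def)
    moreover have "vec.independent (b' x ` J)" using i(2) by (rule vec.independent_mono) blast
    ultimately have "card (b' x ` J) \<le> vec.dim ((\<lambda>i. f i x) ` I)" by (rule vec.independent_card_le_dim)
    moreover have "card (b' x ` J) = card J" using i(1) by (intro card_image) (auto intro: inj_on_subset)
    ultimately show ?thesis using n J B(3) by simp
  qed
  ultimately show "\<exists>f'\<in>polynomial_funs. f' x0 \<noteq> 0 \<and> {y. f' y \<noteq> 0} \<subseteq> {x. n \<le> vec.dim ((\<lambda>i. f i x) ` I)}"
    by (intro bexI[of _ D]) auto
qed

lemma openin_zariski_dim_path_space_ge:
  "openin zariski {x :: 'r \<Rightarrow> 'k::field ^ 'd::finite ^ 'd. n \<le> vec.dim (path_space x l)}"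
proof -
  have "{path_matrix x p *v v | p v. length p = l} =
      (\<lambda>(p, v). path_matrix x p *v v) ` {(p, v). length p = l}" for x :: "'r \<Rightarrow> 'k ^ 'd ^ 'd"
    by auto
  then show ?thesis
    using openin_zariski_dim_ge[of "{(p, v). length p = l}" "\<lambda>(p, v) x. path_matrix x p *v v" n]
    by (simp add: path_space_def polynomial_funs_path_matrix_mult case_prod_beta')
qed

text \<open>The recursive conditions telescope, starting from \<open>J^(L+1) M = 0\<close>. In this
  form each radical power has a condition of its own, to which semicontinuity applies.\<close>

lemma rep_layer_iff:
  fixes x :: "'r::finite \<Rightarrow> 'k::field ^ 'd::finite ^ 'd"
  assumes L: "1 \<le> L"
  shows "x \<in> rep_layer L S \<longleftrightarrow> x \<in> rep_variety L \<and> (\<forall>l. vec.dim (path_space x l) = sum S {l..L})"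
proof (cases "x \<in> rep_variety L")
  case x: True
  have 0: "vec.dim (path_space x l) = 0" if "L < l" for l
    by (simp add: path_space_eq_0[OF x that])
  have "(\<forall>l\<le>L. vec.dim (path_space x l) = S l + vec.dim (path_space x (l + 1))) \<longleftrightarrow>
      (\<forall>l. vec.dim (path_space x l) = sum S {l..L})" (is "?A \<longleftrightarrow> ?B")
  proof
    assume A: ?A
    show ?B
    proof
      fix l show "vec.dim (path_space x l) = sum S {l..L}"
      proof (cases "l \<le> Suc L")
        case True
        then show ?thesis
        proof (induction rule: inc_induct)
          case base
          then show ?case using 0[of "Suc L"] by simp
        next
          case (step l)
          then show ?case using A by (simp add: sum.atLeast_Suc_atMost)
        qed
      qed (simp add: 0)
    qed
  next
    assume ?B
    then show ?A by (simp add: sum.atLeast_Suc_atMost)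
  qed
  then show ?thesis using x by (simp add: rep_layer_def radical_power_rep_module[OF x L])
qed (simp add: rep_layer_def)

section \<open>Irreducibility of the layers\<close>

lemma irreducible_subset_closure_of:
  assumes "irreducible_subset T A"
  shows "irreducible_subset T (T closure_of A)"
  unfolding irreducible_subset_def
proof (intro conjI allI impI)
  have A: "A \<subseteq> topspace T" "A \<noteq> {}" using assms by (auto simp: irreducible_subset_def)
  then have AC: "A \<subseteq> T closure_of A" by (intro closure_of_subset)
  show "T closure_of A \<subseteq> topspace T" by (rule closure_of_subset_topspace)
  show "T closure_of A \<noteq> {}" using A AC by blast
  fix F G assume FG: "closedin T F \<and> closedin T G \<and> T closure_of A \<subseteq> F \<union> G"
  then have "A \<subseteq> F \<or> A \<subseteq> G" using assms AC unfolding irreducible_subset_def by blast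
  then show "T closure_of A \<subseteq> F \<or> T closure_of A \<subseteq> G" using FG closure_of_minimal by metis
qed

text \<open>The closure of \<open>W \<inter> B\<close> and the complement of W are closed and
  together cover B; the second alone does not.\<close>

lemma irreducible_subset_closure_of_open:
  assumes B: "irreducible_subset T B" and W: "openin T W" "W \<inter> B \<noteq> {}"
  shows "B \<subseteq> T closure_of (W \<inter> B)"
proof -
  have "B \<subseteq> topspace T" using B by (simp add: irreducible_subset_def)
  then have "B \<subseteq> T closure_of (W \<inter> B) \<union> (topspace T - W)"
    using closure_of_subset[of "W \<inter> B" T] by blast
  then have "B \<subseteq> T closure_of (W \<inter> B) \<or> B \<subseteq> topspace T - W"
    using B W(1) unfolding irreducible_subset_def by (meson closedin_closure_of closedin_diff closedin_topspace)
  then show ?thesis using W(2) by blast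
qed

text \<open>W is dense in every irreducible set B around the closure of A, and W lies in A, so B
  cannot leave that closure.\<close>

lemma irreducible_component_closure_of:
  assumes A: "irreducible_subset T A" and W: "openin T W" "W \<noteq> {}" "W \<subseteq> A"
  shows "irreducible_component T (T closure_of A)"
  unfolding irreducible_component_def
proof (intro conjI allI impI irreducible_subset_closure_of A)
  fix B assume B: "irreducible_subset T B \<and> T closure_of A \<subseteq> B"
  have "A \<subseteq> T closure_of A" using A by (intro closure_of_subset) (simp add: irreducible_subset_def)
  then have "W \<inter> B \<noteq> {}" using W B by blast
  then have "B \<subseteq> T closure_of (W \<inter> B)"
    using B by (intro irreducible_subset_closure_of_open W(1)) auto
  also have "\<dots> \<subseteq> T closure_of A" using W(3) by (intro closure_of_mono) blast
  finally show "B = T closure_of A" using B by blast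
qed

lemma dense_open_in_irreducible:
  assumes A: "irreducible_subset T A" and W: "openin T W" "W \<inter> A \<noteq> {}" and C: "C = T closure_of A"
  shows "dense_open_in T C (W \<inter> C)"
  unfolding dense_open_in_def
proof
  have irr: "irreducible_subset T C" using A unfolding C by (rule irreducible_subset_closure_of)
  then have sub: "C \<subseteq> topspace T" by (simp add: irreducible_subset_def)
  show "openin (subtopology T C) (W \<inter> C)" using W(1) by (auto simp: openin_subtopology)
  have "A \<subseteq> C" unfolding C using A by (intro closure_of_subset) (simp add: irreducible_subset_def)
  then have "C \<subseteq> T closure_of (W \<inter> C)"
    using W by (intro irreducible_subset_closure_of_open irr) auto
  then show "subtopology T C closure_of (W \<inter> C) = topspace (subtopology T C)"
    using sub by (auto simp: closure_of_subtopology Int_absorb1)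
qed

text \<open>Over a finite field, 1 plus the product of all X - a has positive degree and no
  root.\<close>

lemma infinite_UNIV_alg_closed_field: "infinite (UNIV :: 'k::alg_closed_field set)"
proof
  assume fin: "finite (UNIV :: 'k set)"
  let ?q = "\<Prod>a\<in>(UNIV :: 'k set). [:- a, 1:]"
  have "?q \<noteq> 0" by (simp add: fin)
  have "degree (1 + ?q) > 0"
  proof -
    have "degree ?q = card (UNIV :: 'k set)"
      by (subst degree_prod_eq_sum_degree) auto
    also have "\<dots> > 0" using fin by (simp add: card_gt_0_iff)
    finally show ?thesis by (subst degree_add_eq_right) auto
  qed
  then obtain a where "poly (1 + ?q) a = 0" using alg_closed_imp_poly_has_root by blast
  moreover have "poly ?q a = 0" using fin by (simp add: poly_prod)
  ultimately show False by simp
qed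

subsection \<open>Bases adapted to the radical filtration\<close>

text \<open>Strict triangularity: in the basis b all arrows raise h. Since h is a function on the
  coordinate indices, all points of one layer share the same h and hence the same pattern of zeros,
  which is what makes interpolation between two of them possible.\<close>

definition adapted_basis ::
    "('d \<Rightarrow> nat) \<Rightarrow> ('r \<Rightarrow> 'k::field ^ 'd ^ 'd) \<Rightarrow> ('d \<Rightarrow> 'k ^ 'd::finite) \<Rightarrow> bool" where
  "adapted_basis h x b \<longleftrightarrow> det (of_columns b) \<noteq> 0 \<and>
     (\<forall>s j. x s *v b j \<in> vec.span (b ` {i. h j < h i}))"

lemma span_range_of_columns:
  fixes b :: "'d::finite \<Rightarrow> 'k::field ^ 'd"
  assumes "det (of_columns b) \<noteq> 0"
  shows "vec.span (range b) = UNIV"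
proof -
  have "inj b" "vec.independent (range b)" using assms by (simp_all add: det_of_columns_nonzero_iff_independent)
  then show ?thesis
    using vec.card_ge_dim_independent[of "range b" UNIV] by (auto simp: card_image vec_dim_card simp del: vec.dim_UNIV)
qed

lemma path_matrix_mult_adapted_basis:
  assumes "adapted_basis h x b"
  shows "path_matrix x p *v v \<in> vec.span (b ` {i. length p \<le> h i})"
proof (induction p)
  case Nil
  then show ?case using assms by (simp add: adapted_basis_def span_range_of_columns)
next
  case (Cons s p)
  have "x s *v w \<in> vec.span (b ` {i. Suc (length p) \<le> h i})" if "w \<in> vec.span (b ` {i. length p \<le> h i})" for w
    using that
  proof (induction rule: vec.span_induct_alt)
    case base
    show ?case by (simp add: vec.span_zero)
  next
    case (step c u w)
    then obtain j where j: "u = b j" "length p \<le> h j" by blast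
    have "x s *v u \<in> vec.span (b ` {i. h j < h i})" using assms j by (simp add: adapted_basis_def)
    also have "\<dots> \<subseteq> vec.span (b ` {i. Suc (length p) \<le> h i})" using j by (intro vec.span_mono) auto
    finally show ?case using step(2) by (simp add: vec.add vec.scale vec.span_add vec.span_scale)
  qed
  then show ?case using Cons by (simp add: path_matrix_Cons matrix_vector_mul_assoc[symmetric])
qed

lemma path_space_adapted_basis:
  assumes "adapted_basis h x b"
  shows "path_space x l \<subseteq> vec.span (b ` {i. l \<le> h i})"
  unfolding path_space_def using path_matrix_mult_adapted_basis[OF assms]
  by (intro vec.span_minimal) auto

lemma dim_path_space_adapted_basis:
  assumes "adapted_basis h x b"
  shows "vec.dim (path_space x l) \<le> card {i. l \<le> h i}"
proof -
  have "vec.dim (path_space x l) \<le> card (b ` {i. l \<le> h i})"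
    by (intro vec.dim_le_card path_space_adapted_basis assms) simp
  also have "\<dots> \<le> card {i. l \<le> h i}" by (rule card_image_le) simp
  finally show ?thesis .
qed

text \<open>Each arrow raises h, and h is at most L, so L + 1 arrows leave nothing.\<close>

lemma adapted_basis_rep_variety:
  fixes x :: "'r \<Rightarrow> 'k::field ^ 'd::finite ^ 'd"
  assumes "adapted_basis h x b" "\<And>i. h i \<le> L"
  shows "x \<in> rep_variety L"
  unfolding rep_variety_def
proof (intro CollectI allI impI)
  fix p :: "'r list" assume p: "length p = L + 1"
  have "{i. length p \<le> h i} = {}" using assms(2) p by (auto simp: not_le less_Suc_eq_le)
  then have "path_matrix x p *v v = 0" for v
    using path_matrix_mult_adapted_basis[OF assms(1), of p v] by simp
  then show "path_matrix x p = 0" by (simp add: matrix_eq)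
qed

lemma card_level_ge:
  fixes h :: "'d::finite \<Rightarrow> nat"
  assumes "\<And>l. l \<le> L \<Longrightarrow> card {j. h j = l} = S l" "\<And>j. h j \<le> L"
  shows "card {j. l \<le> h j} = sum S {l..L}"
proof -
  have "{j. l \<le> h j} = (\<Union>m\<in>{l..L}. {j. h j = m})" using assms(2) by auto
  then have "card {j. l \<le> h j} = (\<Sum>m\<in>{l..L}. card {j. h j = m})"
    by (simp only:) (rule card_UN_disjoint, auto)
  then show ?thesis using assms(1) by simp
qed

text \<open>Descending induction on l: a basis of \<open>J^(l+1) M\<close> is extended to one of
  \<open>J^l M\<close>. The number of new vectors is \<open>S l\<close>, which is also the number of
  indices of level l, so the grading h can be prescribed in advance.\<close>

lemma ex_adapted_basis:
  fixes x :: "'r::finite \<Rightarrow> 'k::field ^ 'd::finite ^ 'd" and h :: "'d \<Rightarrow> nat"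
  assumes h: "\<And>l. l \<le> L \<Longrightarrow> card {j. h j = l} = S l" "\<And>j. h j \<le> L"
    and dim: "\<And>l. vec.dim (path_space x l) = sum S {l..L}"
  shows "\<exists>b. adapted_basis h x b"
proof -
  have "\<exists>b. inj_on b {j. l \<le> h j} \<and> vec.independent (b ` {j. l \<le> h j}) \<and>
      (\<forall>m\<ge>l. vec.span (b ` {j. m \<le> h j}) = path_space x m)" if "l \<le> Suc L" for l
    using that
  proof (induction rule: inc_induct)
    case base
    have "path_space x m = {0}" if "Suc L \<le> m" for m
      using that dim[of m] vec.subspace_0[OF subspace_path_space, of x m] by auto
    moreover have "{j. m \<le> h j} = {}" if "Suc L \<le> m" for m
      using that h(2) by (auto simp: not_le) (meson Suc_le_lessD le_trans not_less)
    ultimately show ?case by (simp add: vec.independent_empty)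
  next
    case (step l)
    then obtain b where b: "inj_on b {j. Suc l \<le> h j}" "vec.independent (b ` {j. Suc l \<le> h j})"
      "\<And>m. Suc l \<le> m \<Longrightarrow> vec.span (b ` {j. m \<le> h j}) = path_space x m" by blast
    let ?B = "b ` {j. Suc l \<le> h j}"
    have "?B \<subseteq> path_space x (Suc l)" using b(3)[of "Suc l"] vec.span_superset[of ?B] by simp
    also have "\<dots> \<subseteq> path_space x l" by (rule path_space_antimono) simp
    finally obtain C where C: "?B \<subseteq> C" "C \<subseteq> path_space x l" "vec.independent C" "path_space x l \<subseteq> vec.span C"
      using vec.maximal_independent_subset_extend[of ?B "path_space x l"] b(2) by blast
    have finC: "finite C" using C(3) by (rule vec.finiteI_independent)
    have spanC: "vec.span C = path_space x l"
      using C(2,4) vec.span_minimal[OF C(2) subspace_path_space] by blast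
    have "card C = sum S {l..L}"
      using vec.basis_card_eq_dim[OF C(2,4,3)] dim by simp
    moreover have "card ?B = sum S {Suc l..L}"
      using card_image[OF b(1)] card_level_ge[OF h, of "Suc l"] by simp
    ultimately have "card (C - ?B) = S l"
      using step(2) C(1) by (simp add: card_Diff_subset sum.atLeast_Suc_atMost)
    then have "card (C - ?B) = card {j. h j = l}" using h(1) step(2) by simp
    then obtain g where g: "bij_betw g {j. h j = l} (C - ?B)"
      using finC by (metis bij_betw_iff_card finite finite_Diff)
    \<comment> \<open>Only the values at level l change, so the spans already obtained for m > l are
      kept.\<close>
    define b' where "b' j = (if h j = l then g j else b j)" for j
    have eq: "b' ` {j. m \<le> h j} = b ` {j. m \<le> h j}" if "Suc l \<le> m" for m
      using that by (intro image_cong) (auto simp: b'_def)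
    have lvl: "{j. l \<le> h j} = {j. Suc l \<le> h j} \<union> {j. h j = l}" by auto
    have bb: "bij_betw b' {j. Suc l \<le> h j} ?B" "bij_betw b' {j. h j = l} (C - ?B)"
      using b(1) g by (auto simp: b'_def bij_betw_def inj_on_def image_iff)
    have "bij_betw b' {j. l \<le> h j} C"
      using bij_betw_combine[OF bb] C(1) unfolding lvl by (simp add: Un_absorb1)
    then have "inj_on b' {j. l \<le> h j}" "b' ` {j. l \<le> h j} = C" by (auto simp: bij_betw_def)
    moreover have "vec.span (b' ` {j. m \<le> h j}) = path_space x m" if "l \<le> m" for m
      using that b(3)[of m] eq[of m] spanC \<open>b' ` {j. l \<le> h j} = C\<close> by (cases "m = l") auto
    ultimately show ?case using C(3) by auto
  qed
  from this[of 0] obtain b where b: "inj b" "vec.independent (range b)"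
    "\<And>m. vec.span (b ` {j. m \<le> h j}) = path_space x m" by auto
  have "x s *v b j \<in> vec.span (b ` {i. h j < h i})" for s j
  proof -
    have "b j \<in> path_space x (h j)" unfolding b(3)[symmetric] by (intro vec.span_base) auto
    from path_matrix_mult_path_space[OF this, of "[s]"]
    have "x s *v b j \<in> path_space x (Suc (h j))" by (simp add: path_matrix_Cons)
    then show ?thesis unfolding b(3)[symmetric] by (simp add: Suc_le_eq)
  qed
  then show ?thesis using b(1,2)
    by (auto simp: adapted_basis_def det_of_columns_nonzero_iff_independent)
qed

subsection \<open>Rational curves of triangular representations\<close>

text \<open>\<open>range poly\<close> serves as the ring of polynomial functions in the parameter t
  of a curve.\<close>

lemma range_poly_closed:
  "(\<lambda>_. a) \<in> range poly"
  "f \<in> range poly \<Longrightarrow> g \<in> range poly \<Longrightarrow> (\<lambda>t. f t + g t) \<in> range poly"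
  "f \<in> range poly \<Longrightarrow> g \<in> range poly \<Longrightarrow> (\<lambda>t. f t * g t) \<in> range poly"
  for a :: "'k::field"
proof -
  show "(\<lambda>_. a) \<in> range poly" by (rule image_eqI[of _ _ "[:a:]"]) auto
  assume "f \<in> range poly" "g \<in> range poly"
  then obtain p q where "f = poly p" "g = poly q" by blast
  then show "(\<lambda>t. f t + g t) \<in> range poly" "(\<lambda>t. f t * g t) \<in> range poly"
    by (auto simp: fun_eq_iff intro: image_eqI[of _ _ "p + q"] image_eqI[of _ _ "p * q"])
qed

lemma range_poly_sum:
  fixes f :: "'i \<Rightarrow> 'k::field \<Rightarrow> 'k"
  assumes "\<And>i. i \<in> I \<Longrightarrow> f i \<in> range poly"
  shows "(\<lambda>t. \<Sum>i\<in>I. f i t) \<in> range poly"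
  using assms
  by (induction I rule: infinite_finite_induct) (simp_all add: range_poly_closed)

lemma range_poly_prod:
  fixes f :: "'i \<Rightarrow> 'k::field \<Rightarrow> 'k"
  assumes "\<And>i. i \<in> I \<Longrightarrow> f i \<in> range poly"
  shows "(\<lambda>t. \<Prod>i\<in>I. f i t) \<in> range poly"
  using assms
  by (induction I rule: infinite_finite_induct) (simp_all add: range_poly_closed)

lemma range_poly_det:
  fixes g :: "'k::field \<Rightarrow> 'k ^ 'd::finite ^ 'd"
  assumes "\<And>i j. (\<lambda>t. g t $ i $ j) \<in> range poly"
  shows "(\<lambda>t. det (g t)) \<in> range poly"
  unfolding det_def
  by (intro range_poly_sum range_poly_closed(3)[OF range_poly_closed(1)] range_poly_prod assms)

text \<open>Along a curve whose entries have the common denominator \<delta>, a polynomial function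
  has a power of \<delta> as denominator; the exponents add up along the construction of f.\<close>

lemma polynomial_funs_rational_curve:
  fixes x :: "'k::field \<Rightarrow> 'r \<Rightarrow> 'k ^ 'd ^ 'd"
  assumes f: "f \<in> polynomial_funs"
    and x: "\<And>t s i j. \<delta> t \<noteq> 0 \<Longrightarrow> x t s $ i $ j = N s i j t / \<delta> t"
    and N: "\<And>s i j. N s i j \<in> range poly" and \<delta>: "\<delta> \<in> range poly"
  shows "\<exists>n. \<exists>Q\<in>range poly. \<forall>t. \<delta> t \<noteq> 0 \<longrightarrow> f (x t) * \<delta> t ^ n = Q t"
proof -
  have pow: "(\<lambda>t. \<delta> t ^ n) \<in> range poly" for n
    by (induction n) (simp_all add: range_poly_closed \<delta>)
  show ?thesis using f
  proof induction
    case (const a)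
    show ?case by (intro exI[of _ 0] bexI[of _ "\<lambda>_. a"] range_poly_closed) simp
  next
    case (coord s i j)
    show ?case using x by (intro exI[of _ 1] bexI[OF _ N[of s i j]]) simp
  next
    case (add f g)
    then obtain m n P Q where "P \<in> range poly" "Q \<in> range poly"
      and *: "\<And>t. \<delta> t \<noteq> 0 \<Longrightarrow> f (x t) * \<delta> t ^ m = P t" "\<And>t. \<delta> t \<noteq> 0 \<Longrightarrow> g (x t) * \<delta> t ^ n = Q t"
      by blast
    then have "(\<lambda>t. P t * \<delta> t ^ n + Q t * \<delta> t ^ m) \<in> range poly"
      by (intro range_poly_closed pow)
    then show ?case
      by (intro exI[of _ "m + n"] bexI) (auto simp: *[symmetric] algebra_simps power_add)
  next
    case (mult f g)
    then obtain m n P Q where "P \<in> range poly" "Q \<in> range poly"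
      and *: "\<And>t. \<delta> t \<noteq> 0 \<Longrightarrow> f (x t) * \<delta> t ^ m = P t" "\<And>t. \<delta> t \<noteq> 0 \<Longrightarrow> g (x t) * \<delta> t ^ n = Q t"
      by blast
    then have "(\<lambda>t. P t * Q t) \<in> range poly" by (intro range_poly_closed)
    then show ?case
      by (intro exI[of _ "m + n"] bexI) (auto simp: *[symmetric] algebra_simps power_add)
  qed
qed

text \<open>In matrix form the data are an invertible g and strictly triangular matrices y, and x is
  \<open>g y g^-1\<close>. The triangular y form a linear space and the g an open part of one, so
  there are lines through any two of them.\<close>

lemma adapted_basis_iff:
  fixes x :: "'r \<Rightarrow> 'k::field ^ 'd::finite ^ 'd"
  shows "adapted_basis h x b \<longleftrightarrow> det (of_columns b) \<noteq> 0 \<and>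
    (\<exists>y. (\<forall>s i j. \<not> h j < h i \<longrightarrow> y s $ i $ j = 0) \<and> (\<forall>s. x s ** of_columns b = of_columns b ** y s))"
proof (cases "det (of_columns b) = 0")
  case False
  then have inj: "inj b" by (simp add: det_of_columns_nonzero_iff_independent)
  have span: "v \<in> vec.span (b ` J) \<longleftrightarrow> (\<exists>c. (\<forall>i. i \<notin> J \<longrightarrow> c i = 0) \<and> v = (\<Sum>i\<in>UNIV. c i *s b i))" for v J
  proof
    assume "v \<in> vec.span (b ` J)"
    then obtain u where "v = (\<Sum>w\<in>b ` J. u w *s w)" by (auto simp: vec.span_finite)
    also have "\<dots> = (\<Sum>i\<in>J. u (b i) *s b i)"
      by (intro sum.reindex_cong[OF _ refl]) (use inj in \<open>auto intro: inj_on_subset\<close>)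
    also have "\<dots> = (\<Sum>i\<in>UNIV. (if i \<in> J then u (b i) else 0) *s b i)"
      by (rule sum.mono_neutral_cong_left) auto
    finally show "\<exists>c. (\<forall>i. i \<notin> J \<longrightarrow> c i = 0) \<and> v = (\<Sum>i\<in>UNIV. c i *s b i)"
      by (intro exI[of _ "\<lambda>i. if i \<in> J then u (b i) else 0"]) auto
  next
    assume "\<exists>c. (\<forall>i. i \<notin> J \<longrightarrow> c i = 0) \<and> v = (\<Sum>i\<in>UNIV. c i *s b i)"
    then obtain c where c: "\<And>i. i \<notin> J \<Longrightarrow> c i = 0" "v = (\<Sum>i\<in>UNIV. c i *s b i)" by blast
    show "v \<in> vec.span (b ` J)" unfolding c(2)
    proof (rule vec.span_sum)
      fix i show "c i *s b i \<in> vec.span (b ` J)"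
        using c(1)[of i] by (cases "i \<in> J") (auto intro: vec.span_scale vec.span_base vec.span_zero)
    qed
  qed
  have col: "(x s ** of_columns b = of_columns b ** y) \<longleftrightarrow>
      (\<forall>j. x s *v b j = (\<Sum>i\<in>UNIV. y $ i $ j *s b i))" for s and y :: "'k ^ 'd ^ 'd"
    by (auto simp: vec_eq_iff of_columns_def matrix_matrix_mult_def matrix_vector_mult_def mult.commute)
  have "adapted_basis h x b \<longleftrightarrow>
    (\<forall>s j. \<exists>c. (\<forall>i. \<not> h j < h i \<longrightarrow> c i = 0) \<and> x s *v b j = (\<Sum>i\<in>UNIV. c i *s b i))"
    using False by (simp add: adapted_basis_def span)
  also have "\<dots> \<longleftrightarrow> (\<exists>y. (\<forall>s i j. \<not> h j < h i \<longrightarrow> y s $ i $ j = 0) \<and>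
      (\<forall>s. x s ** of_columns b = of_columns b ** y s))" (is "?A \<longleftrightarrow> (\<exists>y. ?B y)")
  proof
    assume ?A
    then obtain c where c: "\<And>s j i. \<not> h j < h i \<Longrightarrow> c s j i = 0"
      "\<And>s j. x s *v b j = (\<Sum>i\<in>UNIV. c s j i *s b i)" by metis
    then show "\<exists>y. ?B y" unfolding col
      by (intro exI[of _ "\<lambda>s. \<chi> i j. c s j i"]) simp
  next
    assume "\<exists>y. ?B y"
    then obtain y where y: "?B y" by blast
    show ?A
    proof (intro allI)
      fix s j show "\<exists>c. (\<forall>i. \<not> h j < h i \<longrightarrow> c i = 0) \<and> x s *v b j = (\<Sum>i\<in>UNIV. c i *s b i)"
        using y unfolding col by (intro exI[of _ "\<lambda>i. y s $ i $ j"]) simp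
    qed
  qed
  finally show ?thesis using False by simp
qed (simp add: adapted_basis_def)

text \<open>The set of points with an adapted basis is irreducible: two such points \<open>g y g\<^sup>-\<^sup>1\<close> are
  joined by the curve obtained from the lines through the \<open>g\<close> and through the triangular \<open>y\<close>,
  and it is rational by Cramer's rule.\<close>

lemma adapted_basis_irreducible:
  fixes x1 x2 :: "'r \<Rightarrow> 'k::alg_closed_field ^ 'd::finite ^ 'd"
  assumes b: "adapted_basis h x1 b1" "adapted_basis h x2 b2"
    and f: "f1 \<in> polynomial_funs" "f2 \<in> polynomial_funs" "f1 x1 \<noteq> 0" "f2 x2 \<noteq> 0"
  shows "\<exists>x b. adapted_basis h x b \<and> f1 x \<noteq> 0 \<and> f2 x \<noteq> 0"
proof -
  obtain y1 where y1: "\<And>s i j. \<not> h j < h i \<Longrightarrow> y1 s $ i $ j = 0" "\<And>s. x1 s ** of_columns b1 = of_columns b1 ** y1 s"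
    and d1: "det (of_columns b1) \<noteq> 0"
    using b(1) unfolding adapted_basis_iff by blast
  obtain y2 where y2: "\<And>s i j. \<not> h j < h i \<Longrightarrow> y2 s $ i $ j = 0" "\<And>s. x2 s ** of_columns b2 = of_columns b2 ** y2 s"
    and d2: "det (of_columns b2) \<noteq> 0"
    using b(2) unfolding adapted_basis_iff by blast
  define bt where "bt t j = (\<chi> i. (1 - t) * b1 j $ i + t * b2 j $ i)" for t j
  define g where "g t = of_columns (bt t)" for t
  define y where "y t s = (\<chi> i j. (1 - t) * y1 s $ i $ j + t * y2 s $ i $ j)" for t s
  define \<delta> where "\<delta> t = det (g t)" for t
  \<comment> \<open>The adjugate of \<open>g t\<close>, entry by entry a determinant from Cramer's
    rule and hence polynomial in t. Away from the zeros of \<delta> the inverse is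
    \<open>gi t\<close>, and \<open>N\<close> collects the numerators of the curve.\<close>
  define a where "a t = (\<chi> i j. det (\<chi> p q. if q = i then axis j 1 $ p else g t $ p $ q))" for t
  define N where "N s i j t = (g t ** y t s ** a t) $ i $ j" for s i j t
  define gi where "gi t = (\<chi> i j. a t $ i $ j / \<delta> t)" for t
  define x where "x t s = g t ** y t s ** gi t" for t s
  have lin: "(\<lambda>t. (1 - t) * u + t * v) \<in> range poly" for u v :: 'k
    by (rule image_eqI[of _ _ "[:u, v - u:]"]) (auto simp: algebra_simps)
  have g: "(\<lambda>t. g t $ i $ j) \<in> range poly" for i j
    unfolding g_def of_columns_nth bt_def vec_lambda_beta by (rule lin)
  have y: "(\<lambda>t. y t s $ i $ j) \<in> range poly" for s i j
    unfolding y_def vec_lambda_beta by (rule lin)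
  have \<delta>: "\<delta> \<in> range poly" unfolding \<delta>_def by (intro range_poly_det g)
  have a: "(\<lambda>t. a t $ i $ j) \<in> range poly" for i j
    unfolding a_def vec_lambda_beta
  proof (rule range_poly_det)
    fix p q show "(\<lambda>t. (\<chi> p q. if q = i then axis j 1 $ p else g t $ p $ q) $ p $ q) \<in> range poly"
      unfolding vec_lambda_beta by (cases "q = i") (simp_all add: range_poly_closed g)
  qed
  have N: "N s i j \<in> range poly" for s i j
    unfolding N_def matrix_matrix_mult_def vec_lambda_beta
    by (intro range_poly_sum range_poly_closed g y a)
  have inv: "g t ** gi t = mat 1" if "\<delta> t \<noteq> 0" for t
  proof -
    have "(g t ** gi t) $ i $ j = mat 1 $ i $ j" for i j
    proof -
      have "g t *v (\<chi> k. a t $ k $ j / \<delta> t) = axis j 1"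
        using that cramer[of "g t" "\<chi> k. a t $ k $ j / \<delta> t" "axis j 1"] by (simp add: a_def \<delta>_def)
      then have "(g t *v (\<chi> k. a t $ k $ j / \<delta> t)) $ i = axis j 1 $ i" by simp
      then show ?thesis
        by (simp add: matrix_matrix_mult_def matrix_vector_mult_def gi_def mat_def axis_def eq_commute)
    qed
    then show ?thesis by (simp add: vec_eq_iff)
  qed
  then have inv': "gi t ** g t = mat 1" if "\<delta> t \<noteq> 0" for t
    using that matrix_left_right_inverse by blast
  have xg: "x t s ** g t = g t ** y t s" if "\<delta> t \<noteq> 0" for t s
    using inv'[OF that] by (simp add: x_def matrix_mul_assoc[symmetric])
  have "adapted_basis h (x t) (bt t)" if "\<delta> t \<noteq> 0" for t
    unfolding adapted_basis_iff using that xg[OF that] y1(1) y2(1)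
    by (intro conjI exI[of _ "y t"]) (auto simp: g_def \<delta>_def y_def)
  moreover have "\<exists>t. \<delta> t \<noteq> 0 \<and> f1 (x t) \<noteq> 0 \<and> f2 (x t) \<noteq> 0"
  proof -
    have xN: "x t s $ i $ j = N s i j t / \<delta> t" for t s i j
      by (simp add: x_def N_def gi_def matrix_matrix_mult_def sum_divide_distrib)
    \<comment> \<open>Where \<open>g t\<close> is invertible, \<open>x t\<close> is determined by
      \<open>g t\<close> and \<open>y t\<close>; this identifies the points at t = 0 and t = 1 with
      the given ones.\<close>
    have uniq: "x t = x'" if "\<delta> t \<noteq> 0" "\<And>s. x' s ** g t = g t ** y t s" for t x'
    proof
      fix s show "x t s = x' s"
        using that(2)[of s] inv[OF that(1)] by (metis x_def matrix_mul_assoc matrix_mul_rid)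
    qed
    have g0: "g 0 = of_columns b1" "g 1 = of_columns b2" "y 0 = y1" "y 1 = y2"
      by (auto simp: g_def bt_def y_def vec_eq_iff of_columns_def)
    have x0: "\<delta> 0 \<noteq> 0" "x 0 = x1"
      using d1 y1(2) uniq[of 0 x1] by (auto simp: \<delta>_def g0)
    have x1: "\<delta> 1 \<noteq> 0" "x 1 = x2"
      using d2 y2(2) uniq[of 1 x2] by (auto simp: \<delta>_def g0)
    obtain n1 P1 where P1: "P1 \<in> range poly" "\<forall>t. \<delta> t \<noteq> 0 \<longrightarrow> f1 (x t) * \<delta> t ^ n1 = P1 t"
      using polynomial_funs_rational_curve[where x = x and N = N and \<delta> = \<delta>, OF f(1) xN N \<delta>]
      by (elim exE bexE)
    then obtain Q1 where "P1 = poly Q1" by blast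
    then have Q1: "f1 (x t) * \<delta> t ^ n1 = poly Q1 t" if "\<delta> t \<noteq> 0" for t
      using P1(2) that by simp
    obtain n2 P2 where P2: "P2 \<in> range poly" "\<forall>t. \<delta> t \<noteq> 0 \<longrightarrow> f2 (x t) * \<delta> t ^ n2 = P2 t"
      using polynomial_funs_rational_curve[where x = x and N = N and \<delta> = \<delta>, OF f(2) xN N \<delta>]
      by (elim exE bexE)
    then obtain Q2 where "P2 = poly Q2" by blast
    then have Q2: "f2 (x t) * \<delta> t ^ n2 = poly Q2 t" if "\<delta> t \<noteq> 0" for t
      using P2(2) that by simp
    obtain D where D: "\<delta> = poly D" using \<delta> by blast
    have "poly Q1 0 \<noteq> 0" using Q1[OF x0(1), symmetric] x0 f(3) by simp
    moreover have "poly Q2 1 \<noteq> 0" using Q2[OF x1(1), symmetric] x1 f(4) by simp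
    moreover have "poly D 0 \<noteq> 0" using x0(1) D by simp
    \<comment> \<open>D and Q1 are nonzero at 0 and Q2 at 1, so the product is a nonzero polynomial,
      and in an infinite field some t is not a root of it.\<close>
    ultimately have "D * Q1 * Q2 \<noteq> 0" by auto
    then have "finite {t. poly (D * Q1 * Q2) t = 0}" by (rule poly_roots_finite)
    then obtain t where t: "poly (D * Q1 * Q2) t \<noteq> 0"
      using infinite_UNIV_alg_closed_field ex_new_if_finite[of "{t. poly (D * Q1 * Q2) t = 0}"] by blast
    then have "\<delta> t \<noteq> 0" by (simp add: D)
    moreover have "f1 (x t) \<noteq> 0" using Q1[OF \<open>\<delta> t \<noteq> 0\<close>] t by auto
    moreover have "f2 (x t) \<noteq> 0" using Q2[OF \<open>\<delta> t \<noteq> 0\<close>] t by auto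
    ultimately show ?thesis by blast
  qed
  ultimately show ?thesis by blast
qed

lemma openin_zariski_dim_path_spaces_ge:
  "openin zariski {x :: 'r \<Rightarrow> 'k::field ^ 'd::finite ^ 'd. \<forall>l\<le>(m::nat). n l \<le> vec.dim (path_space x l)}"
proof -
  have "{x :: 'r \<Rightarrow> 'k ^ 'd ^ 'd. \<forall>l\<le>m. n l \<le> vec.dim (path_space x l)} =
      (\<Inter>l\<in>{..m}. {x. n l \<le> vec.dim (path_space x l)})" by auto
  then show ?thesis by (auto intro!: openin_INT2 openin_zariski_dim_path_space_ge)
qed

text \<open>The point found on the curve must lie in the layer again. Its adapted basis bounds the
  ranks from above; the bounds from below are built into the choice of \<open>f1\<close> and
  \<open>f2\<close>, whose nonvanishing forces a point of the variety into \<open>?W\<close> as well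
  as out of F and G.\<close>

lemma rep_layer_irreducible:
  fixes h :: "'d::finite \<Rightarrow> nat"
  assumes h: "\<And>l. l \<le> L \<Longrightarrow> card {j. h j = l} = S l" "\<And>j. h j \<le> L" and L: "1 \<le> L"
    and ne: "rep_layer L S \<noteq> ({} :: ('r::finite \<Rightarrow> 'k::alg_closed_field ^ 'd ^ 'd) set)"
  shows "irreducible_subset (rep_topology L) (rep_layer L S :: ('r \<Rightarrow> 'k ^ 'd ^ 'd) set)"
  unfolding irreducible_subset_def
proof (intro conjI allI impI ne)
  let ?A = "rep_layer L S :: ('r \<Rightarrow> 'k ^ 'd ^ 'd) set"
  let ?W = "{x :: 'r \<Rightarrow> 'k ^ 'd ^ 'd. \<forall>l\<le>L. sum S {l..L} \<le> vec.dim (path_space x l)}"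
  show "?A \<subseteq> topspace (rep_topology L)" by (auto simp: rep_layer_def)
  fix F G :: "('r \<Rightarrow> 'k ^ 'd ^ 'd) set"
  assume FG: "closedin (rep_topology L) F \<and> closedin (rep_topology L) G \<and> ?A \<subseteq> F \<union> G"
  show "?A \<subseteq> F \<or> ?A \<subseteq> G"
  proof (rule ccontr)
    assume "\<not> (?A \<subseteq> F \<or> ?A \<subseteq> G)"
    then obtain x1 x2 where x: "x1 \<in> ?A" "x1 \<notin> F" "x2 \<in> ?A" "x2 \<notin> G" by blast
    have op: "\<exists>f b. f \<in> polynomial_funs \<and> f x \<noteq> 0 \<and> (\<forall>y\<in>rep_variety L. f y \<noteq> 0 \<longrightarrow> y \<notin> H \<and> y \<in> ?W) \<and> adapted_basis h x b"
      if H: "closedin (rep_topology L) H" and x: "x \<in> ?A" "x \<notin> H" for H x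
    proof -
      have xl: "x \<in> rep_variety L" "\<And>l. vec.dim (path_space x l) = sum S {l..L}"
        using x(1) unfolding rep_layer_iff[OF L] by blast+
      obtain Z where Z: "closedin zariski Z" "H = Z \<inter> rep_variety L"
        using H by (auto simp: rep_topology_def closedin_subtopology)
      have "openin zariski ((UNIV - Z) \<inter> ?W)"
        using Z(1) openin_zariski_dim_path_spaces_ge
        by (intro openin_Int) (auto simp: closedin_def)
      moreover have "x \<in> (UNIV - Z) \<inter> ?W" using x xl Z(2) by auto
      ultimately obtain f where "f \<in> polynomial_funs" "f x \<noteq> 0" "{y. f y \<noteq> 0} \<subseteq> (UNIV - Z) \<inter> ?W"
        by (rule zariski_openE)
      moreover obtain b where "adapted_basis h x b" using ex_adapted_basis[OF h xl(2)] by blast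
      ultimately show ?thesis using Z(2) by blast
    qed
    have "closedin (rep_topology L) F" using FG by blast
    from op[OF this x(1,2)] obtain f1 b1 where f1: "f1 \<in> polynomial_funs" "f1 x1 \<noteq> 0"
      "\<forall>y\<in>rep_variety L. f1 y \<noteq> 0 \<longrightarrow> y \<notin> F \<and> y \<in> ?W" "adapted_basis h x1 b1"
      by (elim exE conjE)
    have "closedin (rep_topology L) G" using FG by blast
    from op[OF this x(3,4)] obtain f2 b2 where f2: "f2 \<in> polynomial_funs" "f2 x2 \<noteq> 0"
      "\<forall>y\<in>rep_variety L. f2 y \<noteq> 0 \<longrightarrow> y \<notin> G \<and> y \<in> ?W" "adapted_basis h x2 b2"
      by (elim exE conjE)
    obtain y b where y: "adapted_basis h y b" "f1 y \<noteq> 0" "f2 y \<noteq> 0"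
      using adapted_basis_irreducible[OF f1(4) f2(4) f1(1) f2(1) f1(2) f2(2)] by (elim exE conjE)
    have yv: "y \<in> rep_variety L" by (rule adapted_basis_rep_variety[OF y(1) h(2)])
    have "y \<in> ?W" "y \<notin> F" "y \<notin> G" using bspec[OF f1(3) yv] bspec[OF f2(3) yv] y(2,3) by simp_all
    have "vec.dim (path_space y l) = sum S {l..L}" for l
    proof (cases "l \<le> L")
      case True
      then show ?thesis using \<open>y \<in> ?W\<close> dim_path_space_adapted_basis[OF y(1), of l] card_level_ge[OF h, of l]
        by (simp add: order_antisym)
    qed (simp add: path_space_eq_0[OF yv])
    then have "y \<in> ?A" using yv by (simp add: rep_layer_iff[OF L])
    then show False using FG \<open>y \<notin> F\<close> \<open>y \<notin> G\<close> by blast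
  qed
qed

section \<open>An open subset of a layer\<close>

lemma path_matrix_transpose:
  fixes x :: "'r \<Rightarrow> 'k::field ^ 'd::finite ^ 'd"
  shows "path_matrix (\<lambda>s. transpose (x s)) p = transpose (path_matrix x (rev p))"
  by (induction p)
     (simp_all add: path_matrix_Cons path_matrix_append matrix_transpose_mul)

lemma sum_mult_transpose:
  fixes A :: "'k::field ^ 'd::finite ^ 'd"
  shows "(\<Sum>i\<in>UNIV. (transpose A *v w) $ i * v $ i) = (\<Sum>i\<in>UNIV. w $ i * (A *v v) $ i)"
proof -
  have "(\<Sum>i\<in>UNIV. (transpose A *v w) $ i * v $ i) = (\<Sum>i\<in>UNIV. \<Sum>j\<in>UNIV. A $ j $ i * w $ j * v $ i)"
    unfolding matrix_vector_mult_def transpose_def by (simp add: sum_distrib_right)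
  also have "\<dots> = (\<Sum>j\<in>UNIV. \<Sum>i\<in>UNIV. A $ j $ i * w $ j * v $ i)" by (rule sum.swap)
  also have "\<dots> = (\<Sum>i\<in>UNIV. w $ i * (A *v v) $ i)"
    unfolding matrix_vector_mult_def by (simp add: sum_distrib_left mult_ac)
  finally show ?thesis .
qed

text \<open>A path of length m acting on the dual can be moved over to v with its word reversed.
  There it produces a vector of \<open>J^(l+m) M\<close>, which is 0.\<close>

lemma orthogonal_path_space_transpose:
  fixes x :: "'r \<Rightarrow> 'k::field ^ 'd::finite ^ 'd"
  assumes x: "x \<in> rep_variety L" and lm: "L < l + m"
    and v: "v \<in> path_space x l" and w: "w \<in> path_space (\<lambda>s. transpose (x s)) m"
  shows "(\<Sum>i\<in>UNIV. w $ i * v $ i) = 0"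
  using w unfolding path_space_def
proof (induction rule: vec.span_induct_alt)
  case base
  show ?case by simp
next
  case (step c u w)
  then obtain p u' where u: "u = path_matrix (\<lambda>s. transpose (x s)) p *v u'" "length p = m" by blast
  have "path_matrix x (rev p) *v v \<in> path_space x (length (rev p) + l)"
    by (rule path_matrix_mult_path_space[OF v])
  then have "path_matrix x (rev p) *v v = 0"
    using path_space_eq_0[OF x, of "m + l"] lm u(2) by simp
  then have "(\<Sum>i\<in>UNIV. u $ i * v $ i) = 0"
    unfolding u(1) path_matrix_transpose sum_mult_transpose by simp
  then show ?case using step
    by (simp add: distrib_right sum.distrib mult.assoc sum_distrib_left[symmetric])
qed

text \<open>A basis of the span of W, completed to a basis of the whole space, gives the rows of an
  invertible matrix, which carries V into the vectors vanishing at the rows that come from W.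
  Orthogonal complements are avoided, because over a general field a subspace may meet its
  own.\<close>

lemma dim_orthogonal_le:
  fixes V W :: "('k::field ^ 'd::finite) set"
  assumes orth: "\<And>v w. v \<in> V \<Longrightarrow> w \<in> W \<Longrightarrow> (\<Sum>i\<in>UNIV. w $ i * v $ i) = 0"
  shows "vec.dim V + vec.dim W \<le> CARD('d)"
proof -
  obtain B where B: "B \<subseteq> W" "vec.independent B" "card B = vec.dim W"
    using vec.basis_exists by metis
  obtain C where C: "B \<subseteq> C" "vec.independent C" "UNIV \<subseteq> vec.span C"
    using vec.maximal_independent_subset_extend[of B UNIV] B(2) by auto
  then obtain b :: "'d \<Rightarrow> 'k ^ 'd" where b: "bij_betw b UNIV C" using ex_bij_betw_basis by blast
  have inj: "inj b" and ran: "range b = C" using b by (auto simp: bij_betw_def)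
  define J where "J = b -` B"
  have J: "card J = card B" unfolding J_def using C(1) ran by (intro card_vimage_inj inj) auto
  let ?M = "transpose (of_columns b)"
  have "det ?M \<noteq> 0"
    using inj C(2) ran by (simp add: det_transpose det_of_columns_nonzero_iff_independent)
  then have injM: "inj ((*v) ?M)"
    unfolding invertible_det_nz[symmetric] invertible_left_inverse matrix_left_invertible_injective .
  have "(*v) ?M ` V \<subseteq> {y. \<forall>i. i \<notin> - J \<longrightarrow> y $ i = 0}"
  proof (intro image_subsetI CollectI allI impI)
    fix v j assume "v \<in> V" "j \<notin> - J"
    then have "(\<Sum>i\<in>UNIV. b j $ i * v $ i) = 0" using B(1) by (intro orth) (auto simp: J_def)
    then show "(?M *v v) $ j = 0"
      by (simp add: matrix_vector_mult_def transpose_def of_columns_nth del: transpose_matrix_vector)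
  qed
  then have sub: "vec.dim ((*v) ?M ` V) \<le> vec.dim {y :: 'k ^ 'd. \<forall>i. i \<notin> - J \<longrightarrow> y $ i = 0}"
    by (rule vec.dim_subset)
  have "vec.dim V = vec.dim ((*v) ?M ` V)"
    by (rule vec.dim_image_eq[symmetric]) (auto intro: inj_on_subset[OF injM] matrix_vector_mul_linear_gen)
  also note sub
  also have "vec.dim {y :: 'k ^ 'd. \<forall>i. i \<notin> - J \<longrightarrow> y $ i = 0} = card (- J)" by (rule dim_substandard_cart)
  also have "\<dots> = CARD('d) - card J" by (simp add: Compl_eq_Diff_UNIV card_Diff_subset)
  finally show ?thesis using J B(3) card_mono[of UNIV J] by simp
qed

section \<open>Graded modules given by partial permutations\<close>

definition partial_permutation_rep :: "('r \<Rightarrow> ('d \<times> 'd) set) \<Rightarrow> 'r \<Rightarrow> 'k::field ^ 'd ^ 'd" where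
  "partial_permutation_rep E s = (\<chi> i j. if (j, i) \<in> E s then 1 else 0)"

lemma transpose_partial_permutation_rep:
  "transpose (partial_permutation_rep E s) = partial_permutation_rep (\<lambda>s. (E s)\<inverse>) s"
  by (simp add: partial_permutation_rep_def transpose_def)

lemma partial_permutation_rep_axis:
  assumes "single_valued (E s)" "(j, i) \<in> E s"
  shows "partial_permutation_rep E s *v axis j (1 :: 'k::field) = (axis i 1 :: 'k ^ 'd::finite)"
proof -
  have "(j, i') \<in> E s \<longleftrightarrow> i' = i" for i' using assms by (auto simp: single_valued_def)
  then show ?thesis
    by (simp add: vec_eq_iff matrix_vector_mult_def axis_def partial_permutation_rep_def if_distrib[of "\<lambda>y. _ * y"] cong: if_cong)
qed

lemma partial_permutation_rep_axis_0:
  assumes "\<And>i. (j, i) \<notin> E s"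
  shows "partial_permutation_rep E s *v axis j (1 :: 'k::field) = (0 :: 'k ^ 'd::finite)"
  using assms
  by (simp add: vec_eq_iff matrix_vector_mult_def axis_def partial_permutation_rep_def if_distrib[of "\<lambda>y. _ * y"] cong: if_cong)

lemma det_of_columns_axis: "det (of_columns (\<lambda>j. axis j (1 :: 'k::field)) :: 'k ^ 'd::finite ^ 'd) \<noteq> 0"
proof -
  have "of_columns (\<lambda>j. axis j 1) = (mat 1 :: 'k ^ 'd ^ 'd)"
    by (simp add: of_columns_def mat_def axis_def vec_eq_iff)
  then show ?thesis by simp
qed

text \<open>Going back l steps along predecessors exhibits each unit vector of level at least l as a
  path of length l applied to another unit vector. This serves twice: for the module with grading h,
  and for its dual with reversed edges and grading \<open>L - h i\<close>.\<close>

lemma dim_partial_permutation_rep: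
  fixes E :: "'r \<Rightarrow> ('d::finite \<times> 'd) set"
  assumes sv: "\<And>s. single_valued (E s)"
    and pred: "\<And>i. 0 < h i \<Longrightarrow> \<exists>s j. (j, i) \<in> E s \<and> h i = Suc (h j)"
  shows "card {i. l \<le> h i} \<le> vec.dim (path_space (partial_permutation_rep E :: 'r \<Rightarrow> 'k::field ^ 'd ^ 'd) l)"
proof -
  let ?x = "partial_permutation_rep E :: 'r \<Rightarrow> 'k ^ 'd ^ 'd"
  have "axis i 1 \<in> path_space ?x l" if "l \<le> h i" for i
    using that
  proof (induction l arbitrary: i)
    case 0
    then show ?case by (simp add: path_space_0)
  next
    case (Suc l)
    then obtain s j where sj: "(j, i) \<in> E s" "h i = Suc (h j)" using pred[of i] by auto
    then have "axis j 1 \<in> path_space ?x l" using Suc by simp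
    from path_matrix_mult_path_space[OF this, of "[s]"]
    show ?case using partial_permutation_rep_axis[of E s j i, where 'k = 'k] sv sj
      by (simp add: path_matrix_Cons)
  qed
  then have sub: "(\<lambda>i. axis i (1 :: 'k)) ` {i. l \<le> h i} \<subseteq> path_space ?x l" by blast
  have inj: "inj (\<lambda>i :: 'd. axis i (1 :: 'k))" and ind: "vec.independent (range (\<lambda>i :: 'd. axis i (1 :: 'k)))"
    using det_of_columns_axis[where 'k = 'k and 'd = 'd]
    unfolding det_of_columns_nonzero_iff_independent by blast+
  have "card {i. l \<le> h i} = card ((\<lambda>i. axis i (1 :: 'k)) ` {i. l \<le> h i})"
    by (rule card_image[symmetric]) (rule inj_on_subset[OF inj], simp)
  also have "\<dots> \<le> vec.dim (path_space ?x l)"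
    by (rule vec.independent_card_le_dim[OF sub]) (rule vec.independent_mono[OF ind], blast)
  finally show ?thesis .
qed

text \<open>One loop \<open>s0\<close> embeds A into B. What is left of B has at most
  \<open>(CARD('r) - 1) * card A\<close> elements and is sent injectively to pairs
  \<open>(a, s)\<close> with \<open>s \<noteq> s0\<close>. Injectivity of f and g makes every
  \<open>E s\<close> a partial injection.\<close>

lemma ex_partial_permutations_aux:
  fixes A :: "'a set" and B :: "'b set"
  assumes fin: "finite A" "finite B" and card: "card A \<le> card B" "card B \<le> CARD('r::finite) * card A"
  shows "\<exists>E :: 'r \<Rightarrow> ('a \<times> 'b) set. (\<forall>s. E s \<subseteq> A \<times> B \<and> single_valued (E s) \<and> single_valued ((E s)\<inverse>)) \<and>
    (\<forall>a\<in>A. \<exists>s b. (a, b) \<in> E s) \<and> (\<forall>b\<in>B. \<exists>s a. (a, b) \<in> E s)"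
proof -
  define s0 :: 'r where "s0 = undefined"
  obtain f where f: "inj_on f A" "f ` A \<subseteq> B" using card_le_inj[OF fin card(1)] by blast
  have "card (B - f ` A) = card B - card A"
    using f fin by (simp add: card_Diff_subset card_image)
  also have "\<dots> \<le> card A * (CARD('r) - 1)"
    using card(2) by (simp add: algebra_simps diff_mult_distrib2)
  also have "\<dots> = card (A \<times> (UNIV - {s0}))" by (simp add: card_cartesian_product card_Diff_subset)
  finally obtain g where g: "inj_on g (B - f ` A)" "g ` (B - f ` A) \<subseteq> A \<times> (UNIV - {s0})"
    using card_le_inj[of "B - f ` A" "A \<times> (UNIV - {s0})"] fin by auto
  define E where "E s = {(a, b). a \<in> A \<and> b \<in> B \<and>
    (if b \<in> f ` A then b = f a \<and> s = s0 else g b = (a, s))}" for s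
  have "single_valued (E s)" for s
    unfolding single_valued_def
  proof (intro allI impI)
    fix a b b' assume ab: "(a, b) \<in> E s" "(a, b') \<in> E s"
    have sb: "g b \<noteq> (a, s0)" if "b \<in> B - f ` A" for a b using g(2) that by fastforce
    show "b = b'"
    proof (cases "s = s0")
      case True
      then show ?thesis using ab sb by (auto simp: E_def split: if_splits)
    next
      case False
      then have "b \<in> B - f ` A" "b' \<in> B - f ` A" "g b = g b'"
        using ab by (auto simp: E_def split: if_splits)
      then show ?thesis using g(1) by (auto dest: inj_onD)
    qed
  qed
  moreover have "single_valued ((E s)\<inverse>)" for s
    using f(1) by (auto simp: single_valued_def E_def inj_on_def split: if_splits)
  moreover have "\<exists>s b. (a, b) \<in> E s" if "a \<in> A" for a
    using that f(2) by (intro exI[of _ s0] exI[of _ "f a"]) (auto simp: E_def)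
  moreover have "\<exists>s a. (a, b) \<in> E s" if "b \<in> B" for b
  proof (cases "b \<in> f ` A")
    case True
    then show ?thesis using that by (auto simp: E_def)
  next
    case False
    then have "b \<in> B - f ` A" using that by blast
    from subsetD[OF g(2) imageI[OF this]] obtain a s where "g b = (a, s)" "a \<in> A" by blast
    then have "(a, b) \<in> E s" using that False by (simp add: E_def)
    then show ?thesis by blast
  qed
  moreover have "E s \<subseteq> A \<times> B" for s by (auto simp: E_def)
  ultimately show ?thesis by (intro exI[of _ E]) blast
qed

lemma ex_partial_permutations:
  fixes A :: "'a set" and B :: "'b set"
  assumes fin: "finite A" "finite B"
    and card: "card A \<le> CARD('r::finite) * card B" "card B \<le> CARD('r) * card A"
  shows "\<exists>E :: 'r \<Rightarrow> ('a \<times> 'b) set. (\<forall>s. E s \<subseteq> A \<times> B \<and> single_valued (E s) \<and> single_valued ((E s)\<inverse>)) \<and>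
    (\<forall>a\<in>A. \<exists>s b. (a, b) \<in> E s) \<and> (\<forall>b\<in>B. \<exists>s a. (a, b) \<in> E s)"
proof (cases "card A \<le> card B")
  case True
  then show ?thesis by (rule ex_partial_permutations_aux[OF fin _ card(2)])
next
  case False
  then have "card B \<le> card A" by simp
  from ex_partial_permutations_aux[OF fin(2,1) this card(1)]
  obtain E :: "'r \<Rightarrow> ('b \<times> 'a) set" where
    E: "\<forall>s. E s \<subseteq> B \<times> A \<and> single_valued (E s) \<and> single_valued ((E s)\<inverse>)"
      "\<forall>a\<in>B. \<exists>s b. (a, b) \<in> E s" "\<forall>b\<in>A. \<exists>s a. (a, b) \<in> E s"
    by (elim exE conjE)
  have "(E s)\<inverse> \<subseteq> A \<times> B" for s using E(1) by blast
  then show ?thesis using E by (intro exI[of _ "\<lambda>s. (E s)\<inverse>"]) simp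
qed

lemma openin_zariski_dim_path_space_transpose_ge:
  "openin zariski {x :: 'r \<Rightarrow> 'k::field ^ 'd::finite ^ 'd. n \<le> vec.dim (path_space (\<lambda>s. transpose (x s)) l)}"
proof -
  have "{path_matrix (\<lambda>s. transpose (x s)) p *v v | p v. length p = l} =
      (\<lambda>(p, v). transpose (path_matrix x (rev p)) *v v) ` {(p, v). length p = l}" for x :: "'r \<Rightarrow> 'k ^ 'd ^ 'd"
    by (auto simp: path_matrix_transpose)
  moreover have "(\<lambda>x :: 'r \<Rightarrow> 'k ^ 'd ^ 'd. (transpose (path_matrix x p) *v v) $ i) \<in> polynomial_funs" for p v i
    unfolding matrix_vector_mult_def transpose_def vec_lambda_beta
    by (intro polynomial_funs_sum polynomial_funs.mult polynomial_funs_path_matrix polynomial_funs.const)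
  ultimately show ?thesis
    using openin_zariski_dim_ge[of "{(p, v). length p = l}"
        "\<lambda>(p, v) (x :: 'r \<Rightarrow> 'k ^ 'd ^ 'd). transpose (path_matrix x (rev p)) *v v" n]
    by (simp add: path_space_def case_prod_beta' del: transpose_matrix_vector)
qed

text \<open>The open set cut out by lower bounds on the ranks of the radical powers of both the module
  and its dual lies in the layer, because these ranks also bound each other from above.\<close>

lemma ex_open_subset_rep_layer:
  fixes h :: "'d::finite \<Rightarrow> nat"
  assumes h: "\<And>l. l \<le> L \<Longrightarrow> card {j. h j = l} = S l" "\<And>j. h j \<le> L" and L: "1 \<le> L"
    and S: "\<forall>l\<in>{1..L}. S l \<le> CARD('r::finite) * S (l - 1)" "\<forall>l\<in>{1..L}. S (l - 1) \<le> CARD('r) * S l"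
  shows "\<exists>W. openin (rep_topology L) W \<and> W \<noteq> {} \<and> W \<subseteq> (rep_layer L S :: ('r \<Rightarrow> 'k::field ^ 'd ^ 'd) set)"
proof -
  let ?n = "\<lambda>l. sum S {l..L}"
  \<comment> \<open>The exponent \<open>L + 1 - l\<close> is the least one whose sum with l exceeds
    L, as orthogonality requires. For l = 0 no condition on the dual is imposed, since
    \<open>J^0 M\<close> is the whole space anyway.\<close>
  define V where "V = {x :: 'r \<Rightarrow> 'k ^ 'd ^ 'd. (\<forall>l\<le>L. ?n l \<le> vec.dim (path_space x l)) \<and>
    (\<forall>l\<in>{1..L}. CARD('d) - ?n l \<le> vec.dim (path_space (\<lambda>s. transpose (x s)) (L + 1 - l)))}"
  have d: "?n 0 = CARD('d)" using card_level_ge[OF h, of 0] by simp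
  have "V = {x. \<forall>l\<le>L. ?n l \<le> vec.dim (path_space x l)} \<inter>
      (\<Inter>l\<in>{1..L}. {x. CARD('d) - ?n l \<le> vec.dim (path_space (\<lambda>s. transpose (x s)) (L + 1 - l))})"
    by (auto simp: V_def)
  then have "openin zariski V"
    using L by (auto intro!: openin_Int openin_INT2 openin_zariski_dim_path_spaces_ge
        openin_zariski_dim_path_space_transpose_ge)
  then have "openin (rep_topology L) (V \<inter> rep_variety L)"
    unfolding rep_topology_def by (auto simp: openin_subtopology)
  moreover have "x \<in> rep_layer L S" if x: "x \<in> V" "x \<in> rep_variety L" for x
  proof -
    have "vec.dim (path_space x l) = ?n l" for l
    proof -
      consider "l = 0" | "l \<in> {1..L}" | "L < l" by fastforce
      then show ?thesis
      proof cases
        case 1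
        then show ?thesis by (simp add: path_space_0 d vec_dim_card del: vec.dim_UNIV)
      next
        case 2
        have "vec.dim (path_space x l) + vec.dim (path_space (\<lambda>s. transpose (x s)) (L + 1 - l)) \<le> CARD('d)"
          using 2 by (intro dim_orthogonal_le orthogonal_path_space_transpose[OF x(2), of l "L + 1 - l"]) auto
        moreover have "?n l \<le> vec.dim (path_space x l)"
          "CARD('d) - ?n l \<le> vec.dim (path_space (\<lambda>s. transpose (x s)) (L + 1 - l))"
          using x(1) 2 by (simp_all add: V_def)
        ultimately show ?thesis by linarith
      qed (simp add: path_space_eq_0[OF x(2)])
    qed
    then show ?thesis using x(2) by (simp add: rep_layer_iff[OF L])
  qed
  moreover have "\<exists>x. x \<in> V \<and> x \<in> rep_variety L"
  proof -
    \<comment> \<open>Edges are chosen independently between any two consecutive levels; the union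
      over m keeps the injectivity because the level of one end determines m.\<close>
    have "\<exists>E :: 'r \<Rightarrow> ('d \<times> 'd) set. m < L \<longrightarrow>
      (\<forall>s. E s \<subseteq> {j. h j = m} \<times> {j. h j = Suc m} \<and> single_valued (E s) \<and> single_valued ((E s)\<inverse>)) \<and>
      (\<forall>a. h a = m \<longrightarrow> (\<exists>s b. (a, b) \<in> E s)) \<and> (\<forall>b. h b = Suc m \<longrightarrow> (\<exists>s a. (a, b) \<in> E s))" for m
    proof (cases "m < L")
      case True
      then have "card {j. h j = m} = S m" "card {j. h j = Suc m} = S (Suc m)"
        "S (Suc m) \<le> CARD('r) * S m" "S m \<le> CARD('r) * S (Suc m)"
        using h(1) S[THEN bspec[of _ _ "Suc m"]] by auto
      then show ?thesis
        using ex_partial_permutations[of "{j. h j = m}" "{j. h j = Suc m}", where 'r = 'r] by simp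
    qed simp
    then have "\<forall>m. \<exists>E :: 'r \<Rightarrow> ('d \<times> 'd) set. m < L \<longrightarrow>
      (\<forall>s. E s \<subseteq> {j. h j = m} \<times> {j. h j = Suc m} \<and> single_valued (E s) \<and> single_valued ((E s)\<inverse>)) \<and>
      (\<forall>a. h a = m \<longrightarrow> (\<exists>s b. (a, b) \<in> E s)) \<and> (\<forall>b. h b = Suc m \<longrightarrow> (\<exists>s a. (a, b) \<in> E s))" by blast
    from choice[OF this] obtain F :: "nat \<Rightarrow> 'r \<Rightarrow> ('d \<times> 'd) set" where F0: "\<forall>m. m < L \<longrightarrow>
      (\<forall>s. F m s \<subseteq> {j. h j = m} \<times> {j. h j = Suc m} \<and> single_valued (F m s) \<and> single_valued ((F m s)\<inverse>)) \<and>
      (\<forall>a. h a = m \<longrightarrow> (\<exists>s b. (a, b) \<in> F m s)) \<and> (\<forall>b. h b = Suc m \<longrightarrow> (\<exists>s a. (a, b) \<in> F m s))" by (elim exE)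
    have F: "F m s \<subseteq> {j. h j = m} \<times> {j. h j = Suc m}" "single_valued (F m s)" "single_valued ((F m s)\<inverse>)"
      "h a = m \<Longrightarrow> \<exists>s b. (a, b) \<in> F m s" "h b = Suc m \<Longrightarrow> \<exists>s a. (a, b) \<in> F m s" if "m < L" for m s a b
      using F0[rule_format, OF that] by blast+
    define E where "E s = (\<Union>m\<in>{..<L}. F m s)" for s
    have E: "(j, i) \<in> E s \<longleftrightarrow> h j < L \<and> (j, i) \<in> F (h j) s" for i j s
      using F(1) by (fastforce simp: E_def)
    have Eh: "h i = Suc (h j)" if "(j, i) \<in> E s" for i j s
      using that F(1)[of "h j" s] unfolding E by blast
    have sv: "single_valued (E s)" for s
      using F(2) unfolding single_valued_def E by blast
    have sv': "single_valued ((E s)\<inverse>)" for s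
      unfolding single_valued_def converse_iff
    proof (intro allI impI)
      fix i j j' assume a: "(j, i) \<in> E s" "(j', i) \<in> E s"
      have "h j = h j'" using Eh[OF a(1)] Eh[OF a(2)] by simp
      then show "j = j'" using a F(3)[of "h j" s] unfolding E single_valued_def by auto
    qed
    let ?x = "partial_permutation_rep E :: 'r \<Rightarrow> 'k ^ 'd ^ 'd"
    have "?x s *v axis j 1 \<in> vec.span ((\<lambda>i. axis i 1) ` {i. h j < h i})" for s j
    proof (cases "\<exists>i. (j, i) \<in> E s")
      case True
      then obtain i where i: "(j, i) \<in> E s" by blast
      have "?x s *v axis j 1 = axis i 1" by (rule partial_permutation_rep_axis[of E s j i, OF sv i])
      then show ?thesis using Eh[OF i] by (simp add: vec.span_base)
    next
      case False
      then show ?thesis using partial_permutation_rep_axis_0[of j E s, where 'k = 'k] by (simp add: vec.span_zero)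
    qed
    then have "adapted_basis h ?x (\<lambda>i. axis i 1)"
      by (simp add: adapted_basis_def det_of_columns_axis)
    then have "?x \<in> rep_variety L" by (rule adapted_basis_rep_variety[OF _ h(2)])
    moreover have "?n l \<le> vec.dim (path_space ?x l)" for l
    proof -
      have "\<exists>s j. (j, i) \<in> E s \<and> h i = Suc (h j)" if pos: "0 < h i" for i
      proof -
        obtain m where m: "h i = Suc m" "m < L" using pos h(2)[of i] by (cases "h i") auto
        then obtain s j where j: "(j, i) \<in> F m s" using F(5) by blast
        then have "(j, i) \<in> E s" using m by (auto simp: E_def)
        then show ?thesis using Eh by blast
      qed
      from dim_partial_permutation_rep[of E h, OF sv this, of l] show ?thesis
        by (simp add: card_level_ge[OF h])
    qed
    moreover have "CARD('d) - ?n l \<le> vec.dim (path_space (\<lambda>s. transpose (?x s)) (L + 1 - l))" if "l \<in> {1..L}" for l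
    proof -
      \<comment> \<open>In the dual the grading is turned upside down, and predecessors there are
        the successors for \<open>E\<close>.\<close>
      have "\<exists>s j. (j, i) \<in> (E s)\<inverse> \<and> L - h i = Suc (L - h j)" if "0 < L - h i" for i
      proof -
        obtain s j where "(i, j) \<in> F (h i) s" using F(4)[of "h i" i] \<open>0 < L - h i\<close> by auto
        then have "(i, j) \<in> E s" using \<open>0 < L - h i\<close> by (simp add: E)
        moreover from Eh[OF this] have "L - h i = Suc (L - h j)" using h(2)[of j] by simp
        ultimately show ?thesis by blast
      qed
      from dim_partial_permutation_rep[of "\<lambda>s. (E s)\<inverse>" "\<lambda>i. L - h i", OF sv' this, of "L + 1 - l"]
      have "card {i. L + 1 - l \<le> L - h i} \<le> vec.dim (path_space (\<lambda>s. transpose (?x s)) (L + 1 - l))"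
        unfolding transpose_partial_permutation_rep by simp
      moreover have "{i. L + 1 - l \<le> L - h i} = - {i. l \<le> h i}" using that h(2) by fastforce
      ultimately show ?thesis by (simp add: Compl_eq_Diff_UNIV card_Diff_subset card_level_ge[OF h])
    qed
    ultimately show ?thesis by (intro exI[of _ ?x]) (simp add: V_def)
  qed
  ultimately show ?thesis by (intro exI[of _ "V \<inter> rep_variety L"]) blast
qed

section \<open>Skeleta\<close>

lemma skeletonD:
  assumes "skeleton L S \<sigma>"
  shows "(p, i) \<in> \<sigma> \<Longrightarrow> length p \<le> L" "(p, i) \<in> \<sigma> \<Longrightarrow> i < S 0"
    "(p @ q, i) \<in> \<sigma> \<Longrightarrow> (q, i) \<in> \<sigma>" "l \<le> L \<Longrightarrow> card {(p, i) \<in> \<sigma>. length p = l} = S l"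
proof -
  show "(p, i) \<in> \<sigma> \<Longrightarrow> length p \<le> L" "(p, i) \<in> \<sigma> \<Longrightarrow> i < S 0"
    using assms by (auto simp: skeleton_def paths_in_def)
  show "(p @ q, i) \<in> \<sigma> \<Longrightarrow> (q, i) \<in> \<sigma>"
    using assms unfolding skeleton_def by (blast intro: suffixI)
  show "l \<le> L \<Longrightarrow> card {(p, i) \<in> \<sigma>. length p = l} = S l"
    using assms unfolding skeleton_def by blast
qed

lemma finite_paths_in: "finite (paths_in L t :: ('r::finite list \<times> nat) set)"
proof (rule finite_subset)
  show "paths_in L t \<subseteq> {p :: 'r list. length p \<le> L} \<times> {..<t}" by (auto simp: paths_in_def)
  show "finite ({p :: 'r list. length p \<le> L} \<times> {..<t})" by (simp add: finite_short_paths)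
qed

lemma finite_skeleton: "skeleton L S (\<sigma> :: ('r::finite list \<times> nat) set) \<Longrightarrow> finite \<sigma>"
  using finite_subset[OF _ finite_paths_in] by (auto simp: skeleton_def)

text \<open>There are only \<open>S 0\<close> paths of length 0, and a skeleton must contain that
  many.\<close>

lemma skeleton_Nil:
  assumes "skeleton L S (\<sigma> :: ('r::finite list \<times> nat) set)" "i < S 0"
  shows "([], i) \<in> \<sigma>"
proof -
  have "{(p, i) \<in> \<sigma>. length p = 0} = {[]} \<times> {..<S 0}"
  proof (rule card_subset_eq)
    show "{(p, i) \<in> \<sigma>. length p = 0} \<subseteq> {[]} \<times> {..<S 0}"
      using skeletonD(2)[OF assms(1)] by auto
    show "card {(p, i) \<in> \<sigma>. length p = 0} = card ({[] :: 'r list} \<times> {..<S 0})"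
      using skeletonD(4)[OF assms(1), of 0] by (simp add: card_cartesian_product)
  qed simp
  then have "([], i) \<in> {(p, i) \<in> \<sigma>. length p = 0}" using assms(2) by simp
  then show ?thesis by simp
qed

lemma card_skeleton:
  assumes "skeleton L S (\<sigma> :: ('r::finite list \<times> nat) set)"
  shows "card \<sigma> = sum S {..L}"
proof -
  have "\<sigma> = (\<Union>l\<in>{..L}. {(p, i) \<in> \<sigma>. length p = l})" using skeletonD(1)[OF assms] by fastforce
  then have "card \<sigma> = card (\<Union>l\<in>{..L}. {(p, i) \<in> \<sigma>. length p = l})" by (rule arg_cong)
  also have "\<dots> = (\<Sum>l\<in>{..L}. card {(p, i) \<in> \<sigma>. length p = l})"
  proof (rule card_UN_disjoint)
    show "\<forall>l\<in>{..L}. finite {(p, i) \<in> \<sigma>. length p = l}"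
      using finite_skeleton[OF assms] by (auto intro: finite_subset[of _ \<sigma>])
  qed auto
  also have "\<dots> = sum S {..L}" using skeletonD(4)[OF assms] by simp
  finally show ?thesis .
qed

lemma critical_cases:
  assumes "skeleton L S (\<sigma> :: ('r::finite list \<times> nat) set)" "(u, i) \<in> critical L (S 0) \<sigma>"
  obtains s q where "u = s # q" "(q, i) \<in> \<sigma>" "length u \<le> L" "i < S 0" "(u, i) \<notin> \<sigma>"
proof -
  have u: "(u, i) \<notin> \<sigma>" "\<And>q. strict_suffix q u \<Longrightarrow> (q, i) \<in> \<sigma>" "i < S 0" "length u \<le> L"
    using assms(2) by (auto simp: critical_def paths_in_def)
  then have "u \<noteq> []" using skeleton_Nil[OF assms(1)] by metis
  then obtain s q where sq: "u = s # q" by (cases u) auto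
  moreover have "(q, i) \<in> \<sigma>" using u(2)[of q] sq by (auto simp: strict_suffix_def suffix_def)
  ultimately show ?thesis using that u by blast
qed

text \<open>A proper initial subpath of \<open>s # q\<close> is an initial subpath of q. So leaving
  the skeleton by a single arrow always yields a critical path, unless the length exceeds L.\<close>

lemma critical_Cons:
  assumes sk: "skeleton L S \<sigma>" and q: "(q, i) \<in> \<sigma>" "(s # q, i) \<notin> \<sigma>" "length q < L"
  shows "(s # q, i) \<in> critical L (S 0) \<sigma>"
proof -
  have "(q', i) \<in> \<sigma>" if q': "strict_suffix q' (s # q)" for q'
  proof -
    have "suffix q' q" using q' by (auto simp: strict_suffix_def suffix_Cons)
    then show ?thesis using skeletonD(3)[OF sk] q(1) by (auto simp: suffix_def)
  qed
  then show ?thesis using q skeletonD(2)[OF sk q(1)] by (auto simp: critical_def paths_in_def)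
qed

section \<open>Points of a layer with a basis indexed by the skeleton\<close>

lemma of_columns_axis:
  fixes b :: "'d::finite \<Rightarrow> 'k::field ^ 'd"
  shows "of_columns b *v axis j 1 = b j"
  by (simp add: vec_eq_iff matrix_vector_mult_def of_columns_nth axis_def if_distrib[of "\<lambda>y. _ * y"] cong: if_cong)

text \<open>Indexing by the coordinate type through e makes the family the columns of a square
  matrix, so that being a basis means a nonzero determinant.\<close>

definition skeleton_family ::
    "('d \<Rightarrow> 'r list \<times> nat) \<Rightarrow> ('r \<Rightarrow> 'k::field ^ 'd ^ 'd) \<Rightarrow> (nat \<Rightarrow> 'k ^ 'd::finite) \<Rightarrow> 'd \<Rightarrow> 'k ^ 'd" where
  "skeleton_family e x z j = path_matrix x (fst (e j)) *v z (snd (e j))"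

definition skeleton_relations ::
    "nat \<Rightarrow> nat \<Rightarrow> ('r list \<times> nat) set \<Rightarrow> (('r list \<times> nat) \<times> ('r list \<times> nat) \<Rightarrow> 'k::field) \<Rightarrow>
     ('r \<Rightarrow> 'k ^ 'd ^ 'd) \<Rightarrow> (nat \<Rightarrow> 'k ^ 'd::finite) \<Rightarrow> bool" where
  "skeleton_relations L t \<sigma> c x z \<longleftrightarrow> (\<forall>y\<in>critical L t \<sigma>.
     path_matrix x (fst y) *v z (snd y) =
       (\<Sum>w\<in>sigma_above \<sigma> y. c (y, w) *s (path_matrix x (fst w) *v z (snd w))))"

text \<open>Such an e exists because \<sigma> has d elements. Path length, transported along e, is
  the grading that the results on adapted bases ask for.\<close>

locale skeleton_enumeration =
  fixes L :: nat and S :: "nat \<Rightarrow> nat" and \<sigma> :: "('r::finite list \<times> nat) set"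
    and e :: "'d::finite \<Rightarrow> 'r list \<times> nat"
  assumes skel: "skeleton L S \<sigma>" and e: "bij_betw e UNIV \<sigma>" and L1: "1 \<le> L"
begin

definition level :: "'d \<Rightarrow> nat" where "level j = length (fst (e j))"

lemma e_in: "e j \<in> \<sigma>" and inj_e: "inj e"
  using e by (auto simp: bij_betw_def)

lemma e_inverse: "w \<in> \<sigma> \<Longrightarrow> e (inv_into UNIV e w) = w"
  using e by (intro f_inv_into_f) (auto simp: bij_betw_def)

lemma level_le: "level j \<le> L"
  using skeletonD(1)[OF skel, of "fst (e j)" "snd (e j)"] e_in[of j] by (simp add: level_def)

lemma card_level: "l \<le> L \<Longrightarrow> card {j. level j = l} = S l"
proof -
  assume l: "l \<le> L"
  have "e ` {j. level j = l} = {w \<in> \<sigma>. length (fst w) = l}"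
    using e by (auto simp: bij_betw_def level_def)
  also have "\<dots> = {(p, i) \<in> \<sigma>. length p = l}" by auto
  finally have "bij_betw e {j. level j = l} {(p, i) \<in> \<sigma>. length p = l}"
    using inj_e by (auto simp: bij_betw_def intro: inj_on_subset)
  then show ?thesis using skeletonD(4)[OF skel l] by (simp add: bij_betw_same_card)
qed

lemmas card_level_ge' = card_level_ge[of L level S, OF card_level level_le]

lemma skeleton_family_mem_path_space:
  "l \<le> level j \<Longrightarrow> skeleton_family e x z j \<in> path_space x l"
  using path_matrix_mult_mem_path_space[of "fst (e j)" "level j" x] path_space_antimono[of l "level j" x]
  by (auto simp: skeleton_family_def level_def)

text \<open>Skeleton paths of length at least l give independent vectors in \<open>J^l M\<close>,
  and they are as many as its dimension; counting thus turns independence into spanning.\<close>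

lemma path_space_skeleton_family:
  fixes x :: "'r \<Rightarrow> 'k::field ^ 'd ^ 'd"
  assumes x: "x \<in> rep_layer L S" and z: "det (of_columns (skeleton_family e x z)) \<noteq> 0"
  shows "path_space x l \<subseteq> vec.span (skeleton_family e x z ` {j. l \<le> level j})"
proof (rule vec.card_ge_dim_independent)
  let ?b = "skeleton_family e x z"
  have b: "inj ?b" "vec.independent (range ?b)"
    using z unfolding det_of_columns_nonzero_iff_independent by blast+
  show "?b ` {j. l \<le> level j} \<subseteq> path_space x l" using skeleton_family_mem_path_space by blast
  show "vec.independent (?b ` {j. l \<le> level j})" by (rule vec.independent_mono[OF b(2)]) blast
  have "card (?b ` {j. l \<le> level j}) = card {j. l \<le> level j}"
    by (rule card_image) (rule inj_on_subset[OF b(1)], simp)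
  then show "vec.dim (path_space x l) \<le> card (?b ` {j. l \<le> level j})"
    using x unfolding rep_layer_iff[OF L1] by (simp add: card_level_ge')
qed

text \<open>A critical path of length m takes its value in \<open>J^m M\<close>, which the skeleton
  paths of length at least m span. This is why the coefficients need to range over
  \<open>sigma_above \<sigma> y\<close> only.\<close>

lemma ex_skeleton_relations:
  fixes x :: "'r \<Rightarrow> 'k::field ^ 'd ^ 'd"
  assumes x: "x \<in> rep_layer L S" and z: "det (of_columns (skeleton_family e x z)) \<noteq> 0"
  shows "\<exists>c \<in> coord_pairs L (S 0) \<sigma> \<rightarrow>\<^sub>E UNIV. skeleton_relations L (S 0) \<sigma> c x z"
proof -
  let ?b = "skeleton_family e x z"
  let ?m = "\<lambda>w. path_matrix x (fst w) *v z (snd w)"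
  have inj: "inj ?b" using z unfolding det_of_columns_nonzero_iff_independent by blast
  have "\<exists>a. ?m y = (\<Sum>w\<in>sigma_above \<sigma> y. a w *s ?m w)" for y
  proof -
    let ?J = "{j. length (fst y) \<le> level j}"
    have "?m y \<in> path_space x (length (fst y))" by (rule path_matrix_mult_mem_path_space) simp
    then have "?m y \<in> vec.span (?b ` ?J)" using path_space_skeleton_family[OF x z] by blast
    then obtain u where "?m y = (\<Sum>v\<in>?b ` ?J. u v *s v)" by (auto simp: vec.span_finite)
    also have "\<dots> = (\<Sum>j\<in>?J. u (?b j) *s ?b j)"
      by (rule sum.reindex_cong[OF _ refl]) (use inj in \<open>auto intro: inj_on_subset\<close>)
    also have "\<dots> = (\<Sum>j\<in>?J. u (?m (e j)) *s ?m (e j))" by (simp add: skeleton_family_def)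
    also have "\<dots> = (\<Sum>w\<in>sigma_above \<sigma> y. u (?m w) *s ?m w)"
    proof (rule sum.reindex_bij_betw)
      have "e ` ?J = sigma_above \<sigma> y"
        using e by (auto simp: bij_betw_def sigma_above_def level_def)
      then show "bij_betw e ?J (sigma_above \<sigma> y)"
        using inj_e by (auto simp: bij_betw_def intro: inj_on_subset)
    qed
    finally show ?thesis by (rule exI[of _ "\<lambda>w. u (?m w)"])
  qed
  then have "\<exists>a. \<forall>y. ?m y = (\<Sum>w\<in>sigma_above \<sigma> y. a y w *s ?m w)" by (intro choice allI)
  then obtain a where a: "\<forall>y. ?m y = (\<Sum>w\<in>sigma_above \<sigma> y. a y w *s ?m w)" ..
  \<comment> \<open>Restriction picks the one representative that counts as a point of the affine
    space of coefficients.\<close>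
  have "skeleton_relations L (S 0) \<sigma> (restrict (\<lambda>(y, w). a y w) (coord_pairs L (S 0) \<sigma>)) x z"
    unfolding skeleton_relations_def
  proof
    fix y assume "y \<in> critical L (S 0) \<sigma>"
    then have "(\<Sum>w\<in>sigma_above \<sigma> y. restrict (\<lambda>(y, w). a y w) (coord_pairs L (S 0) \<sigma>) (y, w) *s ?m w) =
        (\<Sum>w\<in>sigma_above \<sigma> y. a y w *s ?m w)"
      by (intro sum.cong) (auto simp: coord_pairs_def)
    then show "?m y = (\<Sum>w\<in>sigma_above \<sigma> y. restrict (\<lambda>(y, w). a y w) (coord_pairs L (S 0) \<sigma>) (y, w) *s ?m w)"
      using spec[OF a, of y] by simp
  qed
  then show ?thesis by (intro bexI) auto
qed

lemma openin_zariski_skeleton_family: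
  "openin zariski {x :: 'r \<Rightarrow> 'k::field ^ 'd ^ 'd. det (of_columns (skeleton_family e x z)) \<noteq> 0}"
  by (intro openin_zariski_nonvanishing polynomial_funs_det)
     (simp add: of_columns_nth skeleton_family_def polynomial_funs_path_matrix_mult)

text \<open>The matrices describe \<open>P/U(c)\<close> in the basis given by \<sigma>: an arrow
  prolongs a skeleton path as long as this stays in \<sigma>, and otherwise acts by the critical
  relation. No compatibility of rewriting rules has to be checked, since any tuple of matrices is a
  module over the free algebra and the truncation follows from the grading.\<close>

lemma ex_rep_layer_with_relations:
  fixes c :: "('r list \<times> nat) \<times> ('r list \<times> nat) \<Rightarrow> 'k::field"
  shows "\<exists>(x :: 'r \<Rightarrow> 'k ^ 'd ^ 'd)\<in>rep_layer L S. \<exists>z.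
    det (of_columns (skeleton_family e x z)) \<noteq> 0 \<and> skeleton_relations L (S 0) \<sigma> c x z"
proof -
  define \<epsilon> :: "'r list \<times> nat \<Rightarrow> 'k ^ 'd" where "\<epsilon> w = axis (inv_into UNIV e w) 1" for w
  \<comment> \<open>The default 0 covers exactly the prolongations of length L + 1; a shorter one
    outside \<sigma> is critical.\<close>
  define col where "col s j = (let y = (s # fst (e j), snd (e j)) in
    if y \<in> \<sigma> then \<epsilon> y else if y \<in> critical L (S 0) \<sigma> then \<Sum>w\<in>sigma_above \<sigma> y. c (y, w) *s \<epsilon> w else 0)" for s j
  define x :: "'r \<Rightarrow> 'k ^ 'd ^ 'd" where "x s = of_columns (col s)" for s
  define z where "z i = \<epsilon> ([], i)" for i
  have \<epsilon>_e: "\<epsilon> (e j) = axis j 1" for j by (simp add: \<epsilon>_def inj_e)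
  have x_axis: "x s *v axis j 1 = col s j" for s j
    by (simp add: x_def of_columns_axis)
  have x_\<epsilon>: "x s *v \<epsilon> (q, i) = (let y = (s # q, i) in
      if y \<in> \<sigma> then \<epsilon> y else if y \<in> critical L (S 0) \<sigma> then \<Sum>w\<in>sigma_above \<sigma> y. c (y, w) *s \<epsilon> w else 0)"
    if "(q, i) \<in> \<sigma>" for s q i
    using x_axis[of s "inv_into UNIV e (q, i)"] e_inverse[OF that] by (simp add: \<epsilon>_def[of "(q, i)"] col_def)
  have path: "path_matrix x p *v z i = \<epsilon> (p, i)" if "(p, i) \<in> \<sigma>" for p i
    using that
  proof (induction p)
    case Nil
    then show ?case by (simp add: z_def)
  next
    case (Cons s p)
    then have "(p, i) \<in> \<sigma>" using skeletonD(3)[OF skel, of "[s]" p i] by simp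
    then show ?case using Cons x_\<epsilon>[of p i s] by (simp add: path_matrix_Cons matrix_vector_mul_assoc[symmetric])
  qed
  have fam: "skeleton_family e x z = (\<lambda>j. axis j 1)"
  proof
    fix j show "skeleton_family e x z j = axis j 1"
      using path[of "fst (e j)" "snd (e j)"] e_in[of j] \<epsilon>_e[of j] by (simp add: skeleton_family_def)
  qed
  have mem: "\<epsilon> w \<in> vec.span ((\<lambda>i. axis i 1) ` {i. l \<le> level i})" if "w \<in> \<sigma>" "l \<le> length (fst w)" for w l
    unfolding \<epsilon>_def using that e_inverse[OF that(1)] by (intro vec.span_base imageI) (simp add: level_def)
  \<comment> \<open>Both the prolonged path and the paths in \<open>sigma_above\<close> are longer
    than the path with index j, so every arrow raises the level.\<close>
  have "x s *v axis j 1 \<in> vec.span ((\<lambda>i. axis i 1) ` {i. level j < level i})" for s j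
  proof -
    let ?y = "(s # fst (e j), snd (e j))"
    have "\<epsilon> w \<in> vec.span ((\<lambda>i. axis i 1) ` {i. Suc (level j) \<le> level i})" if "w \<in> sigma_above \<sigma> ?y" for w
      using that by (intro mem) (auto simp: sigma_above_def level_def)
    moreover have "\<epsilon> ?y \<in> vec.span ((\<lambda>i. axis i 1) ` {i. Suc (level j) \<le> level i})" if "?y \<in> \<sigma>"
      using that by (intro mem) (auto simp: level_def)
    ultimately show ?thesis
      unfolding x_axis col_def Let_def Suc_le_eq
      by (auto intro!: vec.span_sum vec.span_scale vec.span_zero)
  qed
  then have adapted: "adapted_basis level x (\<lambda>i. axis i 1)"
    by (simp add: adapted_basis_def det_of_columns_axis)
  have xv: "x \<in> rep_variety L" by (rule adapted_basis_rep_variety[OF adapted level_le])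
  have det: "det (of_columns (skeleton_family e x z)) \<noteq> 0" by (simp add: fam det_of_columns_axis)
  have "vec.dim (path_space x l) = sum S {l..L}" for l
  proof (rule antisym)
    show "vec.dim (path_space x l) \<le> sum S {l..L}"
      using dim_path_space_adapted_basis[OF adapted, of l] by (simp add: card_level_ge')
    let ?b = "skeleton_family e x z"
    have b: "inj ?b" "vec.independent (range ?b)"
      using det unfolding det_of_columns_nonzero_iff_independent by blast+
    have "card (?b ` {j. l \<le> level j}) \<le> vec.dim (path_space x l)"
      using skeleton_family_mem_path_space
      by (intro vec.independent_card_le_dim vec.independent_mono[OF b(2)]) auto
    moreover have "card (?b ` {j. l \<le> level j}) = card {j. l \<le> level j}"
      by (rule card_image) (rule inj_on_subset[OF b(1)], simp)
    ultimately show "sum S {l..L} \<le> vec.dim (path_space x l)" by (simp add: card_level_ge')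
  qed
  then have "x \<in> rep_layer L S" using xv by (simp add: rep_layer_iff[OF L1])
  moreover have "skeleton_relations L (S 0) \<sigma> c x z"
    unfolding skeleton_relations_def
  proof
    fix y assume y: "y \<in> critical L (S 0) \<sigma>"
    obtain u i where ui: "y = (u, i)" by fastforce
    obtain s q where sq: "u = s # q" "(q, i) \<in> \<sigma>" "(u, i) \<notin> \<sigma>"
      using critical_cases[OF skel] y ui by metis
    have "path_matrix x (fst y) *v z (snd y) = (\<Sum>w\<in>sigma_above \<sigma> y. c (y, w) *s \<epsilon> w)"
      using x_\<epsilon>[OF sq(2), of s] path[OF sq(2)] sq y ui
      by (simp add: path_matrix_Cons matrix_vector_mul_assoc[symmetric] Let_def)
    also have "\<dots> = (\<Sum>w\<in>sigma_above \<sigma> y. c (y, w) *s (path_matrix x (fst w) *v z (snd w)))"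
      by (intro sum.cong refl) (auto simp: sigma_above_def path)
    finally show "path_matrix x (fst y) *v z (snd y) =
      (\<Sum>w\<in>sigma_above \<sigma> y. c (y, w) *s (path_matrix x (fst w) *v z (snd w)))" .
  qed
  ultimately show ?thesis using det by blast
qed

end

section \<open>Presentations by critical relations\<close>

subsection \<open>Quotients by kernels\<close>

text \<open>The first isomorphism theorem, with the isomorphism going from N to the quotient: it
  takes n to its fibre under \<Phi>, which is a coset of U, so no representatives have to be
  chosen.\<close>

lemma module_iso_quotient_kernel:
  assumes P: "left_module R P" and N: "left_module R N"
    and hom: "\<And>v. v \<in> carrier P \<Longrightarrow> \<Phi> v \<in> carrier N"
      "\<And>v w. v \<in> carrier P \<Longrightarrow> w \<in> carrier P \<Longrightarrow> \<Phi> (v \<oplus>\<^bsub>P\<^esub> w) = \<Phi> v \<oplus>\<^bsub>N\<^esub> \<Phi> w"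
      "\<And>a v. a \<in> carrier R \<Longrightarrow> v \<in> carrier P \<Longrightarrow> \<Phi> (a \<odot>\<^bsub>P\<^esub> v) = a \<odot>\<^bsub>N\<^esub> \<Phi> v"
    and surj: "\<And>n. n \<in> carrier N \<Longrightarrow> \<exists>v\<in>carrier P. \<Phi> v = n"
    and U: "U = {v \<in> carrier P. \<Phi> v = \<zero>\<^bsub>N\<^esub>}"
  shows "module_iso R N (quotient_module P U)"
proof -
  interpret P: left_module R P by fact
  interpret N: left_module R N by fact
  define f where "f n = {v \<in> carrier P. \<Phi> v = n}" for n
  have minus: "\<Phi> (w \<ominus>\<^bsub>P\<^esub> v) = \<zero>\<^bsub>N\<^esub>" if vw: "v \<in> carrier P" "w \<in> carrier P" "\<Phi> w = \<Phi> v" for v w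
  proof -
    have "(w \<ominus>\<^bsub>P\<^esub> v) \<oplus>\<^bsub>P\<^esub> v = w"
      using vw by (simp add: P.M.minus_eq P.M.a_assoc P.M.l_neg)
    then have "\<Phi> (w \<ominus>\<^bsub>P\<^esub> v) \<oplus>\<^bsub>N\<^esub> \<Phi> v = \<Phi> v"
      using hom(2)[of "w \<ominus>\<^bsub>P\<^esub> v" v] vw by simp
    then show ?thesis using hom(1) vw by (simp add: N.M.add.r_cancel_one)
  qed
  have coset: "U +>\<^bsub>P\<^esub> v = f (\<Phi> v)" if v: "v \<in> carrier P" for v
  proof
    show "U +>\<^bsub>P\<^esub> v \<subseteq> f (\<Phi> v)"
      using v hom by (auto simp: a_r_coset_def' f_def U)
    show "f (\<Phi> v) \<subseteq> U +>\<^bsub>P\<^esub> v"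
    proof
      fix w assume "w \<in> f (\<Phi> v)"
      then have w: "w \<in> carrier P" "\<Phi> w = \<Phi> v" by (auto simp: f_def)
      have "w = (w \<ominus>\<^bsub>P\<^esub> v) \<oplus>\<^bsub>P\<^esub> v"
        using v w by (simp add: P.M.minus_eq P.M.a_assoc P.M.l_neg)
      moreover have "w \<ominus>\<^bsub>P\<^esub> v \<in> U" using minus[OF v w] v w by (simp add: U)
      ultimately show "w \<in> U +>\<^bsub>P\<^esub> v" by (auto simp: a_r_coset_def')
    qed
  qed
  have carrier: "carrier (quotient_module P U) = f ` carrier N"
  proof -
    have "carrier (quotient_module P U) = (\<lambda>v. f (\<Phi> v)) ` carrier P"
      using coset by (auto simp: quotient_module_def A_RCOSETS_def' )
    also have "\<dots> = f ` carrier N" using surj hom(1) by blast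
    finally show ?thesis .
  qed
  have inj: "inj_on f (carrier N)"
  proof (rule inj_onI)
    fix m n assume m: "m \<in> carrier N" and eq: "f m = f n"
    obtain v where "v \<in> carrier P" "\<Phi> v = m" using surj m by blast
    then have "v \<in> f n" using eq by (auto simp: f_def)
    then show "m = n" using \<open>\<Phi> v = m\<close> by (simp add: f_def)
  qed
  have add: "f (m \<oplus>\<^bsub>N\<^esub> n) = f m <+>\<^bsub>P\<^esub> f n" if mn: "m \<in> carrier N" "n \<in> carrier N" for m n
  proof
    show "f m <+>\<^bsub>P\<^esub> f n \<subseteq> f (m \<oplus>\<^bsub>N\<^esub> n)"
      using hom(2) by (auto simp: set_add_def' f_def)
    show "f (m \<oplus>\<^bsub>N\<^esub> n) \<subseteq> f m <+>\<^bsub>P\<^esub> f n"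
    proof
      fix w assume "w \<in> f (m \<oplus>\<^bsub>N\<^esub> n)"
      then have w: "w \<in> carrier P" "\<Phi> w = m \<oplus>\<^bsub>N\<^esub> n" by (auto simp: f_def)
      obtain v where v: "v \<in> carrier P" "\<Phi> v = n" using surj mn by blast
      have wv: "w = (w \<ominus>\<^bsub>P\<^esub> v) \<oplus>\<^bsub>P\<^esub> v"
        using v w by (simp add: P.M.minus_eq P.M.a_assoc P.M.l_neg)
      have "\<Phi> (w \<ominus>\<^bsub>P\<^esub> v) \<oplus>\<^bsub>N\<^esub> n = m \<oplus>\<^bsub>N\<^esub> n"
        using hom(2)[of "w \<ominus>\<^bsub>P\<^esub> v" v] wv v w by simp
      then have "\<Phi> (w \<ominus>\<^bsub>P\<^esub> v) = m" using mn v w hom(1) by (simp add: N.M.add.right_cancel)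
      then have "w \<ominus>\<^bsub>P\<^esub> v \<in> f m" using v w by (simp add: f_def)
      moreover have "v \<in> f n" using v by (simp add: f_def)
      ultimately show "w \<in> f m <+>\<^bsub>P\<^esub> f n" using wv by (auto simp: set_add_def')
    qed
  qed
  have smult: "f (a \<odot>\<^bsub>N\<^esub> n) = (\<Union>v\<in>f n. U +>\<^bsub>P\<^esub> (a \<odot>\<^bsub>P\<^esub> v))"
    if a: "a \<in> carrier R" and n: "n \<in> carrier N" for a n
  proof -
    have "U +>\<^bsub>P\<^esub> (a \<odot>\<^bsub>P\<^esub> v) = f (a \<odot>\<^bsub>N\<^esub> n)" if "v \<in> f n" for v
      using coset[of "a \<odot>\<^bsub>P\<^esub> v"] that a hom(3) P.smult_closed by (simp add: f_def)
    moreover have "f n \<noteq> {}" using surj[OF n] by (auto simp: f_def)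
    ultimately show ?thesis by auto
  qed
  have "f \<in> iso (add_monoid N) (add_monoid (quotient_module P U))"
  proof (rule isoI)
    show "f \<in> hom (add_monoid N) (add_monoid (quotient_module P U))"
      using add carrier by (auto simp: hom_def quotient_module_def)
    show "bij_betw f (carrier (add_monoid N)) (carrier (add_monoid (quotient_module P U)))"
      using inj carrier by (simp add: bij_betw_def)
  qed
  moreover have "f (a \<odot>\<^bsub>N\<^esub> n) = a \<odot>\<^bsub>quotient_module P U\<^esub> f n" if "a \<in> carrier R" "n \<in> carrier N" for a n
    using smult[OF that] by (simp add: quotient_module_def)
  ultimately show ?thesis unfolding module_iso_def by blast
qed

subsection \<open>Coordinates in the free module\<close>

abbreviation free_path_module :: "nat \<Rightarrow> nat \<Rightarrow> ('r list \<Rightarrow> 'k::field, nat \<Rightarrow> 'r list \<Rightarrow> 'k) module" where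
  "free_path_module L t \<equiv> free_module (trunc_path_algebra L) t"

lemma left_module_free_path_module: "left_module (trunc_path_algebra L) (free_path_module L t)"
  by (rule left_module_free_module[OF ring_trunc_path_algebra])

lemma free_path_module_coord [simp]:
  assumes "j < t"
  shows "(v \<oplus>\<^bsub>free_path_module L t\<^esub> w) j p = v j p + w j p"
    "\<zero>\<^bsub>free_path_module L t\<^esub> j p = 0"
    "(a \<odot>\<^bsub>free_path_module L t\<^esub> v) j p = (if length p \<le> L then path_conv a (v j) p else 0)"
  using assms by (simp_all add: free_module_def trunc_path_algebra_def)

lemma free_path_module_carrier_0: "v \<in> carrier (free_path_module L t) \<Longrightarrow> j < t \<Longrightarrow> L < length p \<Longrightarrow> v j p = 0"
  by (auto simp: free_module_def trunc_path_algebra_def PiE_iff)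

lemma free_path_module_eqI:
  assumes "v \<in> carrier (free_path_module L t)" "w \<in> carrier (free_path_module L t)"
    and "\<And>j p. j < t \<Longrightarrow> length p \<le> L \<Longrightarrow> v j p = w j p"
  shows "v = w"
proof (rule extensionalityI)
  show "v \<in> extensional {..<t}" "w \<in> extensional {..<t}"
    using assms(1,2) by (auto simp: free_module_def PiE_def)
  fix j assume "j \<in> {..<t}"
  then show "v j = w j"
    using assms(3)[of j] free_path_module_carrier_0[OF assms(1), of j] free_path_module_carrier_0[OF assms(2), of j]
    by (intro ext) (metis lessThan_iff not_le)
qed

lemma path_conv_scalar: "path_conv (path_vec [] a) f p = a * f p"
proof -
  have "path_conv (path_vec [] a) f p = (\<Sum>k\<le>length p. if k = 0 then a * f p else 0)"
    unfolding path_conv_def path_vec_def by (intro sum.cong) auto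
  then show ?thesis by simp
qed

lemma scalar_coord:
  assumes "v \<in> carrier (free_path_module L t)" "j < t"
  shows "(path_vec [] a \<odot>\<^bsub>free_path_module L t\<^esub> v) j p = a * v j p"
  using assms free_path_module_carrier_0[OF assms] by (simp add: path_conv_scalar)

lemma path_elem_eq:
  assumes "length p \<le> L"
  shows "path_elem L t (p, i) = (\<lambda>j\<in>{..<t}. if j = i then path_vec p (1 :: 'k::field) else (\<lambda>_. 0))"
proof
  fix j
  show "path_elem L t (p, i) j = (\<lambda>j\<in>{..<t}. if j = i then path_vec p (1 :: 'k) else (\<lambda>_. 0)) j"
  proof (cases "j < t")
    case True
    have "path_elem L t (p, i) j q = (if j = i then path_vec p (1 :: 'k) else (\<lambda>_. 0)) q" for q
    proof (cases "length q \<le> L")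
      case False
      then have "q \<noteq> p" using assms by auto
      then show ?thesis using True False by (simp add: path_elem_def path_vec_def)
    next
      case True
      moreover have "free_basis (trunc_path_algebra L :: ('a list \<Rightarrow> 'k) ring) t i j =
          (if j = i then path_vec [] 1 else (\<lambda>_. 0))"
        using \<open>j < t\<close> by (simp add: free_basis_def trunc_path_algebra_def)
      moreover have "path_conv (path_vec p 1) (\<lambda>_. 0 :: 'k) q = 0" by (simp add: path_conv_def)
      ultimately show ?thesis using \<open>j < t\<close> by (simp add: path_elem_def path_conv_one_right)
    qed
    then show ?thesis using True by auto
  qed (simp add: path_elem_def free_module_def)
qed

lemma path_elem_closed:
  assumes "y \<in> paths_in L t"
  shows "path_elem L t y \<in> carrier (free_path_module L t :: (_, nat \<Rightarrow> 'r list \<Rightarrow> 'k::field) module)"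
  using assms path_elem_eq[of "fst y" L t "snd y", where 'k = 'k]
  by (auto simp: paths_in_def free_module_def trunc_path_algebra_def path_vec_def)

lemma path_elem_coord:
  assumes "y \<in> paths_in L t" "j < t"
  shows "path_elem L t y j q = (if y = (q, j) then 1 else (0 :: 'k::field))"
  using assms path_elem_eq[of "fst y" L t "snd y", where 'k = 'k]
  by (cases y) (auto simp: paths_in_def path_vec_def)

lemma path_vec_smult_path_elem:
  assumes "(p, i) \<in> paths_in L t" "length r \<le> L"
  shows "path_vec r (1 :: 'k::field) \<odot>\<^bsub>free_path_module L t\<^esub> path_elem L t (p, i) =
    (if length (r @ p) \<le> L then path_elem L t (r @ p, i) else \<zero>\<^bsub>free_path_module L t\<^esub>)"
proof -
  let ?P = "free_path_module L t :: ('a list \<Rightarrow> 'k, nat \<Rightarrow> 'a list \<Rightarrow> 'k) module"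
  interpret left_module "trunc_path_algebra L :: ('a list \<Rightarrow> 'k) ring" ?P by (rule left_module_free_path_module)
  have conv0: "path_conv f (\<lambda>_. 0) q = 0" for f :: "'a list \<Rightarrow> 'k" and q by (simp add: path_conv_def)
  show ?thesis
  proof (rule free_path_module_eqI)
    show "path_vec r 1 \<odot>\<^bsub>?P\<^esub> path_elem L t (p, i) \<in> carrier ?P"
      by (intro smult_closed path_vec_closed path_elem_closed assms)
    show "(if length (r @ p) \<le> L then path_elem L t (r @ p, i) else \<zero>\<^bsub>?P\<^esub>) \<in> carrier ?P"
      using assms by (auto intro!: path_elem_closed simp: paths_in_def)
    fix j and q :: "'a list" assume j: "j < t" "length q \<le> L"
    have "path_elem L t (p, i) j = (if j = i then path_vec p 1 else (\<lambda>_. 0 :: 'k))"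
      using assms j by (simp add: path_elem_eq paths_in_def)
    moreover have "path_elem L t (r @ p, i) j = (if j = i then path_vec (r @ p) 1 else (\<lambda>_. 0 :: 'k))"
      if "length (r @ p) \<le> L" using that j by (subst path_elem_eq) auto
    ultimately show "(path_vec r 1 \<odot>\<^bsub>?P\<^esub> path_elem L t (p, i)) j q =
        (if length (r @ p) \<le> L then path_elem L t (r @ p, i) else \<zero>\<^bsub>?P\<^esub>) j q"
      using j by (simp add: path_conv_path_vec conv0) (auto simp: path_vec_def)
  qed
qed

lemma finsum_coord:
  assumes "finite F" "\<And>y. y \<in> F \<Longrightarrow> g y \<in> carrier (free_path_module L t)" "j < t"
  shows "(\<Oplus>\<^bsub>free_path_module L t\<^esub>y\<in>F. g y) j p = (\<Sum>y\<in>F. g y j (p :: 'r list) :: 'k::field)"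
proof -
  interpret left_module "trunc_path_algebra L :: ('r list \<Rightarrow> 'k) ring" "free_path_module L t"
    by (rule left_module_free_path_module)
  show ?thesis using assms(1,2)
  proof (induction F rule: finite_induct)
    case empty
    then show ?case using assms(3) by simp
  next
    case (insert y F)
    then have "(\<Oplus>\<^bsub>free_path_module L t\<^esub>y\<in>insert y F. g y) =
        g y \<oplus>\<^bsub>free_path_module L t\<^esub> (\<Oplus>\<^bsub>free_path_module L t\<^esub>y\<in>F. g y)"
      by (intro M.finsum_insert) auto
    then show ?case using insert assms(3) by simp
  qed
qed

lemma minus_coord:
  assumes "v \<in> carrier (free_path_module L t)" "w \<in> carrier (free_path_module L t)" "j < t"
  shows "(v \<ominus>\<^bsub>free_path_module L t\<^esub> w) j p = v j p - (w j (p :: 'r list) :: 'k::field)"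
proof -
  interpret left_module "trunc_path_algebra L :: ('r list \<Rightarrow> 'k) ring" "free_path_module L t"
    by (rule left_module_free_path_module)
  have "(v \<ominus>\<^bsub>free_path_module L t\<^esub> w) \<oplus>\<^bsub>free_path_module L t\<^esub> w = v"
    using assms by (simp add: M.minus_eq M.a_assoc M.l_neg)
  then have "((v \<ominus>\<^bsub>free_path_module L t\<^esub> w) \<oplus>\<^bsub>free_path_module L t\<^esub> w) j p = v j p" by simp
  then show ?thesis using assms(3) by (simp add: eq_diff_eq)
qed

text \<open>Linear combinations of paths over the field, in the same shape in which they occur in
  \<open>critical_relation\<close>.\<close>

definition path_comb ::
    "nat \<Rightarrow> nat \<Rightarrow> ('r list \<times> nat) set \<Rightarrow> ('r list \<times> nat \<Rightarrow> 'k::field) \<Rightarrow> nat \<Rightarrow> 'r list \<Rightarrow> 'k" where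
  "path_comb L t F c = (\<Oplus>\<^bsub>free_path_module L t\<^esub>y\<in>F. path_vec [] (c y) \<odot>\<^bsub>free_path_module L t\<^esub> path_elem L t y)"

lemma scalar_path_elem_closed:
  "y \<in> paths_in L t \<Longrightarrow> path_vec [] a \<odot>\<^bsub>free_path_module L t\<^esub> path_elem L t y \<in>
     carrier (free_path_module L t :: (_, nat \<Rightarrow> 'r list \<Rightarrow> 'k::field) module)"
  by (intro left_module.smult_closed[OF left_module_free_path_module] path_elem_closed path_vec_closed) simp_all

lemma path_comb_closed:
  assumes "F \<subseteq> paths_in L t"
  shows "path_comb L t F c \<in> carrier (free_path_module L t :: (_, nat \<Rightarrow> 'r list \<Rightarrow> 'k::field) module)"
proof -
  interpret left_module "trunc_path_algebra L :: ('r list \<Rightarrow> 'k) ring" "free_path_module L t"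
    by (rule left_module_free_path_module)
  show ?thesis unfolding path_comb_def using assms scalar_path_elem_closed by (intro M.finsum_closed) blast
qed

lemma path_comb_coord:
  fixes F :: "('r::finite list \<times> nat) set" and c :: "'r list \<times> nat \<Rightarrow> 'k::field"
  assumes F: "F \<subseteq> paths_in L t" and j: "j < t"
  shows "path_comb L t F c j p = (if (p, j) \<in> F then c (p, j) else 0)"
proof -
  have fin: "finite F" by (rule finite_subset[OF F finite_paths_in])
  have "path_comb L t F c j p = (\<Sum>y\<in>F. (path_vec [] (c y) \<odot>\<^bsub>free_path_module L t\<^esub> path_elem L t y) j p)"
    unfolding path_comb_def by (intro finsum_coord fin j scalar_path_elem_closed subsetD[OF F])
  also have "\<dots> = (\<Sum>y\<in>F. if y = (p, j) then c (p, j) else 0)"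
  proof (intro sum.cong refl)
    fix y assume y: "y \<in> F"
    have "(path_vec [] (c y) \<odot>\<^bsub>free_path_module L t\<^esub> path_elem L t y) j p = c y * path_elem L t y j p"
      by (rule scalar_coord[OF path_elem_closed[OF subsetD[OF F y]] j])
    then show "(path_vec [] (c y) \<odot>\<^bsub>free_path_module L t\<^esub> path_elem L t y) j p = (if y = (p, j) then c (p, j) else 0)"
      using path_elem_coord[OF subsetD[OF F y] j, of p] by auto
  qed
  finally show ?thesis using fin by simp
qed

lemma path_comb_paths_in:
  fixes v :: "nat \<Rightarrow> 'r::finite list \<Rightarrow> 'k::field"
  assumes "v \<in> carrier (free_path_module L t)"
  shows "v = path_comb L t (paths_in L t) (\<lambda>(p, j). v j p)"
  by (rule free_path_module_eqI[OF assms path_comb_closed]) (auto simp: path_comb_coord paths_in_def)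

text \<open>X need only be a subspace over the field. The lemma is applied to sets for which closure
  under the action of paths is not known beforehand.\<close>

lemma path_comb_mem:
  fixes F :: "('r::finite list \<times> nat) set" and c :: "'r list \<times> nat \<Rightarrow> 'k::field"
  assumes F: "F \<subseteq> paths_in L t" and X: "X \<subseteq> carrier (free_path_module L t)"
    "\<zero>\<^bsub>free_path_module L t\<^esub> \<in> X"
    "\<And>v w. v \<in> X \<Longrightarrow> w \<in> X \<Longrightarrow> v \<oplus>\<^bsub>free_path_module L t\<^esub> w \<in> X"
    "\<And>a v. v \<in> X \<Longrightarrow> path_vec [] a \<odot>\<^bsub>free_path_module L t\<^esub> v \<in> X"
    and c: "\<And>y. y \<in> F \<Longrightarrow> c y \<noteq> 0 \<Longrightarrow> path_elem L t y \<in> X"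
  shows "path_comb L t F c \<in> X"
proof -
  interpret left_module "trunc_path_algebra L :: ('r list \<Rightarrow> 'k) ring" "free_path_module L t"
    by (rule left_module_free_path_module)
  let ?g = "\<lambda>y. path_vec [] (c y) \<odot>\<^bsub>free_path_module L t\<^esub> path_elem L t y"
  have g: "?g y \<in> X" if y: "y \<in> F" for y
  proof (cases "c y = 0")
    case True
    have "path_vec [] 0 = \<zero>\<^bsub>trunc_path_algebra L :: ('r list \<Rightarrow> 'k) ring\<^esub>"
      by (simp add: trunc_path_algebra_def path_vec_def)
    then have "?g y = \<zero>\<^bsub>free_path_module L t\<^esub>"
      using smult_zero_left[OF path_elem_closed[OF subsetD[OF F y]]] True by simp
    then show ?thesis using X(2) by simp
  qed (use X(4) c y in auto)
  have "finite F" by (rule finite_subset[OF F finite_paths_in])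
  then have "(\<Oplus>\<^bsub>free_path_module L t\<^esub>y\<in>F. ?g y) \<in> X" using g
  proof (induction F rule: finite_induct)
    case empty
    then show ?case using X(2) by simp
  next
    case (insert y F)
    have c: "?g y' \<in> X" if "y' \<in> insert y F" for y' using insert.prems that by blast
    then have "?g y' \<in> carrier (free_path_module L t)" if "y' \<in> insert y F" for y'
      using X(1) that by blast
    then show ?case using insert c X(3) by (subst M.finsum_insert) simp_all
  qed
  then show ?thesis unfolding path_comb_def .
qed

subsection \<open>Evaluation of the free module at a family of generators\<close>

definition eval_hom ::
    "nat \<Rightarrow> nat \<Rightarrow> ('r::finite \<Rightarrow> 'k::field ^ 'd ^ 'd) \<Rightarrow> (nat \<Rightarrow> 'k ^ 'd) \<Rightarrow> (nat \<Rightarrow> 'r list \<Rightarrow> 'k) \<Rightarrow> 'k ^ 'd" where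
  "eval_hom L t x z v = (\<Sum>j<t. v j \<odot>\<^bsub>rep_module L x\<^esub> z j)"

lemma eval_hom_eq:
  "eval_hom L t x z v = (\<Sum>(p, j)\<in>paths_in L t. v j p *s (path_matrix x p *v z j))"
proof -
  have "eval_hom L t x z v = (\<Sum>j<t. \<Sum>p | length p \<le> L. v j p *s (path_matrix x p *v z j))"
    by (simp add: eval_hom_def rep_module_def)
  also have "\<dots> = (\<Sum>p | length p \<le> L. \<Sum>j<t. v j p *s (path_matrix x p *v z j))"
    by (rule sum.swap)
  also have "\<dots> = (\<Sum>(p, j)\<in>{p. length p \<le> L} \<times> {..<t}. v j p *s (path_matrix x p *v z j))"
    by (rule sum.cartesian_product)
  also have "\<dots> = (\<Sum>(p, j)\<in>paths_in L t. v j p *s (path_matrix x p *v z j))"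
    by (rule sum.cong) (auto simp: paths_in_def)
  finally show ?thesis .
qed

lemma eval_hom_add:
  "eval_hom L t x z (v \<oplus>\<^bsub>free_path_module L t\<^esub> w) = eval_hom L t x z v + eval_hom L t x z w"
  unfolding eval_hom_eq sum.distrib[symmetric]
  by (intro sum.cong refl) (auto simp: paths_in_def vec.scale_left_distrib)

lemma eval_hom_minus:
  assumes "v \<in> carrier (free_path_module L t)" "w \<in> carrier (free_path_module L t)"
  shows "eval_hom L t x z (v \<ominus>\<^bsub>free_path_module L t\<^esub> w) = eval_hom L t x z v - eval_hom L t x z w"
  unfolding eval_hom_eq sum_subtractf[symmetric]
  by (intro sum.cong refl) (auto simp: paths_in_def vec.scale_left_diff_distrib minus_coord[OF assms])

lemma eval_hom_smult:
  fixes x :: "'r::finite \<Rightarrow> 'k::field ^ 'd::finite ^ 'd"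
  assumes x: "x \<in> rep_variety L" and a: "a \<in> carrier (trunc_path_algebra L)"
    and v: "v \<in> carrier (free_path_module L t)"
  shows "eval_hom L t x z (a \<odot>\<^bsub>free_path_module L t\<^esub> v) = a \<odot>\<^bsub>rep_module L x\<^esub> eval_hom L t x z v"
proof -
  interpret left_module "trunc_path_algebra L :: ('r list \<Rightarrow> 'k) ring" "rep_module L x"
    by (rule left_module_rep_module[OF x])
  have sum: "a \<odot>\<^bsub>rep_module L x\<^esub> (\<Sum>j<t. w j) = (\<Sum>j<t. a \<odot>\<^bsub>rep_module L x\<^esub> w j)" for w :: "nat \<Rightarrow> 'k ^ 'd"
    by (simp add: rep_module_def vec.sum vec.scale_sum_right sum.swap[of _ "{..<t}"])
  have "(a \<odot>\<^bsub>free_path_module L t\<^esub> v) j \<odot>\<^bsub>rep_module L x\<^esub> z j =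
      a \<odot>\<^bsub>rep_module L x\<^esub> (v j \<odot>\<^bsub>rep_module L x\<^esub> z j)" if "j < t" for j
  proof -
    have "(a \<odot>\<^bsub>free_path_module L t\<^esub> v) j = a \<otimes>\<^bsub>trunc_path_algebra L\<^esub> v j"
      using that by (simp add: free_module_def)
    moreover have "v j \<in> carrier (trunc_path_algebra L)" using v that by (auto simp: free_module_def)
    moreover have "z j \<in> carrier (rep_module L x)" by (simp add: rep_module_def)
    ultimately show ?thesis using smult_assoc a by simp
  qed
  then show ?thesis unfolding eval_hom_def sum by (intro sum.cong) auto
qed

lemma eval_hom_path_comb:
  assumes F: "F \<subseteq> paths_in L t"
  shows "eval_hom L t x z (path_comb L t F c) = (\<Sum>y\<in>F. c y *s (path_matrix x (fst y) *v z (snd y)))"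
proof -
  have "eval_hom L t x z (path_comb L t F c) =
      (\<Sum>y\<in>paths_in L t. if y \<in> F then c y *s (path_matrix x (fst y) *v z (snd y)) else 0)"
    unfolding eval_hom_eq
    by (intro sum.cong refl) (auto simp: path_comb_coord[OF F] paths_in_def)
  also have "\<dots> = (\<Sum>y\<in>F. c y *s (path_matrix x (fst y) *v z (snd y)))"
    using F by (intro sum.mono_neutral_cong_right finite_paths_in) auto
  finally show ?thesis .
qed

lemma eval_hom_path_elem:
  fixes x :: "'r::finite \<Rightarrow> 'k::field ^ 'd ^ 'd"
  assumes y: "y \<in> paths_in L t"
  shows "eval_hom L t x z (path_elem L t y) = path_matrix x (fst y) *v z (snd y)"
proof -
  have "eval_hom L t x z (path_elem L t y) =
      (\<Sum>w\<in>paths_in L t. if w = y then path_matrix x (fst y) *v z (snd y) else 0)"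
    unfolding eval_hom_eq
  proof (intro sum.cong refl)
    fix w :: "'r list \<times> nat" assume w: "w \<in> paths_in L t"
    obtain p j where pj: "w = (p, j)" by fastforce
    have "path_elem L t y j p = (if y = (p, j) then 1 else (0 :: 'k))"
      using w pj by (intro path_elem_coord[OF y]) (simp add: paths_in_def)
    then show "(case w of (p, j) \<Rightarrow> path_elem L t y j p *s (path_matrix x p *v z j)) =
        (if w = y then path_matrix x (fst y) *v z (snd y) else 0)"
      using pj by auto
  qed
  then show ?thesis using y by (simp add: finite_paths_in)
qed

subsection \<open>The submodule generated by the critical relations\<close>

lemma critical_relation_eq:
  "critical_relation L t \<sigma> c y =
    path_elem L t y \<ominus>\<^bsub>free_path_module L t\<^esub> path_comb L t (sigma_above \<sigma> y) (\<lambda>w. c (y, w))"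
  by (simp add: critical_relation_def path_comb_def Let_def)

lemma critical_subset: "critical L t \<sigma> \<subseteq> paths_in L t"
  by (auto simp: critical_def)

lemma sigma_above_subset: "skeleton L S \<sigma> \<Longrightarrow> sigma_above \<sigma> y \<subseteq> paths_in L (S 0)"
  by (auto simp: skeleton_def sigma_above_def)

lemma critical_relation_closed:
  fixes \<sigma> :: "('r::finite list \<times> nat) set"
  assumes "skeleton L S \<sigma>" "y \<in> critical L (S 0) \<sigma>"
  shows "critical_relation L (S 0) \<sigma> c y \<in> carrier (free_path_module L (S 0) :: (_, nat \<Rightarrow> 'r list \<Rightarrow> 'k::field) module)"
proof -
  interpret left_module "trunc_path_algebra L :: ('r list \<Rightarrow> 'k) ring" "free_path_module L (S 0)"
    by (rule left_module_free_path_module)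
  show ?thesis unfolding critical_relation_eq
    using assms critical_subset by (intro M.minus_closed path_elem_closed path_comb_closed sigma_above_subset) auto
qed

lemma submodule_relation_submodule:
  fixes \<sigma> :: "('r::finite list \<times> nat) set"
  assumes "skeleton L S \<sigma>"
  shows "submodule (relation_submodule L (S 0) \<sigma> c) (trunc_path_algebra L)
    (free_path_module L (S 0) :: (_, nat \<Rightarrow> 'r list \<Rightarrow> 'k::field) module)"
  unfolding relation_submodule_def
  by (rule left_module.submodule_generated_submodule[OF left_module_free_path_module])
     (rule image_subsetI, rule critical_relation_closed[OF assms])

lemma critical_relation_mem:
  "y \<in> critical L t \<sigma> \<Longrightarrow> critical_relation L t \<sigma> c y \<in> relation_submodule L t \<sigma> c"
  unfolding relation_submodule_def by (rule subsetD[OF generated_submodule_superset]) (rule imageI)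

text \<open>Modulo the critical relations every path reduces to a combination of paths in the skeleton:
  append the arrows of a path one at a time, and rewrite as soon as a critical path arises.\<close>

lemma ex_path_comb_mod_relation_submodule:
  fixes \<sigma> :: "('r::finite list \<times> nat) set" and v :: "nat \<Rightarrow> 'r list \<Rightarrow> 'k::field"
  assumes sk: "skeleton L S \<sigma>" and v: "v \<in> carrier (free_path_module L (S 0))"
  shows "\<exists>a. v \<ominus>\<^bsub>free_path_module L (S 0)\<^esub> path_comb L (S 0) \<sigma> a \<in> relation_submodule L (S 0) \<sigma> c"
proof -
  let ?P = "free_path_module L (S 0) :: (_, nat \<Rightarrow> 'r list \<Rightarrow> 'k) module"
  let ?U = "relation_submodule L (S 0) \<sigma> c"
  interpret left_module "trunc_path_algebra L :: ('r list \<Rightarrow> 'k) ring" ?P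
    by (rule left_module_free_path_module)
  have U: "submodule ?U (trunc_path_algebra L) ?P" by (rule submodule_relation_submodule[OF sk])
  note Uc = submoduleD(1)[OF U]
  have \<sigma>: "\<sigma> \<subseteq> paths_in L (S 0)" using sk by (simp add: skeleton_def)
  note comb = path_comb_closed[OF \<sigma>] and coord = path_comb_coord[OF \<sigma>]
  \<comment> \<open>The elements that reduce to the span of the skeleton modulo U. X is a subspace
    at once; that it absorbs arrows is the content of \<open>reduce\<close>.\<close>
  define X where "X = {v \<in> carrier ?P. \<exists>a. v \<ominus>\<^bsub>?P\<^esub> path_comb L (S 0) \<sigma> a \<in> ?U}"
  have UX: "?U \<subseteq> X"
  proof
    fix u assume u: "u \<in> ?U"
    then have "u \<in> carrier ?P" using Uc by blast
    then have "u \<ominus>\<^bsub>?P\<^esub> path_comb L (S 0) \<sigma> (\<lambda>_. 0) = u"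
      by (intro free_path_module_eqI[where L = L and t = "S 0"] M.minus_closed comb) (auto simp: minus_coord comb coord)
    then show "u \<in> X" using u \<open>u \<in> carrier ?P\<close> unfolding X_def by (intro CollectI conjI exI[of _ "\<lambda>_. 0"]) simp_all
  qed
  have add: "v \<oplus>\<^bsub>?P\<^esub> w \<in> X" if vw: "v \<in> X" "w \<in> X" for v w
  proof -
    obtain a b where ab: "v \<ominus>\<^bsub>?P\<^esub> path_comb L (S 0) \<sigma> a \<in> ?U" "w \<ominus>\<^bsub>?P\<^esub> path_comb L (S 0) \<sigma> b \<in> ?U"
      and c: "v \<in> carrier ?P" "w \<in> carrier ?P" using vw by (auto simp: X_def)
    have "(v \<oplus>\<^bsub>?P\<^esub> w) \<ominus>\<^bsub>?P\<^esub> path_comb L (S 0) \<sigma> (\<lambda>y. a y + b y) =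
        (v \<ominus>\<^bsub>?P\<^esub> path_comb L (S 0) \<sigma> a) \<oplus>\<^bsub>?P\<^esub> (w \<ominus>\<^bsub>?P\<^esub> path_comb L (S 0) \<sigma> b)"
      using c by (intro free_path_module_eqI[where L = L and t = "S 0"] M.minus_closed M.add.m_closed comb) (auto simp: minus_coord comb coord)
    then have "(v \<oplus>\<^bsub>?P\<^esub> w) \<ominus>\<^bsub>?P\<^esub> path_comb L (S 0) \<sigma> (\<lambda>y. a y + b y) \<in> ?U"
      using submoduleD(3)[OF U ab] by simp
    then show ?thesis using c unfolding X_def by (intro CollectI conjI exI) auto
  qed
  have scalar: "path_vec [] s \<odot>\<^bsub>?P\<^esub> v \<in> X" if v: "v \<in> X" for s v
  proof -
    obtain a where a: "v \<ominus>\<^bsub>?P\<^esub> path_comb L (S 0) \<sigma> a \<in> ?U"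
      and c: "v \<in> carrier ?P" using v by (auto simp: X_def)
    have sc: "path_vec [] s \<in> carrier (trunc_path_algebra L)" by (simp add: path_vec_closed)
    have c': "path_vec [] s \<odot>\<^bsub>?P\<^esub> v \<in> carrier ?P" by (rule smult_closed[OF sc c])
    have c'': "v \<ominus>\<^bsub>?P\<^esub> path_comb L (S 0) \<sigma> a \<in> carrier ?P" by (rule M.minus_closed[OF c comb])
    have "(path_vec [] s \<odot>\<^bsub>?P\<^esub> v) \<ominus>\<^bsub>?P\<^esub> path_comb L (S 0) \<sigma> (\<lambda>y. s * a y) =
        path_vec [] s \<odot>\<^bsub>?P\<^esub> (v \<ominus>\<^bsub>?P\<^esub> path_comb L (S 0) \<sigma> a)"
    proof (rule free_path_module_eqI[where L = L and t = "S 0"])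
      show "(path_vec [] s \<odot>\<^bsub>?P\<^esub> v) \<ominus>\<^bsub>?P\<^esub> path_comb L (S 0) \<sigma> (\<lambda>y. s * a y) \<in> carrier ?P"
        by (rule M.minus_closed[OF c' comb])
      show "path_vec [] s \<odot>\<^bsub>?P\<^esub> (v \<ominus>\<^bsub>?P\<^esub> path_comb L (S 0) \<sigma> a) \<in> carrier ?P"
        by (rule smult_closed[OF sc c''])
      fix j and p :: "'r list" assume j: "j < S 0"
      show "((path_vec [] s \<odot>\<^bsub>?P\<^esub> v) \<ominus>\<^bsub>?P\<^esub> path_comb L (S 0) \<sigma> (\<lambda>y. s * a y)) j p =
          (path_vec [] s \<odot>\<^bsub>?P\<^esub> (v \<ominus>\<^bsub>?P\<^esub> path_comb L (S 0) \<sigma> a)) j p"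
        unfolding minus_coord[OF c' comb j] scalar_coord[OF c'' j] scalar_coord[OF c j] minus_coord[OF c comb j] coord[OF j]
        by (simp add: right_diff_distrib)
    qed
    then have "(path_vec [] s \<odot>\<^bsub>?P\<^esub> v) \<ominus>\<^bsub>?P\<^esub> path_comb L (S 0) \<sigma> (\<lambda>y. s * a y) \<in> ?U"
      using submoduleD(4)[OF U sc a] by simp
    then show ?thesis using c' unfolding X_def by (intro CollectI conjI exI) auto
  qed
  have Xc: "X \<subseteq> carrier ?P" by (auto simp: X_def)
  have zero: "\<zero>\<^bsub>?P\<^esub> \<in> X" using UX submoduleD(2)[OF U] by blast
  have \<sigma>X: "path_elem L (S 0) y \<in> X" if y: "y \<in> \<sigma>" for y
  proof -
    have y': "y \<in> paths_in L (S 0)" using y \<sigma> by blast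
    have "path_elem L (S 0) y \<ominus>\<^bsub>?P\<^esub> path_comb L (S 0) \<sigma> (\<lambda>w. if w = y then 1 else 0) = \<zero>\<^bsub>?P\<^esub>"
      using y by (intro free_path_module_eqI[where L = L and t = "S 0"] M.minus_closed comb path_elem_closed y')
        (auto simp: minus_coord comb coord path_elem_closed y' path_elem_coord)
    then have "path_elem L (S 0) y \<ominus>\<^bsub>?P\<^esub> path_comb L (S 0) \<sigma> (\<lambda>w. if w = y then 1 else 0) \<in> ?U"
      using submoduleD(2)[OF U] by simp
    then show ?thesis using path_elem_closed[OF y'] unfolding X_def by blast
  qed
  note mem = path_comb_mem[OF _ Xc zero add scalar]
  \<comment> \<open>Induction on the part r that lies to the left of a skeleton path q, with q
    arbitrary. Rewriting the critical path \<open>s # q\<close> replaces it by skeleton paths, so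
    only the shorter word r remains outside, however long the new paths are; products of length
    above L vanish.\<close>
  have reduce: "path_elem L (S 0) (r @ q, i) \<in> X" if "(q, i) \<in> \<sigma>" "length (r @ q) \<le> L" for r q i
    using that
  proof (induction r arbitrary: q i rule: rev_induct)
    case Nil
    then show ?case using \<sigma>X by simp
  next
    case (snoc s r)
    show ?case
    proof (cases "(s # q, i) \<in> \<sigma>")
      case True
      then show ?thesis using snoc.IH[OF True] snoc.prems by simp
    next
      case False
      let ?y = "(s # q, i)"
      have y: "?y \<in> critical L (S 0) \<sigma>" using critical_Cons[OF sk snoc.prems(1) False] snoc.prems(2) by simp
      then have y': "?y \<in> paths_in L (S 0)" using critical_subset by blast
      have rc: "path_vec r 1 \<in> carrier (trunc_path_algebra L :: ('r list \<Rightarrow> 'k) ring)" and rL: "length r \<le> L"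
        using snoc.prems(2) by (simp_all add: path_vec_closed)
      let ?rel = "critical_relation L (S 0) \<sigma> c ?y"
      let ?comb = "path_comb L (S 0) (sigma_above \<sigma> ?y) (\<lambda>w. c (?y, w))"
      note ab = sigma_above_subset[OF sk, of ?y]
      have relc: "?rel \<in> carrier ?P" by (rule critical_relation_closed[OF sk y])
      have "path_elem L (S 0) ?y = ?rel \<oplus>\<^bsub>?P\<^esub> ?comb"
        unfolding critical_relation_eq
        by (intro free_path_module_eqI[where L = L and t = "S 0"] M.add.m_closed M.minus_closed path_elem_closed[OF y'] path_comb_closed[OF ab])
           (simp add: minus_coord[OF path_elem_closed[OF y'] path_comb_closed[OF ab]])
      then have "path_vec r 1 \<odot>\<^bsub>?P\<^esub> path_elem L (S 0) ?y = (path_vec r 1 \<odot>\<^bsub>?P\<^esub> ?rel) \<oplus>\<^bsub>?P\<^esub> (path_vec r 1 \<odot>\<^bsub>?P\<^esub> ?comb)"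
        using smult_r_distr[OF rc relc path_comb_closed[OF ab]] by simp
      moreover have "path_vec r 1 \<odot>\<^bsub>?P\<^esub> path_elem L (S 0) ?y = path_elem L (S 0) (r @ s # q, i)"
        using path_vec_smult_path_elem[OF y' rL] snoc.prems(2) by simp
      moreover have "path_vec r 1 \<odot>\<^bsub>?P\<^esub> ?rel \<in> X"
        using submoduleD(4)[OF U rc critical_relation_mem[OF y]] UX by blast
      moreover have "path_vec r 1 \<odot>\<^bsub>?P\<^esub> ?comb \<in> X"
      proof -
        \<comment> \<open>The preimage of X under left multiplication by r. It is a subspace because
          scalars commute with paths, so the combination can be treated path by path.\<close>
        define X' where "X' = {v \<in> carrier ?P. path_vec r 1 \<odot>\<^bsub>?P\<^esub> v \<in> X}"
        have "?comb \<in> X'"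
        proof (rule path_comb_mem[OF ab])
          show "X' \<subseteq> carrier ?P" by (auto simp: X'_def)
          have "path_vec r 1 \<odot>\<^bsub>?P\<^esub> \<zero>\<^bsub>?P\<^esub> = \<zero>\<^bsub>?P\<^esub>"
            by (rule free_path_module_eqI[where L = L and t = "S 0"]) (auto intro: smult_closed rc simp: path_conv_def)
          then show "\<zero>\<^bsub>?P\<^esub> \<in> X'" using zero by (simp add: X'_def)
          show "v \<oplus>\<^bsub>?P\<^esub> w \<in> X'" if "v \<in> X'" "w \<in> X'" for v w
            using that add smult_r_distr[OF rc] by (simp add: X'_def)
          show "path_vec [] s \<odot>\<^bsub>?P\<^esub> v \<in> X'" if v: "v \<in> X'" for s v
          proof -
            have sc: "path_vec [] s \<in> carrier (trunc_path_algebra L :: ('r list \<Rightarrow> 'k) ring)" by (simp add: path_vec_closed)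
            have vc: "v \<in> carrier ?P" using v by (simp add: X'_def)
            have comm: "path_vec r 1 \<otimes>\<^bsub>trunc_path_algebra L\<^esub> path_vec [] s = path_vec [] s \<otimes>\<^bsub>trunc_path_algebra L\<^esub> path_vec r 1"
              by (simp add: trunc_path_algebra_def path_conv_path_vec cong: if_cong)
            have "path_vec r 1 \<odot>\<^bsub>?P\<^esub> (path_vec [] s \<odot>\<^bsub>?P\<^esub> v) = path_vec [] s \<odot>\<^bsub>?P\<^esub> (path_vec r 1 \<odot>\<^bsub>?P\<^esub> v)"
              using smult_assoc[OF rc sc vc] smult_assoc[OF sc rc vc] comm by simp
            then show ?thesis using v scalar smult_closed[OF sc vc] by (simp add: X'_def)
          qed
          fix w assume w: "w \<in> sigma_above \<sigma> ?y"
          obtain q' i' where qi: "w = (q', i')" by fastforce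
          have w': "(q', i') \<in> \<sigma>" "(q', i') \<in> paths_in L (S 0)" using w ab qi by (auto simp: sigma_above_def)
          have "path_vec r 1 \<odot>\<^bsub>?P\<^esub> path_elem L (S 0) (q', i') \<in> X"
            using path_vec_smult_path_elem[OF w'(2) rL, where 'k = 'k] snoc.IH[OF w'(1)] zero by simp
          then show "path_elem L (S 0) w \<in> X'" using path_elem_closed[OF w'(2)] qi by (simp add: X'_def)
        qed
        then show ?thesis by (simp add: X'_def)
      qed
      ultimately show ?thesis using add by simp
    qed
  qed
  have "path_elem L (S 0) y \<in> X" if y: "y \<in> paths_in L (S 0)" for y
    using reduce[of "[]" "snd y" "fst y"] skeleton_Nil[OF sk, of "snd y"] y by (auto simp: paths_in_def)
  then have "path_comb L (S 0) (paths_in L (S 0)) (\<lambda>(p, j). v j p) \<in> X" by (intro mem) auto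
  then have "v \<in> X" unfolding path_comb_paths_in[OF v, symmetric] .
  then show ?thesis by (simp add: X_def)
qed

text \<open>Evaluation at z is onto because the skeleton family is a basis, and it kills the
  generators of \<open>U(c)\<close> by the relations. An element of the kernel is congruent modulo
  \<open>U(c)\<close> to a combination of skeleton paths; this still evaluates to 0, so its
  coefficients vanish by independence.\<close>

lemma (in skeleton_enumeration) module_iso_of_skeleton_relations:
  fixes x :: "'r \<Rightarrow> 'k::field ^ 'd ^ 'd"
  assumes x: "x \<in> rep_variety L" and det: "det (of_columns (skeleton_family e x z)) \<noteq> 0"
    and rel: "skeleton_relations L (S 0) \<sigma> c x z"
  shows "module_iso (trunc_path_algebra L) (rep_module L x)
    (quotient_module (free_path_module L (S 0)) (relation_submodule L (S 0) \<sigma> c))"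
proof (rule module_iso_quotient_kernel)
  let ?T = "trunc_path_algebra L :: ('r list \<Rightarrow> 'k) ring"
  let ?P = "free_path_module L (S 0) :: (_, nat \<Rightarrow> 'r list \<Rightarrow> 'k) module"
  let ?U = "relation_submodule L (S 0) \<sigma> c"
  let ?\<Phi> = "eval_hom L (S 0) x z"
  show "left_module ?T ?P" by (rule left_module_free_path_module)
  then interpret P: left_module ?T ?P .
  show "left_module ?T (rep_module L x)" by (rule left_module_rep_module[OF x])
  show "?\<Phi> v \<in> carrier (rep_module L x)" for v by (simp add: rep_module_def)
  show add: "?\<Phi> (v \<oplus>\<^bsub>?P\<^esub> w) = ?\<Phi> v \<oplus>\<^bsub>rep_module L x\<^esub> ?\<Phi> w" for v w
    by (simp add: eval_hom_add) (simp add: rep_module_def)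
  show smult: "?\<Phi> (a \<odot>\<^bsub>?P\<^esub> v) = a \<odot>\<^bsub>rep_module L x\<^esub> ?\<Phi> v" if "a \<in> carrier ?T" "v \<in> carrier ?P" for a v
    by (rule eval_hom_smult[OF x that])
  have \<sigma>: "\<sigma> \<subseteq> paths_in L (S 0)" using skel by (simp add: skeleton_def)
  have comb: "?\<Phi> (path_comb L (S 0) \<sigma> a) = (\<Sum>j\<in>UNIV. a (e j) *s skeleton_family e x z j)" for a
    unfolding eval_hom_path_comb[OF \<sigma>] skeleton_family_def
    by (rule sum.reindex_bij_betw[OF e, symmetric])
  show "\<exists>v\<in>carrier ?P. ?\<Phi> v = n" for n
  proof -
    have "invertible (of_columns (skeleton_family e x z))" using det by (simp add: invertible_det_nz)
    then have "\<exists>w. of_columns (skeleton_family e x z) *v w = n"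
      by (metis invertible_right_inverse matrix_right_invertible_surjective surjD)
    then obtain w where w: "(\<Sum>j\<in>UNIV. w $ j *s skeleton_family e x z j) = n" unfolding of_columns_mult ..
    have "?\<Phi> (path_comb L (S 0) \<sigma> (\<lambda>y. w $ inv_into UNIV e y)) = n"
      unfolding comb using w inj_e by simp
    then show ?thesis using path_comb_closed[OF \<sigma>] by blast
  qed
  have zero: "\<zero>\<^bsub>rep_module L x\<^esub> = 0" by (simp add: rep_module_def)
  have "?\<Phi> u = 0" and uc: "u \<in> carrier ?P" if u: "u \<in> ?U" for u
  proof -
    have "submodule {v \<in> carrier ?P. ?\<Phi> v = 0} ?T ?P"
    proof (rule P.submoduleI)
      show "\<zero>\<^bsub>?P\<^esub> \<in> {v \<in> carrier ?P. ?\<Phi> v = 0}"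
        by (auto simp: eval_hom_eq paths_in_def intro!: sum.neutral)
      fix a v assume a: "a \<in> carrier ?T" and v: "v \<in> {v \<in> carrier ?P. ?\<Phi> v = 0}"
      have "a \<odot>\<^bsub>rep_module L x\<^esub> 0 = 0" by (simp add: rep_module_def)
      then show "a \<odot>\<^bsub>?P\<^esub> v \<in> {v \<in> carrier ?P. ?\<Phi> v = 0}"
        using smult[OF a, of v] a v P.smult_closed by simp
    qed (auto simp: eval_hom_add)
    moreover have "?\<Phi> (critical_relation L (S 0) \<sigma> c y) = 0" if y: "y \<in> critical L (S 0) \<sigma>" for y
    proof -
      have y': "y \<in> paths_in L (S 0)" using y critical_subset by blast
      note ab = sigma_above_subset[OF skel, of y]
      show ?thesis
        using rel y unfolding critical_relation_eq eval_hom_minus[OF path_elem_closed[OF y'] path_comb_closed[OF ab]]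
          eval_hom_path_comb[OF ab] eval_hom_path_elem[OF y'] skeleton_relations_def by simp
    qed
    ultimately have "?U \<subseteq> {v \<in> carrier ?P. ?\<Phi> v = 0}"
      unfolding relation_submodule_def using critical_relation_closed[OF skel]
      by (intro generated_submodule_least) auto
    then show "?\<Phi> u = 0" "u \<in> carrier ?P" using u by blast+
  qed
  moreover have "v \<in> ?U" if v: "v \<in> carrier ?P" "?\<Phi> v = 0" for v
  proof -
    obtain a where a: "v \<ominus>\<^bsub>?P\<^esub> path_comb L (S 0) \<sigma> a \<in> ?U"
      using ex_path_comb_mod_relation_submodule[OF skel v(1)] by blast
    have cc: "path_comb L (S 0) \<sigma> a \<in> carrier ?P" by (rule path_comb_closed[OF \<sigma>])
    have "?\<Phi> (v \<ominus>\<^bsub>?P\<^esub> path_comb L (S 0) \<sigma> a) = 0" using calculation(1)[OF a] .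
    then have "(\<Sum>j\<in>UNIV. a (e j) *s skeleton_family e x z j) = 0"
      unfolding eval_hom_minus[OF v(1) cc] comb v(2) by simp
    then have "a (e j) = 0" for j
      using det[unfolded det_of_columns_nonzero_iff, THEN spec, of "\<lambda>j. a (e j)"] by simp
    then have "a y = 0" if "y \<in> \<sigma>" for y using e_inverse[OF that] by metis
    then have "v \<ominus>\<^bsub>?P\<^esub> path_comb L (S 0) \<sigma> a = v"
      by (intro free_path_module_eqI[where L = L and t = "S 0"] P.M.minus_closed v(1) cc) (auto simp: minus_coord[OF v(1) cc] path_comb_coord[OF \<sigma>])
    then show ?thesis using a by simp
  qed
  ultimately show "?U = {v \<in> carrier ?P. ?\<Phi> v = \<zero>\<^bsub>rep_module L x\<^esub>}" unfolding zero by blast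
qed

text \<open>Nakayama: the relations lie in the radical of the free module, and the radical is nilpotent.\<close>

lemma superfluous_relation_submodule:
  fixes \<sigma> :: "('r::finite list \<times> nat) set"
  assumes sk: "skeleton L S \<sigma>"
  shows "superfluous (trunc_path_algebra L) (free_path_module L (S 0) :: (_, nat \<Rightarrow> 'r list \<Rightarrow> 'k::field) module)
    (relation_submodule L (S 0) \<sigma> c)"
  unfolding superfluous_def
proof (intro conjI allI impI submodule_relation_submodule sk)
  let ?T = "trunc_path_algebra L :: ('r list \<Rightarrow> 'k) ring"
  let ?P = "free_path_module L (S 0) :: (_, nat \<Rightarrow> 'r list \<Rightarrow> 'k) module"
  let ?U = "relation_submodule L (S 0) \<sigma> c"
  interpret P: left_module ?T ?P by (rule left_module_free_path_module)
  \<comment> \<open>The radical of the free module in coordinates: no path of length 0 occurs.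
    Critical paths have positive length because \<sigma> contains all \<open>z i\<close>.\<close>
  let ?J = "{v \<in> carrier ?P. \<forall>j<S 0. v j [] = 0}"
  have UJ: "?U \<subseteq> ?J"
    unfolding relation_submodule_def
  proof (rule generated_submodule_least)
    show "submodule ?J ?T ?P"
      by (rule P.submoduleI) (auto simp: P.smult_closed path_conv_def)
    show "critical_relation L (S 0) \<sigma> c ` critical L (S 0) \<sigma> \<subseteq> ?J"
    proof (intro image_subsetI CollectI conjI allI impI critical_relation_closed[OF sk])
      fix y j assume y: "y \<in> critical L (S 0) \<sigma>" and j: "j < S 0"
      have y': "y \<in> paths_in L (S 0)" using y critical_subset by blast
      note ab = sigma_above_subset[OF sk, of y]
      have "fst y \<noteq> []" using critical_cases[OF sk, of "fst y" "snd y"] y by (metis list.distinct(1) prod.collapse)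
      then show "critical_relation L (S 0) \<sigma> c y j [] = 0"
        unfolding critical_relation_eq minus_coord[OF path_elem_closed[OF y'] path_comb_closed[OF ab] j]
          path_elem_coord[OF y' j] path_comb_coord[OF ab j]
        by (auto simp: sigma_above_def)
    qed
  qed
  fix X assume "submodule X ?T ?P \<and> ?U <+>\<^bsub>?P\<^esub> X = carrier ?P"
  then have X: "submodule X ?T ?P" and UX: "?U <+>\<^bsub>?P\<^esub> X = carrier ?P" by blast+
  note mem = path_comb_mem[OF _ submoduleD(1-3)[OF X] submoduleD(4)[OF X path_vec_closed]]
  \<comment> \<open>Descending induction on the length of p. Write the basis element as u + w with u
    in U and w in X and multiply by p: since u has no part of length 0, the product of p and u
    involves only paths longer than p, which are in X already.\<close>
  have "path_elem L (S 0) (p, i) \<in> X" if "(p, i) \<in> paths_in L (S 0)" for p i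
    using that
  proof (induction "L - length p" arbitrary: p i rule: less_induct)
    case less
    have i: "i < S 0" "length p \<le> L" using less.prems by (auto simp: paths_in_def)
    have z: "([], i) \<in> paths_in L (S 0)" using i by (simp add: paths_in_def)
    have pc: "path_vec p 1 \<in> carrier ?T" using i by (simp add: path_vec_closed)
    have "path_elem L (S 0) ([], i) \<in> ?U <+>\<^bsub>?P\<^esub> X" using path_elem_closed[OF z] UX by simp
    then obtain u w where uw: "u \<in> ?U" "w \<in> X" "path_elem L (S 0) ([], i) = u \<oplus>\<^bsub>?P\<^esub> w"
      by (auto simp: set_add_def')
    have uc: "u \<in> carrier ?P" and u0: "\<And>j. j < S 0 \<Longrightarrow> u j [] = 0" using uw(1) UJ by auto
    have wc: "w \<in> carrier ?P" using uw(2) submoduleD(1)[OF X] by blast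
    have puc: "path_vec p 1 \<odot>\<^bsub>?P\<^esub> u \<in> carrier ?P" by (rule P.smult_closed[OF pc uc])
    have u_coord: "(path_vec p 1 \<odot>\<^bsub>?P\<^esub> u) j q = 0" if j: "j < S 0" and q: "length q \<le> length p" for j q
    proof -
      have "path_vec p (1 :: 'k) (take k q) * u j (drop k q) = 0" if k: "k \<le> length q" for k
        using u0[OF j] q k by (cases "take k q = p") (auto simp: path_vec_def)
      then have "path_conv (path_vec p 1) (u j) q = 0"
        unfolding path_conv_def by (intro sum.neutral) auto
      then show ?thesis using j by simp
    qed
    have "path_vec p 1 \<odot>\<^bsub>?P\<^esub> u = path_comb L (S 0) (paths_in L (S 0)) (\<lambda>(q, j). (path_vec p 1 \<odot>\<^bsub>?P\<^esub> u) j q)"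
      by (rule path_comb_paths_in[OF puc])
    also have "\<dots> \<in> X"
    proof (intro mem)
      fix y assume y: "y \<in> paths_in L (S 0)" "(case y of (q, j) \<Rightarrow> (path_vec p 1 \<odot>\<^bsub>?P\<^esub> u) j q) \<noteq> 0"
      obtain q j where qj: "y = (q, j)" by fastforce
      have "j < S 0" "length q \<le> L" using y(1) qj by (auto simp: paths_in_def)
      then have "\<not> length q \<le> length p" using u_coord[of j q] y(2) qj by auto
      then show "path_elem L (S 0) y \<in> X"
        using less.hyps[of q j] y(1) qj \<open>length q \<le> L\<close> by simp
    qed auto
    finally have "path_vec p 1 \<odot>\<^bsub>?P\<^esub> u \<in> X" .
    moreover have "path_vec p 1 \<odot>\<^bsub>?P\<^esub> w \<in> X" by (rule submoduleD(4)[OF X pc uw(2)])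
    ultimately have "path_vec p 1 \<odot>\<^bsub>?P\<^esub> path_elem L (S 0) ([], i) \<in> X"
      unfolding uw(3) P.smult_r_distr[OF pc uc wc] by (rule submoduleD(3)[OF X])
    then show ?case using path_vec_smult_path_elem[OF z i(2), where 'k = 'k] i(2) by simp
  qed
  then have all: "path_comb L (S 0) (paths_in L (S 0)) a \<in> X" for a by (intro mem) auto
  have "carrier ?P \<subseteq> X"
  proof
    fix v assume v: "v \<in> carrier ?P"
    from all[of "\<lambda>(p, j). v j p"] show "v \<in> X" unfolding path_comb_paths_in[OF v, symmetric] .
  qed
  then show "X = carrier ?P" using submoduleD(1)[OF X] by blast
qed

section \<open>The generic modules of a layer\<close>

text \<open>A rank that is too large at x would be too large on a neighbourhood of x, which meets
  the layer. Inside the closure the open lower bounds alone therefore cut out the layer.\<close>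

lemma rep_layer_of_closure:
  fixes x :: "'r::finite \<Rightarrow> 'k::field ^ 'd::finite ^ 'd"
  assumes L: "1 \<le> L" and x: "x \<in> rep_topology L closure_of rep_layer L S"
    and ge: "\<And>l. l \<le> L \<Longrightarrow> sum S {l..L} \<le> vec.dim (path_space x l)"
  shows "x \<in> rep_layer L S"
proof -
  let ?A = "rep_layer L S :: ('r \<Rightarrow> 'k ^ 'd ^ 'd) set"
  have xv: "x \<in> rep_variety L" using closure_of_subset_topspace[of "rep_topology L" ?A] x by auto
  have "vec.dim (path_space x l) \<le> sum S {l..L}" for l
  proof (rule ccontr)
    let ?V = "rep_variety L \<inter> {y :: 'r \<Rightarrow> 'k ^ 'd ^ 'd. Suc (sum S {l..L}) \<le> vec.dim (path_space y l)}"
    assume "\<not> vec.dim (path_space x l) \<le> sum S {l..L}"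
    then have "x \<in> ?V \<inter> (rep_topology L closure_of ?A)" using x xv by simp
    moreover have "openin (rep_topology L) ?V"
      unfolding rep_topology_def by (intro openin_subtopology_Int2 openin_zariski_dim_path_space_ge)
    ultimately have "?V \<inter> ?A \<noteq> {}" using openin_Int_closure_of_eq_empty by (metis empty_iff)
    moreover have "y \<notin> ?V" if "y \<in> ?A" for y
      using that unfolding rep_layer_iff[OF L] by simp
    ultimately show False by blast
  qed
  then have "vec.dim (path_space x l) = sum S {l..L}" for l
    using ge[of l] path_space_eq_0[OF xv, of l] by (cases "l \<le> L") (simp_all add: order_antisym)
  then show ?thesis using xv by (simp add: rep_layer_iff[OF L])
qed

lemma finite_coord_pairs:
  fixes \<sigma> :: "('r::finite list \<times> nat) set"
  assumes "skeleton L S \<sigma>"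
  shows "finite (coord_pairs L (S 0) \<sigma>)"
  unfolding coord_pairs_def
  by (intro finite_SigmaI finite_subset[OF critical_subset] finite_subset[OF sigma_above_subset[OF assms]]
      finite_paths_in)

theorem mainTheorem2:
  fixes L :: nat and S :: "nat \<Rightarrow> nat"
    and \<sigma> :: "('r::finite list \<times> nat) set"
    and \<Lambda> :: "('r list \<Rightarrow> 'k::alg_closed_field) ring"
    and P :: "('r list \<Rightarrow> 'k, nat \<Rightarrow> 'r list \<Rightarrow> 'k) module"
    and M :: "('r \<Rightarrow> 'k ^ 'd::finite ^ 'd) \<Rightarrow> ('r list \<Rightarrow> 'k, 'k ^ 'd) module"
    and U :: "(('r list \<times> nat) \<times> ('r list \<times> nat) \<Rightarrow> 'k) \<Rightarrow> (nat \<Rightarrow> 'r list \<Rightarrow> 'k) set"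
    and Rep :: "('r \<Rightarrow> 'k ^ 'd ^ 'd) topology"
    and C :: "('r \<Rightarrow> 'k ^ 'd ^ 'd) set"
    and I :: "(('r list \<times> nat) \<times> ('r list \<times> nat)) set"
  assumes "CARD('r) \<ge> 2" and "L \<ge> 1"
    and "(\<Sum>l\<le>L. S l) = CARD('d)"
    and "\<forall>l\<in>{1..L}. S l \<le> CARD('r) * S (l - 1)"
    and "\<forall>l\<in>{1..L}. S (l - 1) \<le> CARD('r) * S l"
    and "skeleton L S \<sigma>"
    and "\<Lambda> = trunc_path_algebra L"
    and "P = free_module \<Lambda> (S 0)"
    and "M = rep_module L"
    and "U = relation_submodule L (S 0) \<sigma>"
    and "Rep = rep_topology L"
    and "C = Rep closure_of rep_layer L S"
    and "I = coord_pairs L (S 0) \<sigma>"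
  shows "irreducible_component Rep C \<and>
    generically Rep C (\<lambda>x. \<exists>c \<in> I \<rightarrow>\<^sub>E UNIV. minimal_presentation \<Lambda> P (U c) (M x)) \<and>
    finite I \<and>
    (\<exists>\<UU>. dense_open_in Rep C \<UU> \<and>
       (\<forall>x\<in>\<UU>. \<exists>c \<in> I \<rightarrow>\<^sub>E UNIV. module_iso \<Lambda> (M x) (quotient_module P (U c))) \<and>
       (\<forall>c \<in> I \<rightarrow>\<^sub>E UNIV. \<exists>x\<in>\<UU>. module_iso \<Lambda> (M x) (quotient_module P (U c))))"
proof -
  note eqs = assms(7-13)
  let ?A = "rep_layer L S :: ('r \<Rightarrow> 'k ^ 'd ^ 'd) set"
  have L: "1 \<le> L" by fact
  have sk: "skeleton L S \<sigma>" by fact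
  have "card \<sigma> = CARD('d)" using card_skeleton[OF sk] assms(3) by simp
  then obtain e :: "'d \<Rightarrow> 'r list \<times> nat" where e: "bij_betw e UNIV \<sigma>"
    using finite_skeleton[OF sk] by (metis bij_betw_iff_card finite)
  interpret skeleton_enumeration L S \<sigma> e by unfold_locales (fact sk e L)+
  let ?det = "\<lambda>x z. det (of_columns (skeleton_family e x z)) \<noteq> (0 :: 'k)"
  \<comment> \<open>For each fixed z the determinant condition is open. Taking the union over all z
    keeps it open, without making z depend on x in any regular way.\<close>
  define W where "W = rep_variety L \<inter> ({x :: 'r \<Rightarrow> 'k ^ 'd ^ 'd. \<forall>l\<le>L. sum S {l..L} \<le> vec.dim (path_space x l)} \<inter>
    (\<Union>z. {x. ?det x z}))"
  define \<UU> where "\<UU> = W \<inter> C"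
  have W: "openin Rep W"
    unfolding W_def eqs rep_topology_def
    by (intro openin_subtopology_Int2 openin_Int openin_zariski_dim_path_spaces_ge openin_Union)
       (auto intro: openin_zariski_skeleton_family)
  have AW: "x \<in> W" if "x \<in> ?A" "?det x z" for x z
    using that unfolding W_def rep_layer_iff[OF L] by auto
  \<comment> \<open>Any coefficients would do; c = 0 already shows that the layer is nonempty and
    that W meets it.\<close>
  obtain x0 :: "'r \<Rightarrow> 'k ^ 'd ^ 'd" and z0 where x0: "x0 \<in> ?A" "?det x0 z0"
    using ex_rep_layer_with_relations[of "\<lambda>_. 0"] by blast
  have irr: "irreducible_subset Rep ?A"
    unfolding eqs using x0(1) by (intro rep_layer_irreducible[OF card_level level_le L]) auto
  have "\<exists>V. openin Rep V \<and> V \<noteq> {} \<and> V \<subseteq> ?A"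
    unfolding eqs by (rule ex_open_subset_rep_layer[OF card_level level_le L assms(4,5)])
  then have component: "irreducible_component Rep C"
    unfolding \<open>C = Rep closure_of rep_layer L S\<close> using irreducible_component_closure_of[OF irr] by blast
  have dense: "dense_open_in Rep C \<UU>"
    unfolding \<UU>_def using x0 AW by (intro dense_open_in_irreducible[OF irr W]) (auto simp: eqs)
  have AC: "?A \<subseteq> C"
    unfolding eqs by (rule closure_of_subset) (auto simp: rep_layer_def)
  have pres: "\<exists>c \<in> I \<rightarrow>\<^sub>E UNIV. module_iso \<Lambda> (M x) (quotient_module P (U c))" if x: "x \<in> \<UU>" for x
  proof -
    obtain z where z: "?det x z" and xC: "x \<in> C"
      and ge: "\<And>l. l \<le> L \<Longrightarrow> sum S {l..L} \<le> vec.dim (path_space x l)"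
      using x by (auto simp: \<UU>_def W_def)
    \<comment> \<open>Points of \<UU> are in the layer and not merely in its closure, so the
      critical paths can be expanded in the skeleton basis.\<close>
    have xA: "x \<in> ?A" using rep_layer_of_closure[OF L _ ge] xC unfolding eqs by blast
    then have xv: "x \<in> rep_variety L" by (simp add: rep_layer_def)
    obtain c where "c \<in> coord_pairs L (S 0) \<sigma> \<rightarrow>\<^sub>E UNIV" "skeleton_relations L (S 0) \<sigma> c x z"
      using ex_skeleton_relations[OF xA z] by blast
    then show ?thesis using module_iso_of_skeleton_relations[OF xv z] unfolding eqs by blast
  qed
  \<comment> \<open>The explicit module with coefficients c lies in the layer and satisfies the
    determinant condition for its own generators, hence it is a point of \<UU>.\<close>
  have real: "\<exists>x\<in>\<UU>. module_iso \<Lambda> (M x) (quotient_module P (U c))" for c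
  proof -
    obtain x :: "'r \<Rightarrow> 'k ^ 'd ^ 'd" and z where x: "x \<in> ?A" "?det x z" "skeleton_relations L (S 0) \<sigma> c x z"
      using ex_rep_layer_with_relations[of c] by blast
    have "x \<in> rep_variety L" using x(1) by (simp add: rep_layer_def)
    then have "module_iso \<Lambda> (M x) (quotient_module P (U c))"
      unfolding eqs by (rule module_iso_of_skeleton_relations[OF _ x(2,3)])
    moreover have "x \<in> \<UU>" unfolding \<UU>_def using AW[OF x(1,2)] AC x(1) by blast
    ultimately show ?thesis by blast
  qed
  have "superfluous \<Lambda> P (U c)" for c
    unfolding eqs by (rule superfluous_relation_submodule[OF sk])
  then have "generically Rep C (\<lambda>x. \<exists>c \<in> I \<rightarrow>\<^sub>E UNIV. minimal_presentation \<Lambda> P (U c) (M x))"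
    unfolding generically_def minimal_presentation_def using dense pres by (intro exI[of _ \<UU>]) blast
  moreover have "finite I" unfolding eqs by (rule finite_coord_pairs[OF sk])
  ultimately show ?thesis
    by (intro conjI component exI[of _ \<UU>] dense ballI pres real)
qed

end
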